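(* Let $\mathcal{A}$ be a unital $*$-algebra, $\mathcal{H}$ a Kreĭn space, and let $T:\mathcal{A}\to\mathcal{L}(\mathcal{H})$ be a linear hermitian map. Let $K_T(x,y)=T(xy^* )$ for $x,y\in\mathcal{A}$. The following assertions are equivalent: (1) There exists a positive definite kernel $L\in\mathcal{B}_\phi^+(\mathcal{A},\mathcal{H})$, where $\phi(a,x)=xa^*$ for $a,x\in\mathcal{A}$, such that $-L\le K_T\le L$. (2) $T$ has a minimal Stinespring dilation.
   Context: A Kreĭn space is an indefinite inner product space $(\mathcal{H},[\cdot,\cdot])$ for which there is a positive inner product $\langle\cdot,\cdot\rangle$ turning $\mathcal{H}$ into a Hilbert space, and $J=J^*=J^{-1}$ on $\mathcal{H}$, with $[\xi,\eta]=\langle J\xi,\eta\rangle$. $\mathcal{L}(\mathcal{H},\mathcal{K})$ is the set of bounded linear operators; $\sharp$ denotes the adjoint with respect to the indefinite inner products. $\mathcal{A}$ is a complex $*$-algebra with identity; $T$ is hermitian if $T(a^* )=T(a)^\sharp$. Stinespring dilation of $T$: a triple $(\pi,\mathcal{K},B)$ where $\mathcal{K}$ is a Kreĭn space, $\pi:\mathcal{A}\to\mathcal{L}(\mathcal{K})$ is a selfadjoint representation (linear, multiplicative, $\pi(a^* )=\pi(a)^\sharp$), and $B\in\mathcal{L}(\mathcal{H},\mathcal{K})$ with $T(a)=B^\sharp\pi(a)B$ for all $a\in\mathcal{A}$. It is minimal if the linear span of $\bigcup_{a\in\mathcal{A}}\pi(a)B\mathcal{H}$ is dense in $\mathcal{K}$.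 Kernels. For a hermitian kernel $M:\mathcal{A}\times\mathcal{A}\to\mathcal{L}(\mathcal{H})$ ($M(x,y)=M(y,x)^\sharp$), let $[f,g]_M=\sum_{x,y}[M(x,y)f(y),g(x)]_{\mathcal{H}}$ on the space $\mathcal{F}_0(\mathcal{A},\mathcal{H})$ of finitely supported functions $\mathcal{A}\to\mathcal{H}$. $M$ is positive definite if $[f,f]_M\ge0$ for all $f$; $A\le B$ means $[f,f]_A\le[f,f]_B$ for all $f$. For $\xi\in\mathcal{H}$, $x\in\mathcal{A}$, $\xi_x$ is the function equal to $\xi$ at $x$ and $0$ elsewhere; for $a\in\mathcal{A}$, $\psi_a$ is the linear map on $\mathcal{F}_0(\mathcal{A},\mathcal{H})$ with $\psi_a(\xi_x)=\xi_{\phi(a,x)}=\xi_{xa^*}$. $\mathcal{B}_\phi^+(\mathcal{A},\mathcal{H})$ is the set of positive definite $\mathcal{L}(\mathcal{H})$-valued kernels $L$ on $\mathcal{A}$ that are $\phi$-bounded, i.e. for every $a\in\mathcal{A}$ the map $\psi_a$ is bounded with respect to the seminorm $[\cdot,\cdot]_L^{1/2}$. *)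

theory Defs
  imports "HOL-Analysis.Analysis" "HOL-Library.Function_Algebras"
begin

section \<open>Inner product spaces, Hilbert spaces and Krein spaces\<close>

text \<open>
  The carrier is a linear subspace of an ambient complex vector space (a type of class
  \<^class>\<open>ab_group_add\<close> with an explicit scalar multiplication), so that one can quantify
  existentially over spaces. Values of the form outside the carrier are irrelevant.
\<close>

record 'v ip_space =
  scl :: "complex \<Rightarrow> 'v \<Rightarrow> 'v"
  carr :: "'v set"
  form :: "'v \<Rightarrow> 'v \<Rightarrow> complex"

text \<open>Forms are linear in the first and conjugate-linear in the second variable.\<close>

definition indefinite_ip_space :: "'v::ab_group_add ip_space \<Rightarrow> bool" where
  "indefinite_ip_space V \<longleftrightarrow>
     vector_space (scl V) \<and> module.subspace (scl V) (carr V) \<and>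
     (\<forall>x\<in>carr V. \<forall>y\<in>carr V. \<forall>z\<in>carr V. form V (x + y) z = form V x z + form V y z) \<and>
     (\<forall>c. \<forall>x\<in>carr V. \<forall>y\<in>carr V. form V (scl V c x) y = c * form V x y) \<and>
     (\<forall>x\<in>carr V. \<forall>y\<in>carr V. form V y x = cnj (form V x y))"

definition ip_norm :: "'v ip_space \<Rightarrow> 'v \<Rightarrow> real" where
  "ip_norm V x = sqrt (Re (form V x x))"

text \<open>
  The locale \<^locale>\<open>Metric_space\<close> requires nonnegativity and symmetry of the distance on
  the whole type, hence the value 0 outside the carrier.
\<close>

definition ip_dist :: "'v::ab_group_add ip_space \<Rightarrow> 'v \<Rightarrow> 'v \<Rightarrow> real" where
  "ip_dist V x y = (if x \<in> carr V \<and> y \<in> carr V then ip_norm V (x - y) else 0)"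

definition hilbert_space :: "'v::ab_group_add ip_space \<Rightarrow> bool" where
  "hilbert_space V \<longleftrightarrow>
     indefinite_ip_space V \<and>
     (\<forall>x\<in>carr V. x \<noteq> 0 \<longrightarrow> Re (form V x x) > 0) \<and>
     Metric_space.mcomplete (carr V) (ip_dist V)"

definition hilbert_ops ::
    "'v::ab_group_add ip_space \<Rightarrow> 'w::ab_group_add ip_space \<Rightarrow> ('v \<Rightarrow> 'w) set" where
  "hilbert_ops V W =
     {A. (\<forall>x\<in>carr V. A x \<in> carr W) \<and>
         (\<forall>x\<in>carr V. \<forall>y\<in>carr V. A (x + y) = A x + A y) \<and>
         (\<forall>c. \<forall>x\<in>carr V. A (scl V c x) = scl W c (A x)) \<and>
         (\<exists>b. \<forall>x\<in>carr V. ip_norm W (A x) \<le> b * ip_norm V x)}"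

text \<open>
  The adjoint with respect to the given, possibly indefinite, forms. For bounded operators
  between Hilbert or Krein spaces the description is proper by the Riesz representation
  theorem and nondegeneracy.
\<close>

definition adjoint_op ::
    "'v ip_space \<Rightarrow> 'w ip_space \<Rightarrow> ('v \<Rightarrow> 'w) \<Rightarrow> 'w \<Rightarrow> 'v" where
  "adjoint_op V W A y =
     (THE x. x \<in> carr V \<and> (\<forall>z\<in>carr V. form V z x = form W (A z) y))"

text \<open>
  Here \<open>h\<close> is the positive inner product; \<open>J = J\<^sup>* = J\<^sup>-\<^sup>1\<close> is taken in the
  resulting Hilbert space.
\<close>

definition hilbert_majorant ::
    "'v::ab_group_add ip_space \<Rightarrow> ('v \<Rightarrow> 'v \<Rightarrow> complex) \<Rightarrow> bool" where
  "hilbert_majorant V h \<longleftrightarrow>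
     hilbert_space (V\<lparr>form := h\<rparr>) \<and>
     (\<exists>J \<in> hilbert_ops (V\<lparr>form := h\<rparr>) (V\<lparr>form := h\<rparr>).
        (\<forall>x\<in>carr V. adjoint_op (V\<lparr>form := h\<rparr>) (V\<lparr>form := h\<rparr>) J x = J x) \<and>
        (\<forall>x\<in>carr V. J (J x) = x) \<and>
        (\<forall>x\<in>carr V. \<forall>y\<in>carr V. form V x y = h (J x) y))"

definition krein_space :: "'v::ab_group_add ip_space \<Rightarrow> bool" where
  "krein_space V \<longleftrightarrow> indefinite_ip_space V \<and> (\<exists>h. hilbert_majorant V h)"

text \<open>
  All the Hilbert norms of a Krein space are equivalent, so boundedness and density do not
  depend on which one is chosen here.
\<close>

definition hilb :: "'v::ab_group_add ip_space \<Rightarrow> 'v ip_space" where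
  "hilb V = V\<lparr>form := (SOME h. hilbert_majorant V h)\<rparr>"

definition krein_ops ::
    "'v::ab_group_add ip_space \<Rightarrow> 'w::ab_group_add ip_space \<Rightarrow> ('v \<Rightarrow> 'w) set" where
  "krein_ops V W = hilbert_ops (hilb V) (hilb W)"

definition krein_dense :: "'v::ab_group_add ip_space \<Rightarrow> 'v set \<Rightarrow> bool" where
  "krein_dense V D \<longleftrightarrow>
     Metric_space.mtopology (carr V) (ip_dist (hilb V)) closure_of D = carr V"


section \<open>Complex unital *-algebras\<close>

locale unital_star_algebra = vector_space scale
  for scale :: "complex \<Rightarrow> 'a::{ring,monoid_mult} \<Rightarrow> 'a" +
  fixes star :: "'a \<Rightarrow> 'a"
  assumes scale_mult_left: "scale c x * y = scale c (x * y)"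
    and scale_mult_right: "x * scale c y = scale c (x * y)"
    and star_add: "star (x + y) = star x + star y"
    and star_scale: "star (scale c x) = scale (cnj c) (star x)"
    and star_mult: "star (x * y) = star y * star x"
    and star_star: "star (star x) = x"


section \<open>Kernels\<close>

text \<open>From here on \<open>H\<close> is a space whose carrier is the whole type.\<close>

definition fin_supp :: "('a \<Rightarrow> 'h::zero) set" where
  "fin_supp = {f. finite {x. f x \<noteq> 0}}"

definition kernel_form ::
    "'h::ab_group_add ip_space \<Rightarrow> ('a \<Rightarrow> 'a \<Rightarrow> 'h \<Rightarrow> 'h) \<Rightarrow> ('a \<Rightarrow> 'h) \<Rightarrow> ('a \<Rightarrow> 'h) \<Rightarrow> complex" where
  "kernel_form H M f g =
     (\<Sum>x | g x \<noteq> 0. \<Sum>y | f y \<noteq> 0. form H (M x y (f y)) (g x))"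

definition hermitian_kernel ::
    "'h::ab_group_add ip_space \<Rightarrow> ('a \<Rightarrow> 'a \<Rightarrow> 'h \<Rightarrow> 'h) \<Rightarrow> bool" where
  "hermitian_kernel H M \<longleftrightarrow>
     (\<forall>x y. M x y \<in> krein_ops H H) \<and> (\<forall>x y. M x y = adjoint_op H H (M y x))"

text \<open>For a hermitian kernel \<open>[f,f]\<^sub>M\<close> is real, so only its real part needs comparing.\<close>

definition kernel_le ::
    "'h::ab_group_add ip_space \<Rightarrow> ('a \<Rightarrow> 'a \<Rightarrow> 'h \<Rightarrow> 'h) \<Rightarrow> ('a \<Rightarrow> 'a \<Rightarrow> 'h \<Rightarrow> 'h) \<Rightarrow> bool" where
  "kernel_le H M N \<longleftrightarrow>
     (\<forall>f\<in>fin_supp. Re (kernel_form H M f f) \<le> Re (kernel_form H N f f))"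

definition positive_definite_kernel ::
    "'h::ab_group_add ip_space \<Rightarrow> ('a \<Rightarrow> 'a \<Rightarrow> 'h \<Rightarrow> 'h) \<Rightarrow> bool" where
  "positive_definite_kernel H M \<longleftrightarrow>
     hermitian_kernel H M \<and> (\<forall>f\<in>fin_supp. Re (kernel_form H M f f) \<ge> 0)"

definition delta :: "'h \<Rightarrow> 'a \<Rightarrow> 'a \<Rightarrow> 'h::zero" where
  "delta \<xi> x = (\<lambda>z. if z = x then \<xi> else 0)"

text \<open>
  The linear map on finitely supported functions that extends
  \<open>delta \<xi> x \<mapsto> delta \<xi> (\<phi> a x)\<close>; see the three lemmas below.
\<close>

definition psi :: "('b \<Rightarrow> 'a \<Rightarrow> 'a) \<Rightarrow> 'b \<Rightarrow> ('a \<Rightarrow> 'h) \<Rightarrow> 'a \<Rightarrow> 'h::ab_group_add" where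
  "psi \<phi> a f = (\<lambda>z. \<Sum>x | f x \<noteq> 0 \<and> \<phi> a x = z. f x)"

lemma psi_delta: "psi \<phi> a (delta \<xi> x) = delta \<xi> (\<phi> a x)"
proof
  fix z
  have "{y. delta \<xi> x y \<noteq> 0 \<and> \<phi> a y = z} = (if \<xi> \<noteq> 0 \<and> \<phi> a x = z then {x} else {})"
    by (auto simp: delta_def)
  then show "psi \<phi> a (delta \<xi> x) z = delta \<xi> (\<phi> a x) z"
    by (auto simp: psi_def delta_def)
qed

lemma psi_eq_sum:
  assumes "finite S" "{x. f x \<noteq> 0} \<subseteq> S"
  shows "psi \<phi> a f z = (\<Sum>x | x \<in> S \<and> \<phi> a x = z. f x)"
  unfolding psi_def using assms by (intro sum.mono_neutral_left) auto

lemma psi_add: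
  assumes "f \<in> fin_supp" "g \<in> fin_supp"
  shows "psi \<phi> a (\<lambda>x. f x + g x) = (\<lambda>z. psi \<phi> a f z + psi \<phi> a g z)"
proof
  fix z
  let ?S = "{x. f x \<noteq> 0} \<union> {x. g x \<noteq> 0}"
  have S: "finite ?S" using assms by (simp add: fin_supp_def)
  have "psi \<phi> a (\<lambda>x. f x + g x) z = (\<Sum>x | x \<in> ?S \<and> \<phi> a x = z. f x + g x)"
    by (rule psi_eq_sum[OF S]) auto
  also have "\<dots> = psi \<phi> a f z + psi \<phi> a g z"
    unfolding sum.distrib
    by (simp add: psi_eq_sum[OF S, of f] psi_eq_sum[OF S, of g] subset_iff)
  finally show "psi \<phi> a (\<lambda>x. f x + g x) z = psi \<phi> a f z + psi \<phi> a g z" .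
qed

lemma psi_scale:
  assumes "vector_space s" "f \<in> fin_supp"
  shows "psi \<phi> a (\<lambda>x. s c (f x)) = (\<lambda>z. s c (psi \<phi> a f z))"
proof
  fix z
  interpret vector_space s by fact
  have S: "finite {x. f x \<noteq> 0}" using assms by (simp add: fin_supp_def)
  show "psi \<phi> a (\<lambda>x. s c (f x)) z = s c (psi \<phi> a f z)"
    by (simp add: psi_eq_sum[OF S] subset_iff scale_sum_right)
qed

text \<open>The set written \<open>\<B>\<^sub>\<phi>\<^sup>+(\<A>, H)\<close>.\<close>

definition phi_bounded_pd_kernels ::
    "'h::ab_group_add ip_space \<Rightarrow> ('b \<Rightarrow> 'a \<Rightarrow> 'a) \<Rightarrow> ('a \<Rightarrow> 'a \<Rightarrow> 'h \<Rightarrow> 'h) set" where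
  "phi_bounded_pd_kernels H \<phi> =
     {L. positive_definite_kernel H L \<and>
         (\<forall>a. \<exists>c. \<forall>f\<in>fin_supp.
            sqrt (Re (kernel_form H L (psi \<phi> a f) (psi \<phi> a f))) \<le> c * sqrt (Re (kernel_form H L f f)))}"


section \<open>Stinespring dilations\<close>

definition selfadjoint_representation ::
    "(complex \<Rightarrow> 'a::{ring,monoid_mult} \<Rightarrow> 'a) \<Rightarrow> ('a \<Rightarrow> 'a) \<Rightarrow>
     'k::ab_group_add ip_space \<Rightarrow> ('a \<Rightarrow> 'k \<Rightarrow> 'k) \<Rightarrow> bool" where
  "selfadjoint_representation sA star K \<pi> \<longleftrightarrow>
     (\<forall>a. \<pi> a \<in> krein_ops K K) \<and>
     (\<forall>v\<in>carr K. Vector_Spaces.linear sA (scl K) (\<lambda>a. \<pi> a v)) \<and>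
     (\<forall>a b. \<forall>v\<in>carr K. \<pi> (a * b) v = \<pi> a (\<pi> b v)) \<and>
     (\<forall>a. \<forall>v\<in>carr K. \<pi> (star a) v = adjoint_op K K (\<pi> a) v)"

definition stinespring_dilation ::
    "(complex \<Rightarrow> 'a::{ring,monoid_mult} \<Rightarrow> 'a) \<Rightarrow> ('a \<Rightarrow> 'a) \<Rightarrow> 'h::ab_group_add ip_space \<Rightarrow>
     ('a \<Rightarrow> 'h \<Rightarrow> 'h) \<Rightarrow> ('a \<Rightarrow> 'k \<Rightarrow> 'k) \<Rightarrow> 'k::ab_group_add ip_space \<Rightarrow> ('h \<Rightarrow> 'k) \<Rightarrow> bool" where
  "stinespring_dilation sA star H T \<pi> K B \<longleftrightarrow>
     krein_space K \<and> selfadjoint_representation sA star K \<pi> \<and> B \<in> krein_ops H K \<and>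
     (\<forall>a \<xi>. T a \<xi> = adjoint_op H K B (\<pi> a (B \<xi>)))"

definition minimal_stinespring_dilation ::
    "(complex \<Rightarrow> 'a::{ring,monoid_mult} \<Rightarrow> 'a) \<Rightarrow> ('a \<Rightarrow> 'a) \<Rightarrow> 'h::ab_group_add ip_space \<Rightarrow>
     ('a \<Rightarrow> 'h \<Rightarrow> 'h) \<Rightarrow> ('a \<Rightarrow> 'k \<Rightarrow> 'k) \<Rightarrow> 'k::ab_group_add ip_space \<Rightarrow> ('h \<Rightarrow> 'k) \<Rightarrow> bool" where
  "minimal_stinespring_dilation sA star H T \<pi> K B \<longleftrightarrow>
     stinespring_dilation sA star H T \<pi> K B \<and>
     krein_dense K (module.span (scl K) (\<Union>a. range (\<lambda>\<xi>. \<pi> a (B \<xi>))))"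

text \<open>
  HOL cannot quantify existentially over types, so the ambient type \<open>'k\<close> of the dilation
  space is a parameter. No generality is lost at \<open>'k = 'a \<Rightarrow> 'h\<close>: for a minimal dilation,
  \<open>v \<mapsto> (\<lambda>a. B\<^sup>\<sharp> (\<pi> a v))\<close> is linear and injective on the dilation space.
\<close>

definition has_minimal_stinespring_dilation ::
    "'k::ab_group_add itself \<Rightarrow> (complex \<Rightarrow> 'a::{ring,monoid_mult} \<Rightarrow> 'a) \<Rightarrow> ('a \<Rightarrow> 'a) \<Rightarrow>
     'h::ab_group_add ip_space \<Rightarrow> ('a \<Rightarrow> 'h \<Rightarrow> 'h) \<Rightarrow> bool" where
  "has_minimal_stinespring_dilation (_ :: 'k itself) sA star H T \<longleftrightarrow>
     (\<exists>\<pi> (K :: 'k ip_space) B. minimal_stinespring_dilation sA star H T \<pi> K B)"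

end

theory Submission
  imports Defs
begin

text \<open>
  Given a dilation with fundamental symmetry \<open>J\<close>, the kernel
  \<open>L(x, y) = B\<^sup>\<sharp> \<pi>(x) J \<pi>(y)\<^sup>\<sharp> B\<close> does the job. For the converse, spectral theory
  of the Gram operator is replaced by duality of quadratic functionals on the finitely supported
  functions. Starting from \<open>Q\<^sub>0 f = [f, f]\<^sub>L\<close>, iterate \<open>Q \<mapsto> (Q + Q\<^sup>*) / 2\<close>, where
  \<open>Q\<^sup>* f = sup\<^sub>g (2 Re [f, g] - Q g)\<close> is the dual functional with respect to the form
  of \<open>K\<^sub>T\<close>. The iterates decrease to a functional with \<open>Q = Q\<^sup>*\<close>, and every bound on the pairs
  \<open>\<psi>\<^sub>a\<close>, \<open>\<psi>\<^sub>b\<close> with \<open>b = a\<^sup>*\<close>, which are adjoint for the form, survives the iteration.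
  Self-duality says that the Gram operator relative to \<open>Q\<close> is a symmetry, so the bounded
  functionals on \<open>Q\<close> form a Krein space; they are realised as functions
  \<open>u\<close> on the algebra, on which \<open>\<pi>\<close> acts by \<open>(\<pi>(a) u)(x) = u(x a)\<close>.
\<close>

section \<open>Semi-inner products and quadratic functionals\<close>

text \<open>The underlying object is a polar decomposition. Relative to L the form of
  \<open>K\<^sub>T\<close> has a selfadjoint contraction G as Gram operator, and the dilation space
  wants the norm given by the modulus of G. The obstacle is that the maps \<psi> need not commute
  with G, so their bounds for L do not pass to the modulus by functional calculus alone. At an
  eigenvalue \<lambda> of G the iteration is q \<mapsto> (q + \<lambda>^2/q)/2, with limit the
  modulus of \<lambda>; it only uses duals and averages, and both respect a bound shared by two
  mutually adjoint maps.

  L and the form may be degenerate. Passing to bounded functionals performs quotient and completion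
  at once, since such a functional vanishes wherever Q does. Self-duality makes Q vanish on the null
  vectors of the form, among them the combinations of deltas that express linearity of T. Hence the
  elements of the space, a priori arbitrary functions on the algebra, are linear on it, which in
  turn makes \<pi>(a) linear in a.\<close>

locale lin_carrier =
  fixes V :: "'v::ab_group_add ip_space"
  assumes vector_space_scl: "vector_space (scl V)"
    and subspace_carr: "module.subspace (scl V) (carr V)"
begin

sublocale vector_space "scl V"
  by (rule vector_space_scl)

lemma carr_zero [simp]: "0 \<in> carr V"
  using subspace_0[OF subspace_carr] .

lemma carr_add [simp]: "x \<in> carr V \<Longrightarrow> y \<in> carr V \<Longrightarrow> x + y \<in> carr V"
  using subspace_add[OF subspace_carr] .

lemma carr_diff [simp]: "x \<in> carr V \<Longrightarrow> y \<in> carr V \<Longrightarrow> x - y \<in> carr V"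
  using subspace_diff[OF subspace_carr] .

lemma carr_scl [simp]: "x \<in> carr V \<Longrightarrow> scl V c x \<in> carr V"
  using subspace_scale[OF subspace_carr] .

lemma carr_neg [simp]: "x \<in> carr V \<Longrightarrow> - x \<in> carr V"
  using subspace_neg[OF subspace_carr] .

lemma lin_carrier_form_update: "lin_carrier (V\<lparr>form := f\<rparr>)"
  by (rule lin_carrier.intro) (simp_all add: vector_space_scl subspace_carr)

lemma carr_sum: "(\<And>i. i \<in> I \<Longrightarrow> f i \<in> carr V) \<Longrightarrow> sum f I \<in> carr V"
  using subspace_sum[OF subspace_carr] by blast

end

locale indefinite_ip = lin_carrier +
  assumes form_add_left:
      "\<And>x y z. x \<in> carr V \<Longrightarrow> y \<in> carr V \<Longrightarrow> z \<in> carr V \<Longrightarrow> form V (x + y) z = form V x z + form V y z"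
    and form_scl_left: "\<And>c x y. x \<in> carr V \<Longrightarrow> y \<in> carr V \<Longrightarrow> form V (scl V c x) y = c * form V x y"
    and form_swap: "\<And>x y. x \<in> carr V \<Longrightarrow> y \<in> carr V \<Longrightarrow> form V y x = cnj (form V x y)"

lemma indefinite_ip_space_iff: "indefinite_ip_space V \<longleftrightarrow> indefinite_ip V"
  unfolding indefinite_ip_space_def indefinite_ip_def indefinite_ip_axioms_def lin_carrier_def
  by blast

context indefinite_ip
begin

lemma form_add_right:
  "x \<in> carr V \<Longrightarrow> y \<in> carr V \<Longrightarrow> z \<in> carr V \<Longrightarrow> form V z (x + y) = form V z x + form V z y"
  by (metis form_swap form_add_left carr_add complex_cnj_add)

lemma form_scl_right:
  "x \<in> carr V \<Longrightarrow> y \<in> carr V \<Longrightarrow> form V y (scl V c x) = cnj c * form V y x"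
  by (metis form_swap form_scl_left carr_scl complex_cnj_mult)

lemma form_zero_left [simp]: "x \<in> carr V \<Longrightarrow> form V 0 x = 0"
  using form_scl_left[of x x 0] by simp

lemma form_zero_right [simp]: "x \<in> carr V \<Longrightarrow> form V x 0 = 0"
  using form_scl_right[of x x 0] by simp

lemma form_neg_left: "x \<in> carr V \<Longrightarrow> y \<in> carr V \<Longrightarrow> form V (- x) y = - form V x y"
  using form_scl_left[of x y "-1"] by simp

lemma form_neg_right: "x \<in> carr V \<Longrightarrow> y \<in> carr V \<Longrightarrow> form V x (- y) = - form V x y"
  using form_scl_right[of y x "-1"] by simp

lemma form_diff_left:
  "x \<in> carr V \<Longrightarrow> y \<in> carr V \<Longrightarrow> z \<in> carr V \<Longrightarrow> form V (x - y) z = form V x z - form V y z"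
  using form_add_left[of x "- y" z] by (simp add: form_neg_left)

lemma form_diff_right:
  "x \<in> carr V \<Longrightarrow> y \<in> carr V \<Longrightarrow> z \<in> carr V \<Longrightarrow> form V z (x - y) = form V z x - form V z y"
  using form_add_right[of x "- y" z] by (simp add: form_neg_right)

lemma form_sum_left:
  assumes "\<And>i. i \<in> I \<Longrightarrow> f i \<in> carr V" "x \<in> carr V"
  shows "form V (sum f I) x = (\<Sum>i\<in>I. form V (f i) x)"
  using assms(1)
proof (induction I rule: infinite_finite_induct)
  case (insert i I)
  then show ?case using assms(2) by (simp add: form_add_left carr_sum)
qed (use assms(2) in auto)

lemma form_self_real: "x \<in> carr V \<Longrightarrow> form V x x = of_real (Re (form V x x))"
  using form_swap[of x x] by (simp add: complex_eq_iff)

lemma form_self_add: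
  "x \<in> carr V \<Longrightarrow> y \<in> carr V \<Longrightarrow>
    Re (form V (x + y) (x + y)) = Re (form V x x) + 2 * Re (form V x y) + Re (form V y y)"
  using form_swap[of x y] by (simp add: form_add_left form_add_right)

lemma form_self_diff:
  "x \<in> carr V \<Longrightarrow> y \<in> carr V \<Longrightarrow>
    Re (form V (x - y) (x - y)) = Re (form V x x) - 2 * Re (form V x y) + Re (form V y y)"
  using form_swap[of x y] by (simp add: form_diff_left form_diff_right)

lemma form_self_scl:
  "x \<in> carr V \<Longrightarrow> Re (form V (scl V c x) (scl V c x)) = (cmod c)\<^sup>2 * Re (form V x x)"
  by (simp add: form_scl_left form_scl_right mult.assoc[symmetric] complex_norm_square[symmetric]
      del: Re_complex_of_real Im_complex_of_real) (simp add: cmod_power2 flip: power2_eq_square)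

end

text \<open>All Cauchy-Schwarz type estimates below reduce to this. Seminorms may vanish on nonzero
  vectors, so \<open>d = 0\<close> has to be covered: a linear function of t that is bounded below
  has slope 0.\<close>

lemma discriminant_bound:
  fixes a d r :: real
  assumes "d \<ge> 0" and nonneg: "\<And>t. 0 \<le> a - 2 * t * r + t\<^sup>2 * d"
  shows "r\<^sup>2 \<le> a * d"
proof (cases "d = 0")
  case True
  have "r = 0"
  proof (rule ccontr)
    assume "r \<noteq> 0"
    \<comment> \<open>At this t the expression equals -1.\<close>
    then show False using nonneg[of "(a + 1) / (2 * r)"] True by simp
  qed
  then show ?thesis using True by simp
next
  case False
  then have "0 \<le> (a - 2 * (r / d) * r + (r / d)\<^sup>2 * d) * d"
    using nonneg[of "r / d"] assms(1) by (intro mult_nonneg_nonneg) auto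
  also have "\<dots> = a * d - r\<^sup>2"
    using False by (simp add: field_simps power2_eq_square)
  finally show ?thesis by simp
qed

text \<open>This phase factor upgrades estimates of real parts to estimates of moduli.\<close>

lemma cmod_rotation:
  obtains c where "cmod c = 1" "c * z = of_real (cmod z)"
proof (cases "z = 0")
  case True
  then show ?thesis using that[of 1] by simp
next
  case False
  have "cnj z / of_real (cmod z) * z = of_real (cmod z)"
    using False by (simp add: field_simps power2_eq_square complex_norm_square[symmetric])
  then show ?thesis using that[of "cnj z / of_real (cmod z)"] False by (simp add: norm_divide)
qed

locale semi_ip = indefinite_ip +
  assumes form_nonneg: "x \<in> carr V \<Longrightarrow> 0 \<le> Re (form V x x)"
begin

lemma Cauchy_Schwarz:
  assumes x: "x \<in> carr V" and y: "y \<in> carr V"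
  shows "(cmod (form V x y))\<^sup>2 \<le> Re (form V x x) * Re (form V y y)"
proof -
  obtain c where c: "cmod c = 1" "c * form V x y = of_real (cmod (form V x y))"
    using cmod_rotation .
  have "0 \<le> Re (form V (scl V c x) (scl V c x)) - 2 * t * cmod (form V x y) + t\<^sup>2 * Re (form V y y)" for t
  proof -
    have "0 \<le> Re (form V (scl V c x - scl V (of_real t) y) (scl V c x - scl V (of_real t) y))"
      using x y by (intro form_nonneg) simp
    then show ?thesis
      using x y c
      by (simp only: form_self_diff form_self_scl carr_scl) (simp add: form_scl_left form_scl_right)
  qed
  from discriminant_bound[OF form_nonneg[OF y] this] show ?thesis
    using x c by (simp add: form_self_scl)
qed

lemma ip_norm_power2: "x \<in> carr V \<Longrightarrow> (ip_norm V x)\<^sup>2 = Re (form V x x)"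
  using form_nonneg by (simp add: ip_norm_def)

lemma ip_norm_nonneg: "x \<in> carr V \<Longrightarrow> 0 \<le> ip_norm V x"
  using form_nonneg by (simp add: ip_norm_def)

lemma cmod_form_le: "x \<in> carr V \<Longrightarrow> y \<in> carr V \<Longrightarrow> cmod (form V x y) \<le> ip_norm V x * ip_norm V y"
  by (rule power2_le_imp_le)
    (simp_all add: power_mult_distrib ip_norm_power2 Cauchy_Schwarz ip_norm_nonneg)

lemma ip_norm_scl: "x \<in> carr V \<Longrightarrow> ip_norm V (scl V c x) = cmod c * ip_norm V x"
  by (simp add: ip_norm_def form_self_scl real_sqrt_mult)

lemma ip_norm_neg: "x \<in> carr V \<Longrightarrow> ip_norm V (- x) = ip_norm V x"
  using ip_norm_scl[of x "-1"] by simp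

lemma ip_norm_minus_commute: "x \<in> carr V \<Longrightarrow> y \<in> carr V \<Longrightarrow> ip_norm V (x - y) = ip_norm V (y - x)"
  using ip_norm_neg[of "x - y"] by simp

lemma ip_norm_triangle:
  assumes x: "x \<in> carr V" and y: "y \<in> carr V"
  shows "ip_norm V (x + y) \<le> ip_norm V x + ip_norm V y"
proof (rule power2_le_imp_le)
  have "Re (form V x y) \<le> ip_norm V x * ip_norm V y"
    using cmod_form_le[OF x y] complex_Re_le_cmod order_trans by blast
  then show "(ip_norm V (x + y))\<^sup>2 \<le> (ip_norm V x + ip_norm V y)\<^sup>2"
    using x y by (simp add: power2_sum ip_norm_power2 form_self_add)
qed (use x y ip_norm_nonneg in simp)

lemma ip_norm_triangle_diff:
  assumes "x \<in> carr V" and "y \<in> carr V" "z \<in> carr V"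
  shows "ip_norm V (x - z) \<le> ip_norm V (x - y) + ip_norm V (y - z)"
  using ip_norm_triangle[of "x - y" "y - z"] assms by simp

end

text \<open>The square of a Hilbert seminorm, characterized by the parallelogram law instead of an
  inner product. In this shape the notion passes directly through duals, averages and pointwise
  limits; an inner product is recovered only at the end.\<close>

definition quadratic_functional :: "'v::ab_group_add ip_space \<Rightarrow> ('v \<Rightarrow> real) \<Rightarrow> bool" where
  "quadratic_functional V Q \<longleftrightarrow>
     (\<forall>x\<in>carr V. 0 \<le> Q x) \<and>
     (\<forall>c. \<forall>x\<in>carr V. Q (scl V c x) = (cmod c)\<^sup>2 * Q x) \<and>
     (\<forall>x\<in>carr V. \<forall>y\<in>carr V. Q (x + y) + Q (x - y) = 2 * Q x + 2 * Q y)"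

text \<open>The imaginary part carries a plus sign at \<open>scl V \<i> y\<close> because forms are
  conjugate-linear in the second variable.\<close>

definition polar_form :: "'v::ab_group_add ip_space \<Rightarrow> ('v \<Rightarrow> real) \<Rightarrow> 'v \<Rightarrow> 'v \<Rightarrow> complex" where
  "polar_form V Q x y =
     Complex ((Q (x + y) - Q (x - y)) / 4)
       ((Q (x + scl V \<i> y) - Q (x - scl V \<i> y)) / 4)"

lemma (in semi_ip) quadratic_functional_form: "quadratic_functional V (\<lambda>x. Re (form V x x))"
  unfolding quadratic_functional_def
  by (auto simp: form_nonneg form_self_scl form_self_add form_self_diff)

text \<open>Cauchy's functional equation. Boundedness on the unit interval replaces continuity,
  because nonnegativity of a quadratic functional yields a bound directly.\<close>

lemma bounded_additive_imp_linear:
  fixes \<phi> :: "real \<Rightarrow> real"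
  assumes add: "\<And>s t. \<phi> (s + t) = \<phi> s + \<phi> t"
    and bound: "\<And>t. 0 \<le> t \<Longrightarrow> t \<le> 1 \<Longrightarrow> \<bar>\<phi> t\<bar> \<le> C"
  shows "\<phi> t = t * \<phi> 1"
proof -
  define \<delta> where "\<delta> t = \<phi> t - t * \<phi> 1" for t
  have add': "\<delta> (s + t) = \<delta> s + \<delta> t" for s t
    by (simp add: \<delta>_def add algebra_simps)
  have zero: "\<delta> 0 = 0" using add'[of 0 0] by simp
  have nat: "\<delta> (of_nat n * t) = of_nat n * \<delta> t" for n t
    by (induction n) (simp_all add: zero algebra_simps add')
  have one: "\<delta> 1 = 0" by (simp add: \<delta>_def)
  have neg: "\<delta> (- t) = - \<delta> t" for t using add'[of t "- t"] zero by simp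
  have int: "\<delta> (of_int n) = 0" for n
  proof (cases n rule: int_cases2)
    case (nonneg m)
    then show ?thesis using nat[of m 1] one by simp
  next
    case (nonpos m)
    then show ?thesis using nat[of m 1] one neg[of "of_nat m"] by simp
  qed
  \<comment> \<open>\<open>\<delta>\<close> has period 1, hence is bounded; a bounded additive function vanishes.\<close>
  have bdd: "\<bar>\<delta> t\<bar> \<le> C + \<bar>\<phi> 1\<bar>" for t
  proof -
    have "\<delta> t = \<delta> (frac t)"
      using add'[of "of_int \<lfloor>t\<rfloor>" "frac t"] by (simp add: int frac_def)
    moreover have "\<bar>\<delta> (frac t)\<bar> \<le> \<bar>\<phi> (frac t)\<bar> + \<bar>frac t * \<phi> 1\<bar>"
      unfolding \<delta>_def by (rule abs_triangle_ineq4)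
    moreover have "\<bar>frac t * \<phi> 1\<bar> \<le> \<bar>\<phi> 1\<bar>"
      using frac_lt_1[of t] by (simp add: abs_mult mult_left_le_one_le)
    ultimately show ?thesis using bound[of "frac t"] frac_lt_1[of t] by simp
  qed
  have "\<delta> t = 0"
  proof (rule ccontr)
    assume "\<delta> t \<noteq> 0"
    then obtain n where "of_nat n * \<bar>\<delta> t\<bar> > C + \<bar>\<phi> 1\<bar>"
      using reals_Archimedean3[of "\<bar>\<delta> t\<bar>"] by auto
    then show False using bdd[of "of_nat n * t"] nat[of n t] by (simp add: abs_mult)
  qed
  then show ?thesis by (simp add: \<delta>_def)
qed

section \<open>Polarization of quadratic functionals\<close>

context lin_carrier
begin

context
  fixes Q assumes Q: "quadratic_functional V Q"
begin

private lemma Q_nonneg: "x \<in> carr V \<Longrightarrow> 0 \<le> Q x"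
  and Q_scl: "x \<in> carr V \<Longrightarrow> Q (scl V c x) = (cmod c)\<^sup>2 * Q x"
  and Q_par: "x \<in> carr V \<Longrightarrow> y \<in> carr V \<Longrightarrow> Q (x + y) + Q (x - y) = 2 * Q x + 2 * Q y"
  using Q by (auto simp: quadratic_functional_def)

text \<open>Four times the real part of the inner product to be constructed.\<close>

private definition S where "S x y = Q (x + y) - Q (x - y)"

private lemma Q_neg: "x \<in> carr V \<Longrightarrow> Q (- x) = Q x"
  using Q_scl[of x "-1"] by simp

private lemma Q_zero: "Q 0 = 0"
  using Q_scl[of 0 0] by simp

private lemma S_swap: "x \<in> carr V \<Longrightarrow> y \<in> carr V \<Longrightarrow> S x y = S y x"
  using Q_neg[of "x - y"] by (simp add: S_def add.commute)

text \<open>The difference of two parallelogram laws, in which the terms \<open>Q (x - z)\<close>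
  cancel. The case z = 0 evaluates the right-hand side, and additivity of S follows.\<close>

private lemma S_double:
  assumes "x \<in> carr V" "z \<in> carr V" "y \<in> carr V"
  shows "S x y + S z y = S (x + z) (y + y) / 2"
proof -
  have a: "Q ((x + y) + (z + y)) + Q ((x + y) - (z + y)) = 2 * Q (x + y) + 2 * Q (z + y)"
    and b: "Q ((x - y) + (z - y)) + Q ((x - y) - (z - y)) = 2 * Q (x - y) + 2 * Q (z - y)"
    by (rule Q_par; use assms in simp)+
  have "(x + y) + (z + y) = (x + z) + (y + y)" "(x + y) - (z + y) = x - z"
    "(x - y) + (z - y) = (x + z) - (y + y)" "(x - y) - (z - y) = x - z"
    by (simp_all add: algebra_simps)
  with a b show ?thesis unfolding S_def by simp
qed

private lemma S_add:
  assumes x: "x \<in> carr V" and z: "z \<in> carr V" and y: "y \<in> carr V"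
  shows "S (x + z) y = S x y + S z y"
proof -
  have "S (x + z) y + S 0 y = S (x + z) (y + y) / 2"
    using S_double[of "x + z" 0 y] assms by simp
  moreover have "S 0 y = 0" using y by (simp add: S_def Q_neg)
  ultimately show ?thesis using S_double[OF x z y] by simp
qed

text \<open>Additivity makes both sides agree up to a bounded additive function of t: the difference
  defining S is dominated by the sum of its two terms, which the parallelogram law computes.\<close>

private lemma S_real_scl:
  assumes x: "x \<in> carr V" and y: "y \<in> carr V"
  shows "S (scl V (of_real t) x) y = t * S x y"
proof -
  define \<phi> where "\<phi> t = S (scl V (of_real t) x) y" for t
  have add: "\<phi> (s + t) = \<phi> s + \<phi> t" for s t
    using x y by (simp add: \<phi>_def scale_left_distrib S_add)
  have bound: "\<bar>\<phi> t\<bar> \<le> 2 * Q x + 2 * Q y" if "0 \<le> t" "t \<le> 1" for t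
  proof -
    let ?z = "scl V (of_real t) x"
    have z: "?z \<in> carr V" using x by simp
    have "Q ?z \<le> Q x"
      using that Q_scl[OF x, of "of_real t"] Q_nonneg[OF x]
      by (simp add: mult_left_le_one_le power_le_one)
    moreover have "\<bar>\<phi> t\<bar> \<le> 2 * Q ?z + 2 * Q y"
      using Q_par[OF z y] Q_nonneg[of "?z + y"] Q_nonneg[of "?z - y"] z y
      unfolding \<phi>_def S_def by simp
    ultimately show ?thesis by simp
  qed
  have "\<phi> t = t * \<phi> 1" by (rule bounded_additive_imp_linear[OF add bound])
  then show ?thesis by (simp add: \<phi>_def)
qed

private lemma S_i:
  assumes x: "x \<in> carr V" and y: "y \<in> carr V"
  shows "S (scl V \<i> x) (scl V \<i> y) = S x y" and "S (scl V \<i> x) y = - S x (scl V \<i> y)"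
proof -
  have 1: "S (scl V \<i> x) (scl V \<i> y) = S x y" if "x \<in> carr V" "y \<in> carr V" for x y
    using Q_scl[of "x + y" \<i>] Q_scl[of "x - y" \<i>] that
    by (simp add: S_def scale_right_distrib scale_right_diff_distrib)
  show "S (scl V \<i> x) (scl V \<i> y) = S x y" by (rule 1[OF x y])
  have "S (scl V \<i> x) (scl V \<i> (scl V \<i> y)) = S x (scl V \<i> y)"
    using 1[of x "scl V \<i> y"] x y by simp
  moreover have "S (scl V \<i> x) (- y) = - S (scl V \<i> x) y"
    by (simp add: S_def)
  ultimately show "S (scl V \<i> x) y = - S x (scl V \<i> y)" by simp
qed

private lemma polar_S: "polar_form V Q x y = Complex (S x y / 4) (S x (scl V \<i> y) / 4)"
  by (simp add: polar_form_def S_def)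

text \<open>The theorem of Jordan and von Neumann.\<close>

lemma polar_form_self:
  assumes "x \<in> carr V" shows "polar_form V Q x x = of_real (Q x)"
proof -
  have "Q (x + x) = 4 * Q x"
    using Q_scl[OF assms, of 2] scale_left_distrib[of 1 1 x] by simp
  moreover have "S x (scl V \<i> x) = 0"
    using S_i(2)[OF assms assms] S_swap[OF assms, of "scl V \<i> x"] assms by simp
  ultimately show ?thesis
    unfolding polar_S by (simp add: S_def Q_zero complex_eq_iff)
qed

lemma semi_ip_polar_form: "semi_ip (V\<lparr>form := polar_form V Q\<rparr>)"
proof (intro semi_ip.intro indefinite_ip.intro lin_carrier_form_update
    indefinite_ip_axioms.intro semi_ip_axioms.intro)
  fix x y z :: 'v and c
  assume "x \<in> carr (V\<lparr>form := polar_form V Q\<rparr>)"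
  then have x: "x \<in> carr V" by simp
  show "0 \<le> Re (form (V\<lparr>form := polar_form V Q\<rparr>) x x)"
    using x Q_nonneg by (simp add: polar_form_self)
  assume "y \<in> carr (V\<lparr>form := polar_form V Q\<rparr>)"
  then have y: "y \<in> carr V" by simp
  show "form (V\<lparr>form := polar_form V Q\<rparr>) y x = cnj (form (V\<lparr>form := polar_form V Q\<rparr>) x y)"
    using x y S_swap[OF x y] S_swap[of y "scl V \<i> x"] S_i(2)[OF x y]
    by (simp add: polar_S complex_eq_iff)
  have "scl V c x = scl V (of_real (Re c)) x + scl V (of_real (Im c)) (scl V \<i> x)"
    by (subst complex_eq[of c]) (simp only: scale_left_distrib scale_scale mult.commute)
  then have *: "S (scl V c x) w = Re c * S x w + Im c * S (scl V \<i> x) w" if "w \<in> carr V" for w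
    using x that by (simp only: S_add S_real_scl carr_scl)
  show "form (V\<lparr>form := polar_form V Q\<rparr>) (scl (V\<lparr>form := polar_form V Q\<rparr>) c x) y =
          c * form (V\<lparr>form := polar_form V Q\<rparr>) x y"
    using x y *[of y] *[of "scl V \<i> y"] S_i[OF x y]
    by (simp add: polar_S complex_eq_iff field_simps)
  assume "z \<in> carr (V\<lparr>form := polar_form V Q\<rparr>)"
  then show "form (V\<lparr>form := polar_form V Q\<rparr>) (x + y) z =
      form (V\<lparr>form := polar_form V Q\<rparr>) x z + form (V\<lparr>form := polar_form V Q\<rparr>) y z"
    using x y by (simp add: polar_S S_add complex_eq_iff add_divide_distrib)
qed

end

end

section \<open>Hilbert spaces\<close>

locale definite_ip = indefinite_ip +
  assumes form_pos: "x \<in> carr V \<Longrightarrow> x \<noteq> 0 \<Longrightarrow> 0 < Re (form V x x)"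

sublocale definite_ip \<subseteq> semi_ip
proof
  fix x assume "x \<in> carr V"
  then show "0 \<le> Re (form V x x)"
    using form_pos[of x] by (cases "x = 0") (auto intro: less_imp_le)
qed

context definite_ip
begin

lemma ip_norm_eq_0_iff: "x \<in> carr V \<Longrightarrow> ip_norm V x = 0 \<longleftrightarrow> x = 0"
  using form_pos[of x] by (cases "x = 0") (auto simp: ip_norm_def)

lemma Metric_space_ip_dist: "Metric_space (carr V) (ip_dist V)"
proof
  show "0 \<le> ip_dist V x y" for x y
    by (simp add: ip_dist_def ip_norm_nonneg)
  show "ip_dist V x y = ip_dist V y x" for x y
    by (simp add: ip_dist_def ip_norm_minus_commute)
  show "ip_dist V x y = 0 \<longleftrightarrow> x = y" if "x \<in> carr V" "y \<in> carr V" for x y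
    using that by (simp add: ip_dist_def ip_norm_eq_0_iff)
  show "ip_dist V x z \<le> ip_dist V x y + ip_dist V y z"
    if "x \<in> carr V" "y \<in> carr V" "z \<in> carr V" for x y z
    using that by (simp add: ip_dist_def ip_norm_triangle_diff)
qed

lemma limitin_ip_dist_iff:
  assumes "\<And>n. x n \<in> carr V"
  shows "limitin (Metric_space.mtopology (carr V) (ip_dist V)) x u sequentially \<longleftrightarrow>
    u \<in> carr V \<and> (\<lambda>n. ip_norm V (x n - u)) \<longlonglongrightarrow> 0"
proof -
  interpret M: Metric_space "carr V" "ip_dist V" by (rule Metric_space_ip_dist)
  show ?thesis
    unfolding M.limitin_metric_dist_null using assms by (auto simp: ip_dist_def cong: conj_cong)
qed

lemma mcomplete_iff:
  "Metric_space.mcomplete (carr V) (ip_dist V) \<longleftrightarrow>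
    (\<forall>x. (\<forall>n. x n \<in> carr V) \<longrightarrow> (\<forall>e>0. \<exists>N. \<forall>m\<ge>N. \<forall>n\<ge>N. ip_norm V (x m - x n) < e) \<longrightarrow>
      (\<exists>u\<in>carr V. (\<lambda>n. ip_norm V (x n - u)) \<longlonglongrightarrow> 0))"
proof -
  interpret M: Metric_space "carr V" "ip_dist V" by (rule Metric_space_ip_dist)
  have "M.MCauchy x \<longleftrightarrow> (\<forall>n. x n \<in> carr V) \<and> (\<forall>e>0. \<exists>N. \<forall>m\<ge>N. \<forall>n\<ge>N. ip_norm V (x m - x n) < e)" for x
    unfolding M.MCauchy_def by (auto simp: ip_dist_def image_subset_iff)
  then show ?thesis
    unfolding M.mcomplete_def by (simp add: limitin_ip_dist_iff Bex_def cong: imp_cong) blast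
qed

lemma form_tendsto:
  assumes "\<And>n. x n \<in> carr V" "u \<in> carr V" "y \<in> carr V" "(\<lambda>n. ip_norm V (x n - u)) \<longlonglongrightarrow> 0"
  shows "(\<lambda>n. form V (x n) y) \<longlonglongrightarrow> form V u y"
proof -
  have "norm (form V (x n) y - form V u y) \<le> ip_norm V (x n - u) * ip_norm V y" for n
    using cmod_form_le[of "x n - u" y] assms by (simp add: form_diff_left)
  then have "(\<lambda>n. form V (x n) y - form V u y) \<longlonglongrightarrow> 0"
    by (intro Lim_null_comparison[OF always_eventually tendsto_mult_left_zero[OF assms(4)]]) blast
  then show ?thesis
    by (simp add: LIM_zero_iff)
qed

end

locale hilbert_ip = definite_ip +
  assumes complete: "Metric_space.mcomplete (carr V) (ip_dist V)"

lemma hilbert_space_iff: "hilbert_space V \<longleftrightarrow> hilbert_ip V"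
  unfolding hilbert_space_def hilbert_ip_def hilbert_ip_axioms_def definite_ip_def
    definite_ip_axioms_def indefinite_ip_space_iff by blast

context hilbert_ip
begin

lemma Cauchy_converges:
  assumes "\<And>n. x n \<in> carr V" "\<And>e. e > 0 \<Longrightarrow> \<exists>N. \<forall>m\<ge>N. \<forall>n\<ge>N. ip_norm V (x m - x n) < e"
  obtains u where "u \<in> carr V" "(\<lambda>n. ip_norm V (x n - u)) \<longlonglongrightarrow> 0"
  using complete assms unfolding mcomplete_iff by metis

text \<open>The representing vector is the limit of a maximizing sequence of
  \<open>2 Re (F x) - [x, x]\<close>, a Cauchy sequence by the parallelogram law.\<close>

theorem Riesz:
  assumes F_add: "\<And>x y. x \<in> carr V \<Longrightarrow> y \<in> carr V \<Longrightarrow> F (x + y) = F x + F y"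
    and F_scl: "\<And>c x. x \<in> carr V \<Longrightarrow> F (scl V c x) = c * F x"
    and F_bound: "\<And>x. x \<in> carr V \<Longrightarrow> cmod (F x) \<le> b * ip_norm V x"
  obtains u where "u \<in> carr V" "\<And>x. x \<in> carr V \<Longrightarrow> F x = form V x u"
proof -
  define q where "q x = Re (form V x x)" for x
  define \<phi> where "\<phi> x = 2 * Re (F x) - q x" for x
  have F_diff: "F (x - y) = F x - F y" if "x \<in> carr V" "y \<in> carr V" for x y
    using F_add[of x "- y"] F_scl[of y "-1"] that by simp
  have upper: "\<phi> x \<le> b\<^sup>2" if "x \<in> carr V" for x
  proof -
    have "Re (F x) \<le> b * ip_norm V x"
      using F_bound[OF that] complex_Re_le_cmod order_trans by blast
    moreover have "2 * (b * ip_norm V x) \<le> b\<^sup>2 + (ip_norm V x)\<^sup>2"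
      using sum_squares_bound[of b "ip_norm V x"] by simp
    ultimately show ?thesis using that by (simp add: \<phi>_def q_def ip_norm_power2)
  qed
  define m where "m = (SUP x\<in>carr V. \<phi> x)"
  have bdd: "bdd_above (\<phi> ` carr V)" by (rule bdd_aboveI2[of _ _ "b\<^sup>2"]) (rule upper)
  have le_m: "\<phi> x \<le> m" if "x \<in> carr V" for x
    unfolding m_def using bdd that by (rule cSUP_upper2) simp
  define \<epsilon> where "\<epsilon> n = 1 / real (Suc n)" for n
  have \<epsilon>_pos: "\<epsilon> n > 0" for n by (simp add: \<epsilon>_def)
  have "\<exists>x\<in>carr V. m - \<epsilon> n < \<phi> x" for n
    using less_cSUP_iff[OF _ bdd, of "m - \<epsilon> n"] carr_zero \<epsilon>_pos[of n] unfolding m_def by fastforce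
  then obtain x where x: "\<And>n. x n \<in> carr V" and x_m: "\<And>n. m - \<epsilon> n < \<phi> (x n)"
    by metis
  have Cauchy: "\<exists>N. \<forall>j\<ge>N. \<forall>k\<ge>N. ip_norm V (x j - x k) < e" if "e > 0" for e
  proof -
    obtain N where N: "\<epsilon> N < e\<^sup>2 / 4"
      using reals_Archimedean[of "e\<^sup>2 / 4"] \<open>e > 0\<close> unfolding inverse_eq_divide \<epsilon>_def by fastforce
    have "ip_norm V (x j - x k) < e" if "N \<le> j" "N \<le> k" for j k
    proof -
      \<comment> \<open>At the midpoint \<phi> equals the mean of its two values plus a quarter of
        \<open>q (x j - x k)\<close>. As \<phi> cannot exceed m, near-maximality of both points
        gives \<open>q (x j - x k) < 4 * \<epsilon> N\<close>; hence the choice of N.\<close>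
      let ?y = "scl V (1/2) (x j + x k)"
      have "\<phi> ?y \<le> m" using x by (intro le_m) simp
      then have "2 * \<phi> (x j) + 2 * \<phi> (x k) + q (x j - x k) \<le> 4 * m"
        using x unfolding \<phi>_def q_def
        by (simp add: F_add F_scl form_self_scl form_self_add form_self_diff power_divide) argo
      moreover have "\<epsilon> j \<le> \<epsilon> N" "\<epsilon> k \<le> \<epsilon> N"
        using that unfolding \<epsilon>_def by (auto intro!: divide_left_mono)
      ultimately have "q (x j - x k) < e\<^sup>2"
        using x_m[of j] x_m[of k] N by linarith
      then show ?thesis
        using \<open>e > 0\<close> x by (intro power2_less_imp_less[of _ e]) (simp_all add: q_def ip_norm_power2)
    qed
    then show ?thesis by blast
  qed
  from Cauchy_converges[OF x Cauchy] obtain u where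
    u: "u \<in> carr V" "(\<lambda>n. ip_norm V (x n - u)) \<longlonglongrightarrow> 0" by metis
  have Re: "Re (F y) = Re (form V u y)" if y: "y \<in> carr V" for y
  proof -
    \<comment> \<open>Moving \<open>x n\<close> along y raises \<phi> by at most
      \<open>\<epsilon> n\<close>. Since this holds for every t, the discriminant measures how far
      \<open>x n\<close> is from representing F at y.\<close>
    have "(Re (form V (x n) y - F y))\<^sup>2 \<le> \<epsilon> n * q y" for n
    proof (rule discriminant_bound)
      show "0 \<le> q y" using y form_nonneg by (simp add: q_def)
      fix t
      have "\<phi> (x n - scl V (of_real t) y) \<le> m" using x y by (intro le_m) simp
      then have "\<phi> (x n) - 2 * t * Re (F y) + 2 * t * Re (form V (x n) y) - t\<^sup>2 * q y \<le> m"
        using x y unfolding \<phi>_def q_def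
        by (simp only: F_diff F_scl form_self_diff form_self_scl carr_scl)
          (simp add: form_scl_right algebra_simps)
      then show "0 \<le> \<epsilon> n - 2 * t * Re (form V (x n) y - F y) + t\<^sup>2 * q y"
        using x_m[of n] by (simp add: algebra_simps)
    qed
    moreover have "(\<lambda>n. \<epsilon> n * q y) \<longlonglongrightarrow> 0"
      using tendsto_mult_left_zero[OF LIMSEQ_inverse_real_of_nat, of "q y"] by (simp add: inverse_eq_divide \<epsilon>_def)
    moreover have "(\<lambda>n. (Re (form V (x n) y - F y))\<^sup>2) \<longlonglongrightarrow> (Re (form V u y - F y))\<^sup>2"
      by (intro tendsto_intros form_tendsto x u y)
    ultimately have "(Re (form V u y - F y))\<^sup>2 \<le> 0"
      by (intro LIMSEQ_le[where X = "\<lambda>n. (Re (form V (x n) y - F y))\<^sup>2"]) auto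
    then show ?thesis by simp
  qed
  have "F y = form V y u" if y: "y \<in> carr V" for y
    using Re[OF y] Re[of "scl V \<i> y"] y F_scl[OF y, of \<i>] form_swap[OF u(1) y]
    by (simp add: form_scl_right u(1) complex_eq_iff)
  with u(1) show thesis by (rule that)
qed

end

text \<open>Baire's theorem in the form used for uniform boundedness. Closedness is sequential to
  match norm limits, and the ball has an arbitrary centre, so users must recentre it.\<close>

lemma (in hilbert_ip) Baire_cover:
  assumes cover: "\<And>x. x \<in> carr V \<Longrightarrow> \<exists>n::nat. x \<in> F n"
    and closed: "\<And>n x u. (\<And>k. x k \<in> F n) \<Longrightarrow> u \<in> carr V \<Longrightarrow>
      (\<lambda>k. ip_norm V (x k - u)) \<longlonglongrightarrow> 0 \<Longrightarrow> u \<in> F n"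
    and sub: "\<And>n. F n \<subseteq> carr V"
  obtains n x r where "r > 0" "x \<in> carr V" "\<And>y. y \<in> carr V \<Longrightarrow> ip_norm V y < r \<Longrightarrow> x + y \<in> F n"
proof -
  interpret M: Metric_space "carr V" "ip_dist V" by (rule Metric_space_ip_dist)
  have cl: "closedin M.mtopology (F n)" for n
    unfolding M.metric_closedin_iff_sequentially_closed
  proof (intro conjI allI impI)
    show "F n \<subseteq> carr V" by (rule sub)
    fix x u assume *: "range x \<subseteq> F n \<and> limitin M.mtopology x u sequentially"
    then have "x k \<in> F n" for k by blast
    then show "u \<in> F n"
      using * sub[of n] by (intro closed[of x n u]) (auto simp: limitin_ip_dist_iff subset_iff)
  qed
  have "\<exists>n. M.mtopology interior_of F n \<noteq> {}"
  proof (rule ccontr)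
    assume "\<not> ?thesis"
    then have "M.mtopology interior_of \<Union>(range F) = {}"
      using cl by (intro M.metric_Baire_category_alt complete) auto
    moreover have "\<Union>(range F) = topspace M.mtopology"
      using cover sub by auto
    ultimately show False using carr_zero by (metis M.topspace_mtopology empty_iff interior_of_topspace)
  qed
  then obtain n x where x: "x \<in> M.mtopology interior_of F n" by auto
  moreover have "openin M.mtopology (M.mtopology interior_of F n)" by simp
  ultimately obtain r where r: "r > 0" "M.mball x r \<subseteq> F n" and xc: "x \<in> carr V"
    unfolding M.openin_mtopology using interior_of_subset[of M.mtopology "F n"] by blast
  have "x + y \<in> F n" if "y \<in> carr V" "ip_norm V y < r" for y
  proof (rule subsetD[OF r(2)])
    show "x + y \<in> M.mball x r"
      using that xc ip_norm_neg[of y] by (simp add: M.in_mball ip_dist_def)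
  qed
  with r(1) xc show thesis by (rule that)
qed

section \<open>Krein spaces\<close>

text \<open>W is a record of its own, tied to V by equations, so that both \<open>hilb V\<close> and
  an explicitly constructed majorant can be plugged in.\<close>

locale krein_pair = V: indefinite_ip V + W: hilbert_ip W
  for V W :: "'v::ab_group_add ip_space" +
  fixes J :: "'v \<Rightarrow> 'v"
  assumes scl_eq: "scl W = scl V" and carr_eq: "carr W = carr V"
    and J_carr: "x \<in> carr V \<Longrightarrow> J x \<in> carr V"
    and J_J: "x \<in> carr V \<Longrightarrow> J (J x) = x"
    and form_eq: "x \<in> carr V \<Longrightarrow> y \<in> carr V \<Longrightarrow> form V x y = form W (J x) y"
begin

text \<open>Both forms are hermitian: swapping the arguments of either side leads to the same
  indefinite form.\<close>

lemma J_sym: "x \<in> carr V \<Longrightarrow> y \<in> carr V \<Longrightarrow> form W (J x) y = form W x (J y)"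
  by (metis J_carr V.form_swap W.form_swap carr_eq form_eq)

lemma form_J_right: "x \<in> carr V \<Longrightarrow> y \<in> carr V \<Longrightarrow> form V x (J y) = form W x y"
  by (metis J_J J_carr J_sym form_eq)

lemma form_J_left: "x \<in> carr V \<Longrightarrow> y \<in> carr V \<Longrightarrow> form V (J x) y = form W x y"
  by (metis J_J J_carr form_eq)

lemma ip_norm_J: "x \<in> carr V \<Longrightarrow> ip_norm W (J x) = ip_norm W x"
  by (metis J_J J_carr J_sym ip_norm_def)

lemma cmod_form_le: "x \<in> carr V \<Longrightarrow> y \<in> carr V \<Longrightarrow> cmod (form V x y) \<le> ip_norm W x * ip_norm W y"
  using W.cmod_form_le[of "J x" y] by (simp add: form_eq J_carr carr_eq ip_norm_J)

lemma nondegenerate: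
  assumes "x \<in> carr V" "\<And>z. z \<in> carr V \<Longrightarrow> form V z x = 0"
  shows "x = 0"
  using assms form_J_left[of x x] J_carr W.form_pos[of x] carr_eq by auto

lemma eq_if_form_eq:
  assumes "x \<in> carr V" "y \<in> carr V" "\<And>z. z \<in> carr V \<Longrightarrow> form V z x = form V z y"
  shows "x = y"
  using nondegenerate[of "x - y"] assms by (simp add: V.form_diff_right)

text \<open>Linearity of J is forced: pairing with \<open>J x\<close> in the indefinite form is
  pairing with x in the positive one, and the indefinite form separates points.\<close>

lemma J_add: "x \<in> carr V \<Longrightarrow> y \<in> carr V \<Longrightarrow> J (x + y) = J x + J y"
    and J_scl: "x \<in> carr V \<Longrightarrow> J (scl V c x) = scl V c (J x)"
proof -
  show "J (x + y) = J x + J y" if "x \<in> carr V" "y \<in> carr V"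
    by (rule eq_if_form_eq)
      (use that W.form_add_right in \<open>simp_all add: J_carr V.form_add_right form_J_right carr_eq\<close>)
  show "J (scl V c x) = scl V c (J x)" if "x \<in> carr V"
    by (rule eq_if_form_eq)
      (use that W.form_scl_right[of x _ c] in \<open>simp_all add: J_carr V.form_scl_right form_J_right carr_eq scl_eq\<close>)
qed

end

lemma hilb_simps [simp]: "scl (hilb V) = scl V" "carr (hilb V) = carr V"
  by (simp_all add: hilb_def)

lemma krein_pair_if_hilbert_majorant:
  assumes "indefinite_ip_space V" "hilbert_majorant V h"
  obtains J where "krein_pair V (V\<lparr>form := h\<rparr>) J"
proof -
  interpret indefinite_ip V using assms(1) by (simp add: indefinite_ip_space_iff)
  from assms(2) obtain J where
    "hilbert_ip (V\<lparr>form := h\<rparr>)" "J \<in> hilbert_ops (V\<lparr>form := h\<rparr>) (V\<lparr>form := h\<rparr>)"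
    "\<forall>x\<in>carr V. J (J x) = x" "\<forall>x\<in>carr V. \<forall>y\<in>carr V. form V x y = h (J x) y"
    unfolding hilbert_majorant_def hilbert_space_iff by blast
  then have "krein_pair V (V\<lparr>form := h\<rparr>) J"
    by (intro krein_pair.intro krein_pair_axioms.intro indefinite_ip_axioms) (auto simp: hilbert_ops_def)
  then show thesis by (rule that)
qed

lemma (in krein_pair) hilbert_majorant:
  assumes "W = V\<lparr>form := h\<rparr>"
  shows "hilbert_majorant V h"
  unfolding hilbert_majorant_def hilbert_space_iff assms[symmetric]
proof (intro conjI bexI ballI)
  show "hilbert_ip W" by (rule W.hilbert_ip_axioms)
  show "J \<in> hilbert_ops W W"
    by (auto simp: hilbert_ops_def J_carr J_add J_scl carr_eq scl_eq ip_norm_J intro!: exI[of _ 1])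
  show "J (J x) = x" if "x \<in> carr V" for x using that by (rule J_J)
  show "form V x y = h (J x) y" if "x \<in> carr V" "y \<in> carr V" for x y
    using form_eq[OF that] assms by simp
  show "adjoint_op W W J x = J x" if "x \<in> carr V" for x
    unfolding adjoint_op_def
  proof (rule the_equality)
    show "J x \<in> carr W \<and> (\<forall>z\<in>carr W. form W z (J x) = form W (J z) x)"
      using that J_sym by (simp add: carr_eq J_carr)
    fix u assume u: "u \<in> carr W \<and> (\<forall>z\<in>carr W. form W z u = form W (J z) x)"
    have "form W (u - J x) (u - J x) = 0"
      using u that J_sym[of "u - J x" x] J_carr V.carr_diff by (simp add: W.form_diff_right carr_eq)
    then show "u = J x" using W.form_pos[of "u - J x"] u that J_carr carr_eq by auto
  qed
qed

lemma krein_space_hilb: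
  assumes "krein_space V"
  obtains J where "krein_pair V (hilb V) J"
proof -
  have "hilbert_majorant V (SOME h. hilbert_majorant V h)"
    using assms unfolding krein_space_def by (metis someI_ex)
  then show thesis
    using that assms krein_pair_if_hilbert_majorant unfolding krein_space_def hilb_def by metis
qed

text \<open>The balls of the second norm are closed in the first norm, since that norm is the
  supremum of the moduli of the functionals \<open>[\<cdot>, J' u]\<close>, which are bounded in the first norm.\<close>

lemma ip_norm_equiv:
  assumes "krein_pair V W J" "krein_pair V W' J'"
  obtains C where "C > 0" "\<And>x. x \<in> carr V \<Longrightarrow> ip_norm W' x \<le> C * ip_norm W x"
proof -
  interpret A: krein_pair V W J by fact
  interpret B: krein_pair V W' J' by fact
  define F where "F n = {x \<in> carr V. ip_norm W' x \<le> real n}" for n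
  have closed: "u \<in> F n"
    if x: "\<And>k. x k \<in> F n" and u: "u \<in> carr W" and lim: "(\<lambda>k. ip_norm W (x k - u)) \<longlonglongrightarrow> 0" for n x u
  proof -
    have xc: "x k \<in> carr V" for k using x F_def by auto
    have uc: "u \<in> carr V" using u A.carr_eq by simp
    \<comment> \<open>This y represents \<open>form W' v u\<close> as a functional of v in the first
      Hilbert space: \<open>J'\<close> leads to the indefinite form, and J leads back.\<close>
    define y where "y = J (J' u)"
    have y: "y \<in> carr V" unfolding y_def by (intro A.J_carr B.J_carr uc)
    have eq: "form W v y = form W' v u" if "v \<in> carr V" for v
      using that uc A.J_sym[of v "J' u"] A.form_eq[of v "J' u"] B.form_J_right[of v u] B.J_carr
      by (simp add: y_def)
    have "(\<lambda>k. form W (x k) y) \<longlonglongrightarrow> form W u y"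
      by (rule A.W.form_tendsto) (use xc uc y lim A.carr_eq in simp_all)
    then have "(\<lambda>k. cmod (form W' (x k) u)) \<longlonglongrightarrow> cmod (form W' u u)"
      unfolding eq[OF xc] eq[OF uc] by (rule tendsto_norm)
    moreover have "cmod (form W' (x k) u) \<le> real n * ip_norm W' u" for k
    proof -
      have "cmod (form W' (x k) u) \<le> ip_norm W' (x k) * ip_norm W' u"
        using B.W.cmod_form_le xc uc B.carr_eq by simp
      also have "\<dots> \<le> real n * ip_norm W' u"
        using x[of k] B.W.ip_norm_nonneg[of u] uc B.carr_eq by (intro mult_right_mono) (auto simp: F_def)
      finally show ?thesis .
    qed
    ultimately have "cmod (form W' u u) \<le> real n * ip_norm W' u"
      by (intro LIMSEQ_le_const2) auto
    moreover have "cmod (form W' u u) = ip_norm W' u * ip_norm W' u"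
      using B.W.form_self_real[of u] B.W.ip_norm_power2[of u] B.W.form_nonneg[of u] uc B.carr_eq
      by (metis abs_of_nonneg norm_of_real power2_eq_square)
    moreover have "0 \<le> ip_norm W' u" using B.W.ip_norm_nonneg uc B.carr_eq by simp
    ultimately have "ip_norm W' u \<le> real n"
      by (cases "ip_norm W' u = 0") auto
    then show ?thesis using uc by (simp add: F_def)
  qed
  obtain n x r where r: "r > 0" and x: "x \<in> carr W"
    and ball: "\<And>y. y \<in> carr W \<Longrightarrow> ip_norm W y < r \<Longrightarrow> x + y \<in> F n"
  proof (rule A.W.Baire_cover)
    show "\<exists>n. x \<in> F n" if "x \<in> carr W" for x
      using that real_arch_simple[of "ip_norm W' x"] A.carr_eq by (auto simp: F_def)
    show "F n \<subseteq> carr W" for n using A.carr_eq by (auto simp: F_def)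
  qed (use closed in blast)+
  \<comment> \<open>The ball is centred at x, so recentring at 0 costs \<open>ip_norm W' x\<close>;
    the summand 1 keeps D positive.\<close>
  define D where "D = real n + ip_norm W' x + 1"
  have D: "D > 0" using B.W.ip_norm_nonneg[of x] x A.carr_eq B.carr_eq by (simp add: D_def)
  have small: "ip_norm W' y \<le> D" if y: "y \<in> carr V" "ip_norm W y < r" for y
  proof -
    have "ip_norm W' (x + y) \<le> real n" using ball[of y] y A.carr_eq by (simp add: F_def)
    moreover have "ip_norm W' y \<le> ip_norm W' (x + y) + ip_norm W' (- x)"
      using B.W.ip_norm_triangle[of "x + y" "- x"] x y A.carr_eq B.carr_eq by simp
    ultimately show ?thesis using B.W.ip_norm_neg[of x] x A.carr_eq B.carr_eq by (simp add: D_def)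
  qed
  have "ip_norm W' y \<le> (2 * D / r) * ip_norm W y" if y: "y \<in> carr V" for y
  proof (cases "y = 0")
    case True
    then show ?thesis
      using A.W.ip_norm_eq_0_iff[OF A.W.carr_zero] B.W.ip_norm_eq_0_iff[OF B.W.carr_zero] by simp
  next
    case False
    then have pos: "ip_norm W y > 0"
      using y A.W.ip_norm_nonneg[of y] A.W.ip_norm_eq_0_iff[of y] A.carr_eq by simp
    \<comment> \<open>Scales y to norm \<open>r / 2\<close>, strictly inside the ball; hence the
      factor 2 in the final constant.\<close>
    define t where "t = r / (2 * ip_norm W y)"
    have t: "t > 0" using r pos by (simp add: t_def)
    have "ip_norm W (scl V (of_real t) y) = r / 2"
      using A.W.ip_norm_scl[of y "of_real t"] y pos t A.carr_eq A.scl_eq by simp (simp add: t_def)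
    then have "ip_norm W' (scl V (of_real t) y) \<le> D"
      using small[of "scl V (of_real t) y"] y r by simp
    then have "t * ip_norm W' y \<le> D"
      using B.W.ip_norm_scl[of y "of_real t"] y t B.carr_eq B.scl_eq by simp
    then show ?thesis using pos r by (simp add: t_def field_simps)
  qed
  moreover have "2 * D / r > 0" using D r by simp
  ultimately show thesis using that by blast
qed

section \<open>Bounded operators and adjoints\<close>

lemma hilbert_opsE:
  assumes "A \<in> hilbert_ops V W" "semi_ip V"
  obtains b where "b \<ge> 0" "\<And>x. x \<in> carr V \<Longrightarrow> ip_norm W (A x) \<le> b * ip_norm V x"
proof -
  interpret semi_ip V by fact
  from assms obtain b where b: "\<And>x. x \<in> carr V \<Longrightarrow> ip_norm W (A x) \<le> b * ip_norm V x"
    unfolding hilbert_ops_def by blast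
  \<comment> \<open>The constant in the definition has no sign, whereas later estimates multiply
    inequalities by it.\<close>
  have "ip_norm W (A x) \<le> max b 0 * ip_norm V x" if "x \<in> carr V" for x
    using b[OF that] mult_right_mono[OF max.cobounded1[of b 0] ip_norm_nonneg[OF that]] by simp
  then show thesis using that[of "max b 0"] by simp
qed

lemma hilbert_ops_compose:
  assumes A: "A \<in> hilbert_ops V W" and B: "B \<in> hilbert_ops U V" and "semi_ip V" "semi_ip W" "semi_ip U"
  shows "(\<lambda>x. A (B x)) \<in> hilbert_ops U W"
proof -
  obtain a where a: "a \<ge> 0" "\<And>x. x \<in> carr V \<Longrightarrow> ip_norm W (A x) \<le> a * ip_norm V x"
    using hilbert_opsE[OF A] assms by metis
  obtain b where b: "b \<ge> 0" "\<And>x. x \<in> carr U \<Longrightarrow> ip_norm V (B x) \<le> b * ip_norm U x"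
    using hilbert_opsE[OF B] assms by metis
  have "ip_norm W (A (B x)) \<le> a * b * ip_norm U x" if "x \<in> carr U" for x
  proof -
    have "ip_norm W (A (B x)) \<le> a * ip_norm V (B x)"
      using B that by (intro a) (auto simp: hilbert_ops_def)
    also have "\<dots> \<le> a * (b * ip_norm U x)" by (intro mult_left_mono a b that)
    finally show ?thesis by simp
  qed
  then show ?thesis using A B unfolding hilbert_ops_def by auto
qed

text \<open>Since \<open>hilb\<close> is an arbitrary choice, boundedness is proved for a convenient
  majorant and transferred by equivalence of norms.\<close>

lemma hilbert_ops_equiv:
  assumes "krein_pair V V1 J1" "krein_pair V V2 J2" "krein_pair W W1 I1" "krein_pair W W2 I2"
    and A: "A \<in> hilbert_ops V1 W1"
  shows "A \<in> hilbert_ops V2 W2"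
proof -
  interpret V1: krein_pair V V1 J1 by fact
  interpret V2: krein_pair V V2 J2 by fact
  interpret W1: krein_pair W W1 I1 by fact
  interpret W2: krein_pair W W2 I2 by fact
  obtain b where b: "b \<ge> 0" "\<And>x. x \<in> carr V \<Longrightarrow> ip_norm W1 (A x) \<le> b * ip_norm V1 x"
    using hilbert_opsE[OF A V1.W.semi_ip_axioms] V1.carr_eq by metis
  obtain c where c: "c > 0" "\<And>x. x \<in> carr V \<Longrightarrow> ip_norm V1 x \<le> c * ip_norm V2 x"
    using ip_norm_equiv[OF assms(2,1)] by metis
  obtain d where d: "d > 0" "\<And>x. x \<in> carr W \<Longrightarrow> ip_norm W2 x \<le> d * ip_norm W1 x"
    using ip_norm_equiv[OF assms(3,4)] by metis
  have Ac: "A x \<in> carr W" if "x \<in> carr V" for x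
    using A that V1.carr_eq W1.carr_eq by (auto simp: hilbert_ops_def)
  have "ip_norm W2 (A x) \<le> (d * (b * c)) * ip_norm V2 x" if "x \<in> carr V" for x
  proof -
    have "ip_norm W2 (A x) \<le> d * ip_norm W1 (A x)" by (intro d Ac that)
    also have "\<dots> \<le> d * (b * ip_norm V1 x)" using d b that by (intro mult_left_mono) auto
    also have "\<dots> \<le> d * (b * (c * ip_norm V2 x))" using d b c that by (intro mult_left_mono) auto
    finally show ?thesis by (simp add: mult.assoc)
  qed
  then show ?thesis
    using A unfolding hilbert_ops_def
    by (auto simp: V1.carr_eq V2.carr_eq W1.carr_eq W2.carr_eq V1.scl_eq V2.scl_eq W1.scl_eq W2.scl_eq)
qed

context
  fixes V W :: "'v::ab_group_add ip_space" and J A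
  fixes X Y :: "'w::ab_group_add ip_space" and I
  assumes V: "krein_pair V W J" and X: "krein_pair X Y I" and A: "A \<in> hilbert_ops W Y"
begin

interpretation V: krein_pair V W J by (rule V)
interpretation X: krein_pair X Y I by (rule X)

lemma hilbert_ops_carr: "x \<in> carr V \<Longrightarrow> A x \<in> carr X"
  using A by (auto simp: hilbert_ops_def V.carr_eq X.carr_eq)

text \<open>Disposes of the definite description: nondegeneracy gives uniqueness, so exhibiting a
  candidate is enough.\<close>

lemma adjoint_op_eqI:
  assumes "x \<in> carr V" "\<And>z. z \<in> carr V \<Longrightarrow> form V z x = form X (A z) y"
  shows "adjoint_op V X A y = x"
  unfolding adjoint_op_def
proof (rule the_equality)
  show "x \<in> carr V \<and> (\<forall>z\<in>carr V. form V z x = form X (A z) y)" using assms by blast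
  show "u = x" if "u \<in> carr V \<and> (\<forall>z\<in>carr V. form V z u = form X (A z) y)" for u
    using that assms by (intro V.eq_if_form_eq) auto
qed

text \<open>Riesz represents the functional in the Hilbert form, and J turns the representing vector
  into one for the indefinite form.\<close>

lemma adjoint_op:
  assumes y: "y \<in> carr X"
  shows adjoint_op_carr: "adjoint_op V X A y \<in> carr V"
    and form_adjoint_op: "z \<in> carr V \<Longrightarrow> form V z (adjoint_op V X A y) = form X (A z) y"
proof -
  obtain b where b: "b \<ge> 0" "\<And>x. x \<in> carr V \<Longrightarrow> ip_norm Y (A x) \<le> b * ip_norm W x"
    using hilbert_opsE[OF A V.W.semi_ip_axioms] V.carr_eq by metis
  obtain u where u: "u \<in> carr W" "\<And>x. x \<in> carr W \<Longrightarrow> form X (A x) y = form W x u"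
  proof (rule V.W.Riesz)
    fix x z c assume x: "x \<in> carr W"
    show "form X (A (scl W c x)) y = c * form X (A x) y"
      using A x y hilbert_ops_carr[of x] by (auto simp: hilbert_ops_def X.V.form_scl_left V.carr_eq X.scl_eq)
    have "cmod (form X (A x) y) \<le> ip_norm Y (A x) * ip_norm Y y"
      using X.cmod_form_le hilbert_ops_carr x y V.carr_eq by simp
    also have "\<dots> \<le> b * ip_norm W x * ip_norm Y y"
      using b(2) x y X.W.ip_norm_nonneg by (intro mult_right_mono) (auto simp: V.carr_eq X.carr_eq)
    finally show "cmod (form X (A x) y) \<le> b * ip_norm Y y * ip_norm W x" by (simp add: mult_ac)
    assume z: "z \<in> carr W"
    show "form X (A (x + z)) y = form X (A x) y + form X (A z) y"
      using A x z y hilbert_ops_carr[of x] hilbert_ops_carr[of z] by (auto simp: hilbert_ops_def X.V.form_add_left V.carr_eq)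
  qed blast
  have *: "J u \<in> carr V" "\<And>z. z \<in> carr V \<Longrightarrow> form V z (J u) = form X (A z) y"
    using u V.J_carr V.carr_eq V.form_J_right by auto
  have "adjoint_op V X A y = J u" by (rule adjoint_op_eqI[OF *])
  with * show "adjoint_op V X A y \<in> carr V"
    "z \<in> carr V \<Longrightarrow> form V z (adjoint_op V X A y) = form X (A z) y" by auto
qed

lemma adjoint_op_hilbert_ops: "adjoint_op V X A \<in> hilbert_ops Y W"
proof -
  let ?B = "adjoint_op V X A"
  note Bc = adjoint_op_carr and fB = form_adjoint_op
  have add: "?B (x + y) = ?B x + ?B y" if "x \<in> carr X" "y \<in> carr X" for x y
    using that by (intro adjoint_op_eqI) (auto simp: Bc fB V.V.form_add_right X.V.form_add_right hilbert_ops_carr)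
  have scl: "?B (scl X c x) = scl V c (?B x)" if "x \<in> carr X" for x c
    using that by (intro adjoint_op_eqI) (auto simp: Bc fB V.V.form_scl_right X.V.form_scl_right hilbert_ops_carr)
  obtain b where b: "b \<ge> 0" "\<And>x. x \<in> carr V \<Longrightarrow> ip_norm Y (A x) \<le> b * ip_norm W x"
    using hilbert_opsE[OF A V.W.semi_ip_axioms] V.carr_eq by metis
  have "ip_norm W (?B y) \<le> b * ip_norm Y y" if y: "y \<in> carr X" for y
  proof -
    let ?x = "?B y"
    have x: "?x \<in> carr V" by (rule Bc[OF y])
    have n: "0 \<le> ip_norm W ?x" "0 \<le> ip_norm Y y"
      using x y V.W.ip_norm_nonneg X.W.ip_norm_nonneg by (auto simp: V.carr_eq X.carr_eq)
    \<comment> \<open>Testing against \<open>J ?x\<close> makes the indefinite pairing equal to the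
      squared norm of \<open>?x\<close>, of which one factor cancels at the end.\<close>
    have "(ip_norm W ?x)\<^sup>2 = Re (form W ?x ?x)" using V.W.ip_norm_power2 x V.carr_eq by simp
    also have "\<dots> = Re (form X (A (J ?x)) y)"
      using fB[OF y, of "J ?x"] V.form_J_left[OF x x] V.J_carr[OF x] by simp
    also have "\<dots> \<le> cmod (form X (A (J ?x)) y)" by (rule complex_Re_le_cmod)
    also have "\<dots> \<le> ip_norm Y (A (J ?x)) * ip_norm Y y"
      using X.cmod_form_le hilbert_ops_carr V.J_carr x y by simp
    also have "\<dots> \<le> (b * ip_norm W ?x) * ip_norm Y y"
      using b(2)[of "J ?x"] V.J_carr x n by (intro mult_right_mono) (auto simp: V.ip_norm_J)
    finally have "ip_norm W ?x * ip_norm W ?x \<le> ip_norm W ?x * (b * ip_norm Y y)"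
      by (simp add: power2_eq_square mult_ac)
    then show ?thesis using n b(1) by (cases "ip_norm W ?x = 0") auto
  qed
  then show ?thesis
    unfolding hilbert_ops_def using add scl Bc
    by (auto simp: V.carr_eq X.carr_eq V.scl_eq X.scl_eq)
qed

end

text \<open>Density may be checked in an explicit majorant, although \<open>krein_dense\<close>
  refers to the chosen one.\<close>

lemma krein_denseI:
  assumes K: "krein_pair V W J" "krein_pair V (hilb V) J'" and D: "D \<subseteq> carr V"
    and dense: "\<And>u e. u \<in> carr V \<Longrightarrow> e > 0 \<Longrightarrow> \<exists>d\<in>D. ip_norm W (u - d) < e"
  shows "krein_dense V D"
proof -
  interpret H: krein_pair V "hilb V" J' by fact
  interpret M: Metric_space "carr V" "ip_dist (hilb V)"
    using H.W.Metric_space_ip_dist by simp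
  obtain C where C: "C > 0" "\<And>x. x \<in> carr V \<Longrightarrow> ip_norm (hilb V) x \<le> C * ip_norm W x"
    using ip_norm_equiv[OF K] by metis
  have "\<exists>d\<in>D. d \<in> M.mball u r" if u: "u \<in> carr V" and r: "r > 0" for u r
  proof -
    obtain d where d: "d \<in> D" "ip_norm W (u - d) < r / C"
      using dense[of u "r / C"] u r C by auto
    then have dc: "d \<in> carr V" using D by blast
    have "ip_norm (hilb V) (u - d) \<le> C * ip_norm W (u - d)" by (intro C) (simp add: u dc)
    also have "\<dots> < r" using d(2) C(1) by (simp add: field_simps)
    finally have "d \<in> M.mball u r" using u dc by (simp add: M.in_mball ip_dist_def)
    with d(1) show ?thesis by blast
  qed
  then show ?thesis unfolding krein_dense_def M.metric_closure_of by auto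
qed

section \<open>Self-dual quadratic functionals\<close>

text \<open>Functionals are conjugate-linear, as is \<open>[f, \<cdot>]\<close>. The square of the dual norm is written
  as a Fenchel conjugate, which makes the parallelogram law for it a change of variables.\<close>

definition conj_linear_on :: "'v::ab_group_add ip_space \<Rightarrow> ('v \<Rightarrow> complex) \<Rightarrow> bool" where
  "conj_linear_on V l \<longleftrightarrow>
     (\<forall>x\<in>carr V. \<forall>y\<in>carr V. l (x + y) = l x + l y) \<and>
     (\<forall>c. \<forall>x\<in>carr V. l (scl V c x) = cnj c * l x)"

definition bounded_functional ::
    "'v::ab_group_add ip_space \<Rightarrow> ('v \<Rightarrow> real) \<Rightarrow> ('v \<Rightarrow> complex) \<Rightarrow> bool" where
  "bounded_functional V Q l \<longleftrightarrow>
     conj_linear_on V l \<and> (\<exists>C\<ge>0. \<forall>g\<in>carr V. (cmod (l g))\<^sup>2 \<le> C * Q g)"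

definition dual_functional ::
    "'v::ab_group_add ip_space \<Rightarrow> ('v \<Rightarrow> real) \<Rightarrow> ('v \<Rightarrow> complex) \<Rightarrow> real" where
  "dual_functional V Q l = (SUP g\<in>carr V. 2 * Re (l g) - Q g)"

section \<open>Fenchel conjugates of quadratic functionals\<close>

locale quadratic = lin_carrier +
  fixes Q
  assumes quadratic: "quadratic_functional V Q"
begin

lemma Q_nonneg: "x \<in> carr V \<Longrightarrow> 0 \<le> Q x"
  and Q_scl: "x \<in> carr V \<Longrightarrow> Q (scl V c x) = (cmod c)\<^sup>2 * Q x"
  and Q_parallelogram: "x \<in> carr V \<Longrightarrow> y \<in> carr V \<Longrightarrow> Q (x + y) + Q (x - y) = 2 * Q x + 2 * Q y"
  using quadratic by (auto simp: quadratic_functional_def)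

lemma Q_zero: "Q 0 = 0"
  using Q_scl[OF carr_zero, of 0] by simp

lemma dual_term_le:
  assumes "g \<in> carr V" "C \<ge> 0" "(cmod (l g))\<^sup>2 \<le> C * Q g"
  shows "2 * Re (l g) - Q g \<le> C"
proof -
  have "Re (l g) \<le> sqrt C * sqrt (Q g)"
    using real_le_rsqrt[OF assms(3)] complex_Re_le_cmod[of "l g"] by (simp add: real_sqrt_mult)
  then show ?thesis
    using sum_squares_bound[of "sqrt C" "sqrt (Q g)"] assms(2) Q_nonneg[OF assms(1)] by simp
qed

text \<open>Together with \<open>dual_bound\<close> this identifies the conjugate as the least
  admissible constant, the squared dual norm. The reason is 2ab - b^2 \<le> a^2.\<close>

lemma dual_le:
  assumes "C \<ge> 0" "\<And>g. g \<in> carr V \<Longrightarrow> (cmod (l g))\<^sup>2 \<le> C * Q g"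
  shows "dual_functional V Q l \<le> C"
  unfolding dual_functional_def using dual_term_le assms by (intro cSUP_least) (auto intro: carr_zero)

lemma dual_upper:
  assumes "bounded_functional V Q l" "g \<in> carr V"
  shows "2 * Re (l g) - Q g \<le> dual_functional V Q l"
proof -
  obtain C where "C \<ge> 0" "\<And>g. g \<in> carr V \<Longrightarrow> (cmod (l g))\<^sup>2 \<le> C * Q g"
    using assms(1) by (auto simp: bounded_functional_def)
  then have "bdd_above ((\<lambda>g. 2 * Re (l g) - Q g) ` carr V)"
    by (intro bdd_aboveI2[of _ _ C]) (rule dual_term_le)
  then show ?thesis unfolding dual_functional_def using assms(2) by (rule cSUP_upper2) simp
qed

lemma dual_nonneg:
  assumes "bounded_functional V Q l" shows "0 \<le> dual_functional V Q l"
proof -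
  have "l 0 = 0"
    using assms carr_zero scale_zero_left[of 0] unfolding bounded_functional_def conj_linear_on_def
    by (metis complex_cnj_zero mult_zero_left)
  then show ?thesis using dual_upper[OF assms carr_zero] by (simp add: Q_zero)
qed

text \<open>Restricts the supremum to the multiples of g, rotated so that l is real there, and
  optimizes over the real factor.\<close>

lemma dual_bound:
  assumes l: "bounded_functional V Q l" and g: "g \<in> carr V"
  shows "(cmod (l g))\<^sup>2 \<le> dual_functional V Q l * Q g"
proof -
  obtain c where c: "cmod c = 1" "c * l g = of_real (cmod (l g))"
    using cmod_rotation .
  have scl: "l (scl V a g) = cnj a * l g" for a
    using l g by (auto simp: bounded_functional_def conj_linear_on_def)
  have "0 \<le> dual_functional V Q l - 2 * t * cmod (l g) + t\<^sup>2 * Q g" for t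
  proof -
    have "l (scl V (of_real t * cnj c) g) = of_real t * (c * l g)"
      by (simp add: scl)
    then have "Re (l (scl V (of_real t * cnj c) g)) = t * cmod (l g)" by (simp add: c)
    then show ?thesis
      using dual_upper[OF l, of "scl V (of_real t * cnj c) g"] g c(1)
      by (simp add: Q_scl norm_mult)
  qed
  from discriminant_bound[OF Q_nonneg[OF g] this] show ?thesis .
qed

lemma dual_approx:
  assumes "bounded_functional V Q l" "e > 0"
  obtains g where "g \<in> carr V" "dual_functional V Q l - e < 2 * Re (l g) - Q g"
proof -
  have "\<not> dual_functional V Q l \<le> dual_functional V Q l - e" using assms(2) by simp
  then have "\<not> (\<forall>g\<in>carr V. 2 * Re (l g) - Q g \<le> dual_functional V Q l - e)"
    using cSUP_least[of "carr V" "\<lambda>g. 2 * Re (l g) - Q g"] carr_zero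
    unfolding dual_functional_def by blast
  then show thesis using that by (auto simp: not_le)
qed

lemma bounded_functional_scl:
  assumes "bounded_functional V Q l"
  shows "bounded_functional V Q (\<lambda>g. c * l g)"
    and "dual_functional V Q (\<lambda>g. c * l g) \<le> (cmod c)\<^sup>2 * dual_functional V Q l"
proof -
  have *: "(cmod (c * l g))\<^sup>2 \<le> (cmod c)\<^sup>2 * dual_functional V Q l * Q g" if "g \<in> carr V" for g
    using mult_left_mono[OF dual_bound[OF assms that], of "(cmod c)\<^sup>2"]
    by (simp add: norm_mult power_mult_distrib mult_ac)
  have "(cmod c)\<^sup>2 * dual_functional V Q l \<ge> 0" using dual_nonneg[OF assms] by simp
  moreover have "conj_linear_on V (\<lambda>g. c * l g)"
    using assms by (simp add: bounded_functional_def conj_linear_on_def algebra_simps)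
  ultimately show "bounded_functional V Q (\<lambda>g. c * l g)"
    using * unfolding bounded_functional_def by blast
  show "dual_functional V Q (\<lambda>g. c * l g) \<le> (cmod c)\<^sup>2 * dual_functional V Q l"
    using * dual_nonneg[OF assms] by (intro dual_le) simp_all
qed

text \<open>The inequality for c, used once more for \<open>1 / c\<close>, is its own
  converse.\<close>

lemma dual_scl:
  assumes "bounded_functional V Q l"
  shows "dual_functional V Q (\<lambda>g. c * l g) = (cmod c)\<^sup>2 * dual_functional V Q l"
proof (cases "c = 0")
  case True
  then show ?thesis
    using bounded_functional_scl[OF assms, of 0] dual_nonneg by fastforce
next
  case False
  note cl = bounded_functional_scl[OF assms, of c]
  have "dual_functional V Q l \<le> (cmod (1 / c))\<^sup>2 * dual_functional V Q (\<lambda>g. c * l g)"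
    using bounded_functional_scl(2)[OF cl(1), of "1 / c"] False by simp
  then have "(cmod c)\<^sup>2 * dual_functional V Q l \<le> dual_functional V Q (\<lambda>g. c * l g)"
    using False by (simp add: norm_divide field_simps)
  with cl(2) show ?thesis by simp
qed

lemma bounded_functional_add:
  assumes "bounded_functional V Q l" "bounded_functional V Q m"
  shows "bounded_functional V Q (\<lambda>g. l g + m g)"
proof -
  let ?C = "2 * dual_functional V Q l + 2 * dual_functional V Q m"
  have "(cmod (l g + m g))\<^sup>2 \<le> ?C * Q g" if "g \<in> carr V" for g
  proof -
    have "(cmod (l g + m g))\<^sup>2 \<le> (cmod (l g) + cmod (m g))\<^sup>2"
      by (intro power_mono norm_triangle_ineq) simp
    also have "\<dots> \<le> 2 * (cmod (l g))\<^sup>2 + 2 * (cmod (m g))\<^sup>2"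
      using sum_squares_bound[of "cmod (l g)" "cmod (m g)"] by (simp add: power2_sum)
    also have "\<dots> \<le> 2 * (dual_functional V Q l * Q g) + 2 * (dual_functional V Q m * Q g)"
      using dual_bound[OF assms(1) that] dual_bound[OF assms(2) that] by simp
    finally show ?thesis by (simp add: algebra_simps)
  qed
  moreover have "?C \<ge> 0" using assms dual_nonneg by simp
  moreover have "conj_linear_on V (\<lambda>g. l g + m g)"
    using assms by (simp add: bounded_functional_def conj_linear_on_def algebra_simps)
  ultimately show ?thesis unfolding bounded_functional_def by blast
qed

lemma bounded_functional_diff:
  assumes "bounded_functional V Q l" "bounded_functional V Q m"
  shows "bounded_functional V Q (\<lambda>g. l g - m g)"
  using bounded_functional_add[OF assms(1) bounded_functional_scl(1)[OF assms(2), of "-1"]] by simp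

text \<open>Take near-maximizers g and h of the two suprema on the left, with g = s + d and h = s -
  d. Then the linear terms regroup into 2 l(s) + 2 m(d) and the quadratic ones into 2 Q(s) + 2 Q(d),
  which are competitors for the right-hand side.\<close>

lemma dual_parallelogram_le:
  assumes l: "bounded_functional V Q l" and m: "bounded_functional V Q m"
  shows "dual_functional V Q (\<lambda>g. l g + m g) + dual_functional V Q (\<lambda>g. l g - m g)
    \<le> 2 * dual_functional V Q l + 2 * dual_functional V Q m" (is "?a + ?b \<le> ?c")
proof (rule field_le_epsilon)
  fix e :: real assume e: "e > 0"
  obtain g where g: "g \<in> carr V" "?a - e / 2 < 2 * Re (l g + m g) - Q g"
    using dual_approx[OF bounded_functional_add[OF l m], of "e / 2"] e by auto
  obtain h where h: "h \<in> carr V" "?b - e / 2 < 2 * Re (l h - m h) - Q h"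
    using dual_approx[OF bounded_functional_diff[OF l m], of "e / 2"] e by auto
  define s where "s = scl V (1/2) (g + h)"
  define d where "d = scl V (1/2) (g - h)"
  have sd: "s \<in> carr V" "d \<in> carr V" using g h by (simp_all add: s_def d_def)
  have "s + d = g" "s - d = h"
    using scale_left_distrib[of "1/2" "1/2"]
    by (simp_all add: s_def d_def scale_right_distrib scale_right_diff_distrib)
  then have Q: "Q g + Q h = 2 * Q s + 2 * Q d" using Q_parallelogram[OF sd] by simp
  have lin: "f g = f s + f d" "f h = f s - f d" if "bounded_functional V Q f" for f
  proof -
    have f: "f (x + y) = f x + f y" if "x \<in> carr V" "y \<in> carr V" for x y
      using \<open>bounded_functional V Q f\<close> that by (simp add: bounded_functional_def conj_linear_on_def)
    show "f g = f s + f d" using f[OF sd] \<open>s + d = g\<close> by simp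
    show "f h = f s - f d"
      using f[OF h(1) sd(2)] \<open>s - d = h\<close>[symmetric] by simp
  qed
  have "2 * Re (l s) - Q s \<le> dual_functional V Q l" "2 * Re (m d) - Q d \<le> dual_functional V Q m"
    using dual_upper l m sd by auto
  then show "?a + ?b \<le> ?c + e" using g(2) h(2) Q lin[OF l] lin[OF m] by simp
qed

text \<open>The inequality for l + m and l - m, whose sum and difference are 2 l and 2 m, is the
  reverse inequality.\<close>

lemma dual_parallelogram:
  assumes l: "bounded_functional V Q l" and m: "bounded_functional V Q m"
  shows "dual_functional V Q (\<lambda>g. l g + m g) + dual_functional V Q (\<lambda>g. l g - m g)
    = 2 * dual_functional V Q l + 2 * dual_functional V Q m"
proof -
  have two: "(\<lambda>g. l g + m g + (l g - m g)) = (\<lambda>g. 2 * l g)" "(\<lambda>g. l g + m g - (l g - m g)) = (\<lambda>g. 2 * m g)"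
    by auto
  show ?thesis
    using dual_parallelogram_le[OF l m] dual_scl[OF l, of 2] dual_scl[OF m, of 2]
      dual_parallelogram_le[OF bounded_functional_add[OF l m] bounded_functional_diff[OF l m]]
    unfolding two by simp
qed

end

text \<open>The assumption says that the Gram operator of the form relative to Q is a contraction.
  It is stated off the diagonal so that each \<open>form V f\<close> is at once a bounded
  functional.\<close>

locale majorized = indefinite_ip V + quadratic V Q for V :: "'v::ab_group_add ip_space" and Q +
  assumes form_le_Q: "f \<in> carr V \<Longrightarrow> g \<in> carr V \<Longrightarrow> (cmod (form V f g))\<^sup>2 \<le> Q f * Q g"
begin

abbreviation dual where "dual f \<equiv> dual_functional V Q (form V f)"

lemma conj_linear_form: "f \<in> carr V \<Longrightarrow> conj_linear_on V (form V f)"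
  by (simp add: conj_linear_on_def form_add_right form_scl_right)

lemma bounded_functional_form: "f \<in> carr V \<Longrightarrow> bounded_functional V Q (form V f)"
  unfolding bounded_functional_def using conj_linear_form form_le_Q Q_nonneg by blast

lemma dual_le_Q: "f \<in> carr V \<Longrightarrow> dual f \<le> Q f"
  using form_le_Q Q_nonneg by (intro dual_le) auto

lemma form_le_dual: "f \<in> carr V \<Longrightarrow> g \<in> carr V \<Longrightarrow> (cmod (form V f g))\<^sup>2 \<le> dual f * Q g"
  by (rule dual_bound[OF bounded_functional_form])

lemma dual_cong: "(\<And>g. g \<in> carr V \<Longrightarrow> l g = m g) \<Longrightarrow> dual_functional V Q l = dual_functional V Q m"
  unfolding dual_functional_def by (auto intro!: SUP_cong)

lemma quadratic_functional_dual: "quadratic_functional V dual"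
  unfolding quadratic_functional_def
proof (intro conjI ballI allI)
  fix x y c assume x: "x \<in> carr V"
  note bx = bounded_functional_form[OF x]
  show "0 \<le> dual x" by (rule dual_nonneg[OF bx])
  have "dual (scl V c x) = dual_functional V Q (\<lambda>g. c * form V x g)"
    using x by (intro dual_cong) (simp add: form_scl_left)
  then show "dual (scl V c x) = (cmod c)\<^sup>2 * dual x" by (simp add: dual_scl[OF bx])
  assume y: "y \<in> carr V"
  have "dual (x + y) = dual_functional V Q (\<lambda>g. form V x g + form V y g)"
    "dual (x - y) = dual_functional V Q (\<lambda>g. form V x g - form V y g)"
    using x y by (auto intro!: dual_cong simp: form_add_left form_diff_left)
  then show "dual (x + y) + dual (x - y) = 2 * dual x + 2 * dual y"
    by (simp add: dual_parallelogram[OF bx bounded_functional_form[OF y]])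
qed

definition average where "average f = (Q f + dual f) / 2"

lemma average_le: "f \<in> carr V \<Longrightarrow> average f \<le> Q f"
  using dual_le_Q by (simp add: average_def)

text \<open>The arithmetic-geometric mean inequality behind the iteration: Q and its dual bound the
  form jointly, one at each argument, and this survives replacing both by their mean.\<close>

lemma majorized_average: "majorized V average"
proof unfold_locales
  show "quadratic_functional V average"
    unfolding quadratic_functional_def average_def
  proof (intro conjI ballI allI)
    note d = quadratic_functional_dual[unfolded quadratic_functional_def]
    fix x y c assume x: "x \<in> carr V"
    show "0 \<le> (Q x + dual x) / 2" using d x Q_nonneg by simp
    show "(Q (scl V c x) + dual (scl V c x)) / 2 = (cmod c)\<^sup>2 * ((Q x + dual x) / 2)"
      using d x Q_scl by (simp add: algebra_simps)
    assume y: "y \<in> carr V"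
    have "dual (x + y) + dual (x - y) = 2 * dual x + 2 * dual y" using d x y by blast
    then show "(Q (x + y) + dual (x + y)) / 2 + (Q (x - y) + dual (x - y)) / 2
        = 2 * ((Q x + dual x) / 2) + 2 * ((Q y + dual y) / 2)"
      using Q_parallelogram[OF x y] by (simp add: field_simps)
  qed
  fix f g assume f: "f \<in> carr V" and g: "g \<in> carr V"
  note d0 = dual_nonneg[OF bounded_functional_form]
  define a b c d where "a = sqrt (Q f)" "b = sqrt (dual f)" "c = sqrt (Q g)" "d = sqrt (dual g)"
  have "cmod (form V f g) \<le> b * c"
    using real_le_rsqrt[OF form_le_dual[OF f g]] by (simp add: a_b_c_d_def real_sqrt_mult)
  moreover have "cmod (form V f g) \<le> d * a"
    using real_le_rsqrt[OF form_le_dual[OF g f]] form_swap[OF f g]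
    by (simp add: a_b_c_d_def real_sqrt_mult)
  ultimately have "2 * cmod (form V f g) \<le> a * d + b * c" by (simp add: mult.commute)
  then have "(2 * cmod (form V f g))\<^sup>2 \<le> (a * d + b * c)\<^sup>2" by (intro power_mono) auto
  \<comment> \<open>Cauchy-Schwarz in the plane for (a, b) and (d, c), by Lagrange's
    identity.\<close>
  also have "\<dots> \<le> (a\<^sup>2 + b\<^sup>2) * (c\<^sup>2 + d\<^sup>2)"
  proof -
    have "(a\<^sup>2 + b\<^sup>2) * (c\<^sup>2 + d\<^sup>2) = (a * d + b * c)\<^sup>2 + (a * c - b * d)\<^sup>2"
      by (simp add: power2_eq_square algebra_simps)
    then show ?thesis by simp
  qed
  finally show "(cmod (form V f g))\<^sup>2 \<le> average f * average g"
    using f g d0 Q_nonneg by (simp add: a_b_c_d_def average_def power_mult_distrib)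
qed

text \<open>The dual norm of \<open>S f\<close> is tested through the adjoint, so a bound of
  \<open>S'\<close> on Q becomes a bound of S on the dual. This is why bounds are always carried for
  a pair of maps.\<close>

lemma dual_contract:
  assumes S: "\<And>f. f \<in> carr V \<Longrightarrow> S f \<in> carr V" "\<And>f. f \<in> carr V \<Longrightarrow> S' f \<in> carr V"
    and adj: "\<And>f g. f \<in> carr V \<Longrightarrow> g \<in> carr V \<Longrightarrow> form V (S f) g = form V f (S' g)"
    and c: "c \<ge> 0" "\<And>f. f \<in> carr V \<Longrightarrow> Q (S' f) \<le> c * Q f"
    and f: "f \<in> carr V"
  shows "dual (S f) \<le> c * dual f"
proof (rule dual_le)
  have d: "0 \<le> dual f" by (rule dual_nonneg[OF bounded_functional_form[OF f]])
  then show "0 \<le> c * dual f" using c by simp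
  fix g assume g: "g \<in> carr V"
  have "(cmod (form V (S f) g))\<^sup>2 \<le> dual f * Q (S' g)"
    unfolding adj[OF f g] by (rule form_le_dual) (use f g S in auto)
  also have "\<dots> \<le> dual f * (c * Q g)" by (intro mult_left_mono c g d)
  finally show "(cmod (form V (S f) g))\<^sup>2 \<le> c * dual f * Q g" by (simp add: mult_ac)
qed

text \<open>In terms of the Gram operator \<open>G\<close> of the form relative to \<open>Q\<close>, the iteration
  \<open>Q \<mapsto> (Q + Q\<^sup>*) / 2\<close> is Newton's method for the square root of \<open>G\<^sup>2\<close>;
  its limit is the functional of \<open>\<bar>G\<bar>\<close>.\<close>

primrec newton :: "nat \<Rightarrow> 'v \<Rightarrow> real" where
  "newton 0 = Q"
| "newton (Suc n) = majorized.average V (newton n)"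

lemma majorized_newton: "majorized V (newton n)"
proof (induction n)
  case 0
  show ?case by (simp add: majorized_axioms)
next
  case (Suc n)
  then show ?case by (simp add: majorized.majorized_average)
qed

definition newton_lim where "newton_lim f = lim (\<lambda>n. newton n f)"

lemma newton_decseq: "f \<in> carr V \<Longrightarrow> decseq (\<lambda>n. newton n f)"
  by (rule decseq_SucI) (simp add: majorized.average_le[OF majorized_newton])

lemma newton_tendsto: "f \<in> carr V \<Longrightarrow> (\<lambda>n. newton n f) \<longlonglongrightarrow> newton_lim f"
proof -
  assume f: "f \<in> carr V"
  have "0 \<le> newton n f" for n
    using quadratic.Q_nonneg[OF majorized.axioms(2)[OF majorized_newton] f] .
  then have "convergent (\<lambda>n. newton n f)"
    using decseq_convergent[OF newton_decseq[OF f], of 0] unfolding convergent_def by metis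
  then show ?thesis by (simp add: newton_lim_def convergent_LIMSEQ_iff)
qed

lemma newton_lim_le: "f \<in> carr V \<Longrightarrow> newton_lim f \<le> newton n f"
  using decseq_ge[OF newton_decseq newton_tendsto] .

lemma majorized_newton_lim: "majorized V newton_lim"
proof unfold_locales
  note q = quadratic.Q_nonneg quadratic.Q_scl quadratic.Q_parallelogram
  note q' = q[OF majorized.axioms(2)[OF majorized_newton]]
  show "quadratic_functional V newton_lim"
    unfolding quadratic_functional_def
  proof (intro conjI ballI allI)
    fix x y c assume x: "x \<in> carr V"
    show "0 \<le> newton_lim x"
      using q'(1)[OF x] by (intro LIMSEQ_le_const[OF newton_tendsto[OF x]]) auto
    have "(\<lambda>n. newton n (scl V c x)) \<longlonglongrightarrow> (cmod c)\<^sup>2 * newton_lim x"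
      unfolding q'(2)[OF x] by (intro tendsto_intros newton_tendsto x)
    then show "newton_lim (scl V c x) = (cmod c)\<^sup>2 * newton_lim x"
      using newton_tendsto[of "scl V c x"] x LIMSEQ_unique by auto
    assume y: "y \<in> carr V"
    have "(\<lambda>n. newton n (x + y) + newton n (x - y)) \<longlonglongrightarrow> 2 * newton_lim x + 2 * newton_lim y"
      unfolding q'(3)[OF x y] by (intro tendsto_intros newton_tendsto x y)
    moreover have "(\<lambda>n. newton n (x + y) + newton n (x - y)) \<longlonglongrightarrow> newton_lim (x + y) + newton_lim (x - y)"
      by (intro tendsto_intros newton_tendsto carr_add carr_diff x y)
    ultimately show "newton_lim (x + y) + newton_lim (x - y) = 2 * newton_lim x + 2 * newton_lim y"
      using LIMSEQ_unique by blast
  qed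
  fix f g assume f: "f \<in> carr V" and g: "g \<in> carr V"
  show "(cmod (form V f g))\<^sup>2 \<le> newton_lim f * newton_lim g"
  proof (rule LIMSEQ_le_const)
    show "(\<lambda>n. newton n f * newton n g) \<longlonglongrightarrow> newton_lim f * newton_lim g"
      by (intro tendsto_intros newton_tendsto f g)
    show "\<exists>N. \<forall>n\<ge>N. (cmod (form V f g))\<^sup>2 \<le> newton n f * newton n g"
      using majorized.form_le_Q[OF majorized_newton f g] by blast
  qed
qed

text \<open>The recursion solved for the dual term: it is twice the next iterate minus the present
  one, so its limit is known without any continuity of dualization.\<close>

lemma newton_dual_tendsto:
  assumes f: "f \<in> carr V"
  shows "(\<lambda>n. dual_functional V (newton n) (form V f)) \<longlonglongrightarrow> newton_lim f"
proof -
  have "(\<lambda>n. 2 * newton (Suc n) f - newton n f) \<longlonglongrightarrow> 2 * newton_lim f - newton_lim f"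
    by (intro tendsto_intros newton_tendsto f LIMSEQ_Suc)
  moreover have "2 * newton (Suc n) f - newton n f = dual_functional V (newton n) (form V f)" for n
    by (simp add: majorized.average_def[OF majorized_newton] field_simps)
  ultimately show ?thesis by simp
qed

text \<open>Dualization reverses order. The dual of the limit therefore dominates the duals of all
  iterates, and these converge to the limit itself; the other inequality is majorization.\<close>

lemma newton_lim_selfdual:
  assumes f: "f \<in> carr V"
  shows "dual_functional V newton_lim (form V f) = newton_lim f"
proof (rule antisym)
  show "dual_functional V newton_lim (form V f) \<le> newton_lim f"
    by (rule majorized.dual_le_Q[OF majorized_newton_lim f])
  interpret L: majorized V newton_lim by (rule majorized_newton_lim)
  have "dual_functional V (newton n) (form V f) \<le> L.dual f" for n
  proof (rule quadratic.dual_le[OF majorized.axioms(2)[OF majorized_newton]])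
    have d: "0 \<le> L.dual f" by (rule L.dual_nonneg[OF L.bounded_functional_form[OF f]])
    then show "0 \<le> L.dual f" .
    fix g assume g: "g \<in> carr V"
    show "(cmod (form V f g))\<^sup>2 \<le> L.dual f * newton n g"
      using L.form_le_dual[OF f g] mult_left_mono[OF newton_lim_le[OF g] d] by (rule order_trans)
  qed
  then show "newton_lim f \<le> L.dual f"
    by (intro LIMSEQ_le_const2[OF newton_dual_tendsto[OF f]]) auto
qed

text \<open>The induction has to treat S and \<open>S'\<close> together, since the dual half of each
  average bounds one map through the other.\<close>

lemma newton_lim_contract:
  assumes S: "\<And>f. f \<in> carr V \<Longrightarrow> S f \<in> carr V" "\<And>f. f \<in> carr V \<Longrightarrow> S' f \<in> carr V"
    and adj: "\<And>f g. f \<in> carr V \<Longrightarrow> g \<in> carr V \<Longrightarrow> form V (S f) g = form V f (S' g)"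
    and c: "c \<ge> 0"
    and bound: "\<And>f. f \<in> carr V \<Longrightarrow> Q (S f) \<le> c * Q f" "\<And>f. f \<in> carr V \<Longrightarrow> Q (S' f) \<le> c * Q f"
    and f: "f \<in> carr V"
  shows "newton_lim (S f) \<le> c * newton_lim f"
proof -
  have adj': "form V (S' f) g = form V f (S g)" if "f \<in> carr V" "g \<in> carr V" for f g
    using that S adj[of g f] form_swap by metis
  have "(\<forall>f\<in>carr V. newton n (S f) \<le> c * newton n f) \<and> (\<forall>f\<in>carr V. newton n (S' f) \<le> c * newton n f)" for n
  proof (induction n)
    case 0
    then show ?case using bound by simp
  next
    case (Suc n)
    interpret N: majorized V "newton n" by (rule majorized_newton)
    have "N.dual (S f) \<le> c * N.dual f" "N.dual (S' f) \<le> c * N.dual f" if "f \<in> carr V" for f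
      using N.dual_contract[of S S' c f] N.dual_contract[of S' S c f] S adj adj' c Suc that by auto
    then show ?case using Suc by (auto simp: N.average_def algebra_simps intro!: add_mono)
  qed
  then show ?thesis
    using f S by (intro LIMSEQ_le[OF newton_tendsto tendsto_mult_left[OF newton_tendsto]]) auto
qed

end

section \<open>The Krein space of a self-dual majorant\<close>

text \<open>The space consists of the bounded functionals on \<open>(V, Q)\<close>, represented through the
  pairing \<open>p\<close>; in this way no completion has to be formed. Self-duality makes the Gram
  operator an involution.\<close>

locale antidual = majorized V Q for V :: "'v::ab_group_add ip_space" and Q +
  fixes r :: "complex \<Rightarrow> 'u \<Rightarrow> 'u::ab_group_add" and p :: "'u \<Rightarrow> 'v \<Rightarrow> complex"
  assumes selfdual: "f \<in> carr V \<Longrightarrow> dual f = Q f"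
    and r_vs: "vector_space r"
    and p_add: "g \<in> carr V \<Longrightarrow> p (u + v) g = p u g + p v g"
    and p_scl: "g \<in> carr V \<Longrightarrow> p (r c u) g = c * p u g"
    and p_conj: "conj_linear_on V (p u)"
    and p_surj: "bounded_functional V Q l \<Longrightarrow> \<exists>u. \<forall>g\<in>carr V. p u g = l g"
    and p_inj: "(\<And>g. g \<in> carr V \<Longrightarrow> p u g = 0) \<Longrightarrow> u = 0"
begin

interpretation R: vector_space r by (rule r_vs)

lemma p_zero: "g \<in> carr V \<Longrightarrow> p 0 g = 0"
  using p_add[of g 0 0] by simp

lemma p_diff: "g \<in> carr V \<Longrightarrow> p (u - v) g = p u g - p v g"
  using p_add[of g "u - v" v] by simp

lemma p_eqI: "(\<And>g. g \<in> carr V \<Longrightarrow> p u g = p v g) \<Longrightarrow> u = v"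
  using p_inj[of "u - v"] by (simp add: p_diff)

lemma p_add_right: "f \<in> carr V \<Longrightarrow> g \<in> carr V \<Longrightarrow> p u (f + g) = p u f + p u g"
  and p_scl_right: "f \<in> carr V \<Longrightarrow> p u (scl V c f) = cnj c * p u f"
  using p_conj[of u] by (auto simp: conj_linear_on_def)

section \<open>The Hilbert space of bounded functionals\<close>

definition "QK u = dual_functional V Q (p u)"

text \<open>Only the linear structure; the zero form is a placeholder, replaced by the positive form
  in \<open>W\<close> and by the indefinite one in \<open>K\<close>.\<close>

definition "U = \<lparr>scl = r, carr = {u. bounded_functional V Q (p u)}, form = (\<lambda>_ _. 0)\<rparr>"

definition "W = U\<lparr>form := polar_form U QK\<rparr>"

lemma U_simps [simp]: "scl U = r" "u \<in> carr U \<longleftrightarrow> bounded_functional V Q (p u)"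
  and W_simps [simp]: "scl W = r" "carr W = carr U"
  by (simp_all add: U_def W_def)

lemma bounded_functional_cong:
  "bounded_functional V Q l \<Longrightarrow> (\<And>g. g \<in> carr V \<Longrightarrow> m g = l g) \<Longrightarrow> bounded_functional V Q m"
  unfolding bounded_functional_def conj_linear_on_def by simp

lemma UI:
  assumes "C \<ge> 0" "\<And>g. g \<in> carr V \<Longrightarrow> (cmod (p u g))\<^sup>2 \<le> C * Q g"
  shows "u \<in> carr U"
  using assms p_conj by (auto simp: bounded_functional_def)

lemma lin_carrier_U: "lin_carrier U"
proof (rule lin_carrier.intro)
  show "vector_space (scl U)" by (simp add: r_vs)
  show "module.subspace (scl U) (carr U)"
    unfolding U_simps(1)
  proof (rule R.subspaceI)
    show "0 \<in> carr U" by (rule UI[of 0]) (simp_all add: p_zero)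
    show "u + v \<in> carr U" if "u \<in> carr U" "v \<in> carr U" for u v
      using that bounded_functional_cong[OF bounded_functional_add[of "p u" "p v"]] p_add by simp
    show "r c u \<in> carr U" if "u \<in> carr U" for u c
      using that bounded_functional_cong[OF bounded_functional_scl(1)[of "p u" c]] p_scl by simp
  qed
qed

interpretation U: lin_carrier U by (rule lin_carrier_U)

lemma quadratic_QK: "quadratic_functional U QK"
  unfolding quadratic_functional_def
proof (intro conjI ballI allI)
  fix u v c assume u: "u \<in> carr U"
  show "0 \<le> QK u" using u dual_nonneg by (simp add: QK_def)
  have "QK (r c u) = dual_functional V Q (\<lambda>g. c * p u g)"
    unfolding QK_def by (intro dual_cong) (simp add: p_scl)
  then show "QK (scl U c u) = (cmod c)\<^sup>2 * QK u" using dual_scl u by (simp add: QK_def)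
  assume v: "v \<in> carr U"
  have "QK (u + v) = dual_functional V Q (\<lambda>g. p u g + p v g)"
    "QK (u - v) = dual_functional V Q (\<lambda>g. p u g - p v g)"
    unfolding QK_def by (auto intro!: dual_cong simp: p_add p_diff)
  then show "QK (u + v) + QK (u - v) = 2 * QK u + 2 * QK v"
    using u v dual_parallelogram by (simp add: QK_def)
qed

interpretation U: quadratic U QK
  by unfold_locales (rule quadratic_QK)

lemma QK_bound: "u \<in> carr U \<Longrightarrow> g \<in> carr V \<Longrightarrow> (cmod (p u g))\<^sup>2 \<le> QK u * Q g"
  using dual_bound by (simp add: QK_def)

lemma QK_le: "C \<ge> 0 \<Longrightarrow> (\<And>g. g \<in> carr V \<Longrightarrow> (cmod (p u g))\<^sup>2 \<le> C * Q g) \<Longrightarrow> QK u \<le> C"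
  unfolding QK_def by (rule dual_le)

lemma form_W: "form W u v = polar_form U QK u v"
  by (simp add: W_def)

lemma form_W_self: "u \<in> carr U \<Longrightarrow> form W u u = of_real (QK u)"
  unfolding form_W by (rule U.polar_form_self[OF quadratic_QK])

lemma definite_ip_W: "definite_ip W"
proof (rule definite_ip.intro)
  have "semi_ip W" unfolding W_def by (rule U.semi_ip_polar_form[OF quadratic_QK])
  then show "indefinite_ip W" by (simp add: semi_ip_def)
  show "definite_ip_axioms W"
  proof
    fix u assume u: "u \<in> carr W" "u \<noteq> 0"
    have "QK u \<noteq> 0"
    proof
      assume "QK u = 0"
      then have "p u g = 0" if "g \<in> carr V" for g using QK_bound[of u g] u that by simp
      then show False using p_inj u by blast
    qed
    then show "0 < Re (form W u u)" using u U.Q_nonneg[of u] by (simp add: form_W_self)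
  qed
qed

interpretation W: definite_ip W by (rule definite_ip_W)

lemma ip_norm_W: "u \<in> carr U \<Longrightarrow> ip_norm W u = sqrt (QK u)"
  by (simp add: ip_norm_def form_W_self)

text \<open>Dual spaces are complete: a Cauchy sequence converges pointwise, its limit is bounded,
  and \<open>p_surj\<close> realizes the limit in the ambient type.\<close>

lemma hilbert_ip_W: "hilbert_ip W"
proof (intro hilbert_ip.intro hilbert_ip_axioms.intro definite_ip_W)
  show "Metric_space.mcomplete (carr W) (ip_dist W)"
    unfolding W.mcomplete_iff
  proof (intro allI impI)
    fix x :: "nat \<Rightarrow> 'u"
    assume "\<forall>n. x n \<in> carr W" and "\<forall>e>0. \<exists>N. \<forall>m\<ge>N. \<forall>n\<ge>N. ip_norm W (x m - x n) < e"
    then have x: "x n \<in> carr U" and Cau: "e > 0 \<Longrightarrow> \<exists>N. \<forall>m\<ge>N. \<forall>n\<ge>N. ip_norm W (x m - x n) < e" for n e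
      by auto
    have diff: "cmod (p (x m) g - p (x n) g) \<le> ip_norm W (x m - x n) * sqrt (Q g)"
      if "g \<in> carr V" for m n g
      using real_le_rsqrt[OF QK_bound[of "x m - x n" g]] that x U.carr_diff[of "x m" "x n"]
      by (simp add: ip_norm_W p_diff real_sqrt_mult del: U_simps(2))
    define l where "l g = lim (\<lambda>n. p (x n) g)" for g
    have l: "(\<lambda>n. p (x n) g) \<longlonglongrightarrow> l g" if g: "g \<in> carr V" for g
    proof -
      have "Cauchy (\<lambda>n. p (x n) g)"
      proof (rule metric_CauchyI)
        fix e :: real assume "e > 0"
        \<comment> \<open>The summand 1 avoids dividing by zero where
          \<open>Q g = 0\<close>.\<close>
        define e' where "e' = e / (sqrt (Q g) + 1)"
        have s: "0 \<le> sqrt (Q g)" using Q_nonneg[OF g] by simp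
        then have "e' > 0" using \<open>e > 0\<close> unfolding e'_def by (intro divide_pos_pos add_nonneg_pos) auto
        then obtain N where N: "\<forall>m\<ge>N. \<forall>n\<ge>N. ip_norm W (x m - x n) < e'" using Cau by blast
        have "dist (p (x m) g) (p (x n) g) < e" if "m \<ge> N" "n \<ge> N" for m n
        proof -
          have "dist (p (x m) g) (p (x n) g) \<le> e' * sqrt (Q g)"
            using diff[OF g, of m n] mult_right_mono[OF less_imp_le s] N that
            unfolding dist_norm by (meson order_trans)
          also have "\<dots> < e' * (sqrt (Q g) + 1)" using \<open>e' > 0\<close> by simp
          also have "\<dots> = e" using s by (simp add: e'_def add_nonneg_eq_0_iff)
          finally show ?thesis .
        qed
        then show "\<exists>N. \<forall>m\<ge>N. \<forall>n\<ge>N. dist (p (x m) g) (p (x n) g) < e" by blast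
      qed
      then show ?thesis unfolding l_def by (simp add: Cauchy_convergent_iff convergent_LIMSEQ_iff)
    qed
    have close: "cmod (p (x n) g - l g) \<le> e * sqrt (Q g)"
      if N: "\<forall>m\<ge>N. \<forall>n\<ge>N. ip_norm W (x m - x n) < e" and n: "n \<ge> N" and g: "g \<in> carr V" for N n e g
    proof (rule LIMSEQ_le_const2)
      show "(\<lambda>m. cmod (p (x n) g - p (x m) g)) \<longlonglongrightarrow> cmod (p (x n) g - l g)"
        by (intro tendsto_intros l g)
      have "cmod (p (x n) g - p (x m) g) \<le> e * sqrt (Q g)" if "m \<ge> N" for m
        using diff[OF g, of n m] mult_right_mono[OF less_imp_le, of "ip_norm W (x n - x m)" e "sqrt (Q g)"]
          N n that Q_nonneg[OF g] by (meson order_trans real_sqrt_ge_zero)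
      then show "\<exists>M. \<forall>m\<ge>M. cmod (p (x n) g - p (x m) g) \<le> e * sqrt (Q g)" by blast
    qed
    have "conj_linear_on V l"
      unfolding conj_linear_on_def
    proof (intro conjI ballI allI)
      fix f g c assume f: "f \<in> carr V"
      have "(\<lambda>n. p (x n) (scl V c f)) \<longlonglongrightarrow> cnj c * l f"
        unfolding p_scl_right[OF f] by (intro tendsto_intros l f)
      then show "l (scl V c f) = cnj c * l f" using l[of "scl V c f"] f LIMSEQ_unique by auto
      assume g: "g \<in> carr V"
      have "(\<lambda>n. p (x n) (f + g)) \<longlonglongrightarrow> l f + l g"
        unfolding p_add_right[OF f g] by (intro tendsto_intros l f g)
      then show "l (f + g) = l f + l g" using l[of "f + g"] f g LIMSEQ_unique by auto
    qed
    \<comment> \<open>Tolerance 1 keeps l within dual distance 1 of \<open>x N\<close>, which bounds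
      l.\<close>
    moreover obtain N where N: "\<forall>m\<ge>N. \<forall>n\<ge>N. ip_norm W (x m - x n) < 1" using Cau[of 1] by auto
    have "(cmod (l g))\<^sup>2 \<le> (1 + ip_norm W (x N))\<^sup>2 * Q g" if g: "g \<in> carr V" for g
    proof -
      have "cmod (l g) \<le> cmod (p (x N) g - l g) + cmod (p (x N) g)"
        by (metis add.commute norm_triangle_sub norm_minus_commute)
      also have "\<dots> \<le> 1 * sqrt (Q g) + ip_norm W (x N) * sqrt (Q g)"
        using close[OF N order_refl g] real_le_rsqrt[OF QK_bound[OF x g, of N]]
        by (simp add: ip_norm_W[OF x] real_sqrt_mult)
      finally have "cmod (l g) \<le> (1 + ip_norm W (x N)) * sqrt (Q g)" by (simp add: algebra_simps)
      then have "(cmod (l g))\<^sup>2 \<le> ((1 + ip_norm W (x N)) * sqrt (Q g))\<^sup>2" by (intro power_mono) auto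
      then show ?thesis using Q_nonneg[OF g] by (simp add: power_mult_distrib)
    qed
    ultimately have bl: "bounded_functional V Q l"
      unfolding bounded_functional_def using zero_le_power2 by blast
    then obtain u where u: "\<And>g. g \<in> carr V \<Longrightarrow> p u g = l g" using p_surj by blast
    have uU: "u \<in> carr U" using bounded_functional_cong[OF bl u] by simp
    have "(\<lambda>n. ip_norm W (x n - u)) \<longlonglongrightarrow> 0"
    proof (rule LIMSEQ_I)
      fix e :: real assume e: "e > 0"
      \<comment> \<open>Half of e, because the estimate becomes non-strict in the limit.\<close>
      obtain N where N: "\<forall>m\<ge>N. \<forall>n\<ge>N. ip_norm W (x m - x n) < e / 2" using Cau[of "e / 2"] e by auto
      have "norm (ip_norm W (x n - u) - 0) < e" if n: "n \<ge> N" for n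
      proof -
        have "QK (x n - u) \<le> (e / 2)\<^sup>2"
        proof (rule QK_le)
          fix g assume g: "g \<in> carr V"
          have "(cmod (p (x n - u) g))\<^sup>2 \<le> (e / 2 * sqrt (Q g))\<^sup>2"
            using close[OF N n g] g by (intro power_mono) (auto simp: p_diff u)
          then show "(cmod (p (x n - u) g))\<^sup>2 \<le> (e / 2)\<^sup>2 * Q g"
            using Q_nonneg[OF g] by (simp add: power_mult_distrib power_divide)
        qed simp
        then have "ip_norm W (x n - u) \<le> e / 2"
          unfolding ip_norm_W[OF U.carr_diff[OF x uU]] using e by (intro real_le_lsqrt) auto
        moreover have "0 \<le> ip_norm W (x n - u)"
          using W.ip_norm_nonneg U.carr_diff[OF x uU] by simp
        ultimately show ?thesis using e by simp
      qed
      then show "\<exists>N. \<forall>n\<ge>N. norm (ip_norm W (x n - u) - 0) < e" by blast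
    qed
    with uU show "\<exists>u\<in>carr W. (\<lambda>n. ip_norm W (x n - u)) \<longlonglongrightarrow> 0" unfolding W_simps by blast
  qed
qed

section \<open>The Gram map and the fundamental symmetry\<close>

definition "emb f = (SOME u. \<forall>g\<in>carr V. p u g = form V f g)"

lemma p_emb: "f \<in> carr V \<Longrightarrow> g \<in> carr V \<Longrightarrow> p (emb f) g = form V f g"
  using someI_ex[OF p_surj[OF bounded_functional_form[of f]]] by (simp add: emb_def)

lemma emb_U: "f \<in> carr V \<Longrightarrow> emb f \<in> carr U"
  using bounded_functional_cong[OF bounded_functional_form[of f]] p_emb by simp

text \<open>Here self-duality enters: it makes \<open>emb\<close> isometric, and hence J below a
  contraction.\<close>

lemma QK_emb: "f \<in> carr V \<Longrightarrow> QK (emb f) = Q f"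
  unfolding QK_def selfdual[symmetric] by (intro dual_cong) (rule p_emb)

lemma emb_add: "f \<in> carr V \<Longrightarrow> g \<in> carr V \<Longrightarrow> emb (f + g) = emb f + emb g"
  by (rule p_eqI) (simp add: p_emb p_add form_add_left)

lemma emb_scl: "f \<in> carr V \<Longrightarrow> emb (scl V c f) = r c (emb f)"
  by (rule p_eqI) (simp add: p_emb p_scl form_scl_left)

lemma W_bound: "u \<in> carr U \<Longrightarrow> v \<in> carr U \<Longrightarrow> (cmod (form W u v))\<^sup>2 \<le> QK u * QK v"
  using W.Cauchy_Schwarz[of u v] by (simp add: form_W_self)

lemma bounded_functional_W:
  assumes u: "u \<in> carr U"
  shows "bounded_functional V Q (\<lambda>g. form W u (emb g))"
  unfolding bounded_functional_def conj_linear_on_def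
proof (intro conjI exI[of _ "QK u"] ballI allI)
  show "0 \<le> QK u" by (rule U.Q_nonneg[OF u])
  fix f g c assume f: "f \<in> carr V"
  show "(cmod (form W u (emb f)))\<^sup>2 \<le> QK u * Q f"
    using W_bound[OF u emb_U[OF f]] by (simp add: QK_emb f)
  show "form W u (emb (scl V c f)) = cnj c * form W u (emb f)"
    using W.form_scl_right[of "emb f" u c] emb_U[OF f] u by (simp add: emb_scl f)
  assume g: "g \<in> carr V"
  show "form W u (emb (f + g)) = form W u (emb f) + form W u (emb g)"
    using W.form_add_right[of "emb f" "emb g" u] emb_U f g u by (simp add: emb_add f g)
qed

text \<open>Defined as the transpose of \<open>emb\<close>, so that it lives on the whole space at
  once instead of being extended by continuity from a dense subspace.\<close>

definition "J u = (SOME w. \<forall>g\<in>carr V. p w g = form W u (emb g))"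

lemma p_J: "u \<in> carr U \<Longrightarrow> g \<in> carr V \<Longrightarrow> p (J u) g = form W u (emb g)"
  using someI_ex[OF p_surj[OF bounded_functional_W[of u]]] by (simp add: J_def)

lemma J_U: "u \<in> carr U \<Longrightarrow> J u \<in> carr U"
  using bounded_functional_cong[OF bounded_functional_W[of u]] p_J by simp

lemma J_add: "u \<in> carr U \<Longrightarrow> v \<in> carr U \<Longrightarrow> J (u + v) = J u + J v"
  by (rule p_eqI) (use U.carr_add W.form_add_left emb_U in \<open>simp add: p_J p_add del: U_simps(2)\<close>)

lemma J_scl: "u \<in> carr U \<Longrightarrow> J (r c u) = r c (J u)"
  by (rule p_eqI)
    (use U.carr_scl[of u c] W.form_scl_left[of u _ c] emb_U in \<open>simp add: p_J p_scl del: U_simps(2)\<close>)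

lemma J_diff: "u \<in> carr U \<Longrightarrow> v \<in> carr U \<Longrightarrow> J (u - v) = J u - J v"
  using J_add[of "u - v" v] U.carr_diff[of u v] by (simp del: U_simps(2))

lemma QK_J_le: "u \<in> carr U \<Longrightarrow> QK (J u) \<le> QK u"
  using U.Q_nonneg W_bound emb_U by (intro QK_le) (auto simp: p_J QK_emb simp del: U_simps(2) simp flip: QK_emb)

text \<open>The Riesz isomorphism \<open>\<Psi>\<close> of \<open>(V, Q)\<close> onto a dense subspace of its dual; see
  \<open>form_W_\<Psi>\<close>.\<close>

definition "\<Psi> f = J (emb f)"

lemma \<Psi>_U: "f \<in> carr V \<Longrightarrow> \<Psi> f \<in> carr U"
  unfolding \<Psi>_def by (intro J_U emb_U)

lemma \<Psi>_neg: "f \<in> carr V \<Longrightarrow> \<Psi> (- f) = - \<Psi> f"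
  using emb_scl[of f "-1"] J_scl[of "emb f" "-1"] emb_U by (simp add: \<Psi>_def)

lemma form_W_emb: "f \<in> carr V \<Longrightarrow> g \<in> carr V \<Longrightarrow> form W (emb f) (emb g) = polar_form V Q f g"
proof -
  assume f: "f \<in> carr V" and g: "g \<in> carr V"
  have *: "QK (emb f + emb h) = Q (f + h)" "QK (emb f - emb h) = Q (f - h)" if h: "h \<in> carr V" for h
  proof -
    show "QK (emb f + emb h) = Q (f + h)"
      using QK_emb[of "f + h"] f h by (simp add: emb_add)
    have "emb f - emb h = emb (f - h)" using emb_add[of "f - h" h] f h by simp
    then show "QK (emb f - emb h) = Q (f - h)" using QK_emb[of "f - h"] f h by simp
  qed
  show ?thesis
    using *[OF g] *[of "scl V \<i> g"] g by (simp add: form_W polar_form_def emb_scl)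
qed

lemma p_\<Psi>: "f \<in> carr V \<Longrightarrow> g \<in> carr V \<Longrightarrow> p (\<Psi> f) g = polar_form V Q f g"
  unfolding \<Psi>_def using p_J emb_U form_W_emb by metis

text \<open>Completing the square: adding \<open>\<Psi> f\<close> to the functional translates the
  variable of the supremum by f.\<close>

lemma QK_add_\<Psi>_le:
  assumes u: "u \<in> carr U" and f: "f \<in> carr V"
  shows "QK (u + \<Psi> f) \<le> QK u + 2 * Re (p u f) + Q f"
proof -
  interpret P: semi_ip "V\<lparr>form := polar_form V Q\<rparr>" by (rule semi_ip_polar_form[OF quadratic])
  have "2 * Re (p (u + \<Psi> f) g) - Q g \<le> QK u + 2 * Re (p u f) + Q f" if g: "g \<in> carr V" for g
  proof -
    have "Q (f - g) = Q f - 2 * Re (polar_form V Q f g) + Q g"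
      using P.form_self_diff[of f g] f g by (simp add: polar_form_self[OF quadratic])
    moreover have "Q (g - f) = Q (f - g)" using Q_scl[of "f - g" "-1"] f g by simp
    moreover have "p u g = p u (g - f) + p u f" using p_add_right[of "g - f" f u] f g by simp
    moreover have "2 * Re (p u (g - f)) - Q (g - f) \<le> QK u"
      using dual_upper[of "p u" "g - f"] u f g by (simp add: QK_def)
    ultimately show ?thesis using f g by (simp add: p_add p_\<Psi>)
  qed
  then show ?thesis
    unfolding QK_def[of "u + \<Psi> f"] dual_functional_def by (intro cSUP_least) (auto intro: carr_zero)
qed

text \<open>The reverse inequality is the same estimate for \<open>u + \<Psi> f\<close> and
  \<open>- f\<close>.\<close>

lemma QK_add_\<Psi>:
  assumes u: "u \<in> carr U" and f: "f \<in> carr V"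
  shows "QK (u + \<Psi> f) = QK u + 2 * Re (p u f) + Q f"
proof (rule antisym[OF QK_add_\<Psi>_le[OF u f]])
  have "QK (u + \<Psi> f + \<Psi> (- f)) \<le> QK (u + \<Psi> f) + 2 * Re (p (u + \<Psi> f) (- f)) + Q (- f)"
    using U.carr_add[OF u \<Psi>_U[OF f]] f by (intro QK_add_\<Psi>_le) auto
  moreover have "p (u + \<Psi> f) (- f) = - (p u f + of_real (Q f))"
    using p_scl_right[OF f, of "u + \<Psi> f" "-1"] f
    by (simp add: p_add p_\<Psi> polar_form_self[OF quadratic])
  moreover have "Q (- f) = Q f" using Q_scl[OF f, of "-1"] by simp
  ultimately show "QK u + 2 * Re (p u f) + Q f \<le> QK (u + \<Psi> f)" using f by (simp add: \<Psi>_neg)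
qed

text \<open>Comparing two expansions of \<open>QK (u + \<Psi> f)\<close> gives the real parts;
  multiplying u by -i gives the imaginary parts.\<close>

lemma form_W_\<Psi>:
  assumes u: "u \<in> carr U" and f: "f \<in> carr V"
  shows "form W u (\<Psi> f) = p u f"
proof -
  have "QK (\<Psi> f) = Q f"
    using QK_add_\<Psi>[OF U.carr_zero f] by (simp add: p_zero f U.Q_zero)
  then have Re: "Re (form W u (\<Psi> f)) = Re (p u f)" if "u \<in> carr U" for u
    using QK_add_\<Psi>[OF that f] W.form_self_add[of u "\<Psi> f"] \<Psi>_U[OF f] that U.carr_add[OF that \<Psi>_U[OF f]]
    by (simp add: form_W_self del: U_simps(2))
  have "form W (r (- \<i>) u) (\<Psi> f) = - \<i> * form W u (\<Psi> f)"
    using W.form_scl_left[of u "\<Psi> f" "- \<i>"] u \<Psi>_U[OF f] unfolding W_simps by blast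
  moreover have "Re (form W (r (- \<i>) u) (\<Psi> f)) = Re (p (r (- \<i>) u) f)"
    using Re[OF U.carr_scl[OF u], of "- \<i>"] unfolding U_simps(1) .
  ultimately have "Re (- \<i> * form W u (\<Psi> f)) = Re (- \<i> * p u f)"
    unfolding p_scl[OF f] by simp
  then show ?thesis using Re[OF u] by (simp add: complex_eq_iff)
qed

lemma J_\<Psi>: "f \<in> carr V \<Longrightarrow> J (\<Psi> f) = emb f"
proof (rule p_eqI)
  fix g assume f: "f \<in> carr V" and g: "g \<in> carr V"
  have "p (J (\<Psi> f)) g = cnj (form W (emb g) (\<Psi> f))"
    using W.form_swap[of "emb g" "\<Psi> f"] p_J[OF \<Psi>_U[OF f] g] emb_U[OF g] \<Psi>_U[OF f] by (simp del: U_simps(2))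
  also have "\<dots> = p (emb f) g"
    using f g by (simp only: form_W_\<Psi> emb_U p_emb) (metis form_swap)
  finally show "p (J (\<Psi> f)) g = p (emb f) g" .
qed

text \<open>By completing the square, the amount by which f misses the supremum defining
  \<open>QK u\<close> is exactly \<open>QK (u - \<Psi> f)\<close>; so any near-maximizer will
  do.\<close>

lemma dense_\<Psi>:
  assumes u: "u \<in> carr U" and e: "e > 0"
  obtains f where "f \<in> carr V" "QK (u - \<Psi> f) < e"
proof -
  obtain f where f: "f \<in> carr V" "QK u - e < 2 * Re (p u f) - Q f"
    using dual_approx[of "p u" e] u e by (auto simp: QK_def)
  have "p u (- f) = - p u f" using p_scl_right[OF f(1), of u "-1"] by simp
  moreover have "Q (- f) = Q f" using Q_scl[OF f(1), of "-1"] by simp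
  ultimately have "QK (u - \<Psi> f) < e"
    using QK_add_\<Psi>[OF u carr_neg[OF f(1)]] f by (simp add: \<Psi>_neg)
  with f(1) show thesis by (rule that)
qed

lemma eq_0_if_QK_small:
  assumes "u \<in> carr U" "\<And>e. e > 0 \<Longrightarrow> QK u \<le> e" shows "u = 0"
proof -
  have "QK u \<le> 0" using assms(2) field_le_epsilon[of "QK u" 0] by simp
  then have "p u g = 0" if "g \<in> carr V" for g
    using QK_bound[OF assms(1) that] U.Q_nonneg[OF assms(1)] by simp
  then show ?thesis by (rule p_inj)
qed

lemma QK_diff_le: "u \<in> carr U \<Longrightarrow> v \<in> carr U \<Longrightarrow> QK (u - v) \<le> 2 * QK u + 2 * QK v"
  using U.Q_parallelogram[of u v] U.Q_nonneg[OF U.carr_add[of u v]] by (simp del: U_simps(2))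

text \<open>On the range of \<Psi> this is \<open>J_\<Psi>\<close> followed by the definition of
  \<Psi>. The range is dense and J is a contraction; the error for w is at most
  \<open>4 * QK w\<close>, hence the tolerance \<open>e / 4\<close>.\<close>

lemma J_J: assumes u: "u \<in> carr U" shows "J (J u) = u"
proof -
  have "QK (J (J u) - u) \<le> e" if e: "e > 0" for e
  proof -
    obtain f where f: "f \<in> carr V" "QK (u - \<Psi> f) < e / 4" using dense_\<Psi>[OF u, of "e / 4"] e by auto
    define w where "w = u - \<Psi> f"
    have w: "w \<in> carr U" unfolding w_def by (intro U.carr_diff u \<Psi>_U f)
    have "J (J w) = J (J u) - \<Psi> f"
      unfolding w_def using u f \<Psi>_U J_U emb_U by (simp add: J_diff J_\<Psi> del: U_simps(2)) (simp add: \<Psi>_def)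
    then have "J (J u) - u = J (J w) - w" by (simp add: w_def)
    then have "QK (J (J u) - u) \<le> 2 * QK (J (J w)) + 2 * QK w" using QK_diff_le[OF J_U[OF J_U[OF w]] w] by simp
    also have "\<dots> \<le> 4 * QK w" using QK_J_le[OF w] QK_J_le[OF J_U[OF w]] by simp
    also have "\<dots> \<le> e" using f by (simp add: w_def)
    finally show ?thesis .
  qed
  then have "J (J u) - u = 0" using U.carr_diff[OF J_U[OF J_U[OF u]] u] by (rule eq_0_if_QK_small[rotated])
  then show ?thesis by simp
qed

lemma QK_J: "u \<in> carr U \<Longrightarrow> QK (J u) = QK u"
  using QK_J_le[of u] QK_J_le[of "J u"] J_U[of u] J_J[of u] by (simp del: U_simps(2))

lemma form_W_J_J:
  assumes u: "u \<in> carr U" and v: "v \<in> carr U"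
  shows "form W (J u) (J v) = form W u v"
proof -
  have *: "QK (J u + J v) = QK (u + v)" "QK (J u - J v) = QK (u - v)" if v: "v \<in> carr U" for v
    using QK_J[OF U.carr_add[OF u v]] QK_J[OF U.carr_diff[OF u v]] by (simp_all only: J_add J_diff u v)
  show ?thesis
    using *[OF v] *[OF U.carr_scl[OF v], of \<i>] J_scl[OF v] by (simp add: form_W polar_form_def)
qed

section \<open>The indefinite form\<close>

definition "K = U\<lparr>form := \<lambda>u v. form W (J u) v\<rparr>"

lemma K_simps [simp]: "scl K = r" "carr K = carr U"
  by (simp_all add: K_def)

lemma form_K: "form K u v = form W (J u) v"
  by (simp add: K_def)

lemma W_eq: "W = K\<lparr>form := form W\<rparr>"
  by (simp add: K_def W_def)

lemma krein_pair_K: "krein_pair K W J"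
proof (intro krein_pair.intro indefinite_ip.intro hilbert_ip_W)
  show "lin_carrier K" unfolding K_def by (rule U.lin_carrier_form_update)
  show "indefinite_ip_axioms K"
  proof
    fix x y z c assume "x \<in> carr K" "y \<in> carr K"
    then have xy: "x \<in> carr U" "y \<in> carr U" unfolding K_simps by auto
    then show "form K (scl K c x) y = c * form K x y"
      using W.form_scl_left[of "J x" y c] J_U[of x] by (simp add: form_K J_scl del: U_simps(2))
    show "form K y x = cnj (form K x y)"
      using W.form_swap[of "J x" y] J_U[of x] J_U[of y] xy form_W_J_J[of "J y" x] J_J[of y]
      by (simp add: form_K del: U_simps(2))
    assume "z \<in> carr K"
    then show "form K (x + y) z = form K x z + form K y z"
      using W.form_add_left[of "J x" "J y" z] J_U xy by (simp add: form_K J_add del: U_simps(2))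
  qed
  show "krein_pair_axioms K W J"
    by unfold_locales (simp_all add: form_K J_U J_J del: U_simps(2))
qed

text \<open>The reproducing property: the two applications of J cancel. It reduces questions about
  the form to values of functionals.\<close>

lemma form_K_emb: "u \<in> carr U \<Longrightarrow> g \<in> carr V \<Longrightarrow> form K u (emb g) = p u g"
  unfolding form_K using p_J[OF J_U, of u g] by (simp add: J_J del: U_simps(2))

lemma krein_space_K: "krein_space K"
proof -
  interpret krein_pair K W J by (rule krein_pair_K)
  show ?thesis
    unfolding krein_space_def indefinite_ip_space_iff
    using hilbert_majorant[OF W_eq] V.indefinite_ip_axioms by blast
qed

text \<open>The isometry J exchanges the ranges of \<open>emb\<close> and \<Psi>, so density of one
  carries over to the other.\<close>

lemma dense_emb:
  assumes u: "u \<in> carr U" and e: "e > 0"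
  obtains f where "f \<in> carr V" "ip_norm W (u - emb f) < e"
proof -
  obtain f where f: "f \<in> carr V" "QK (J u - \<Psi> f) < e\<^sup>2"
    using dense_\<Psi>[OF J_U[OF u], of "e\<^sup>2"] e by auto
  have "QK (u - emb f) = QK (J u - \<Psi> f)"
    using QK_J[OF U.carr_diff[OF u emb_U[OF f(1)]]] by (simp only: J_diff u emb_U f(1) \<Psi>_def)
  then have "ip_norm W (u - emb f) < e"
    unfolding ip_norm_W[OF U.carr_diff[OF u emb_U[OF f(1)]]]
    using f(2) e by (intro real_less_lsqrt) auto
  with f(1) show thesis by (rule that)
qed

section \<open>Transposes of adjoint pairs\<close>

context
  fixes R R' :: "'u \<Rightarrow> 'u" and S S' :: "'v \<Rightarrow> 'v" and c :: real
  assumes S: "\<And>g. g \<in> carr V \<Longrightarrow> S g \<in> carr V" "\<And>g. g \<in> carr V \<Longrightarrow> S' g \<in> carr V"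
    and adj: "\<And>f g. f \<in> carr V \<Longrightarrow> g \<in> carr V \<Longrightarrow> form V (S f) g = form V f (S' g)"
    and c: "c \<ge> 0" "\<And>g. g \<in> carr V \<Longrightarrow> Q (S g) \<le> c * Q g" "\<And>g. g \<in> carr V \<Longrightarrow> Q (S' g) \<le> c * Q g"
    and R: "\<And>u g. g \<in> carr V \<Longrightarrow> p (R u) g = p u (S' g)" "\<And>u g. g \<in> carr V \<Longrightarrow> p (R' u) g = p u (S g)"
begin

lemma
  assumes u: "u \<in> carr U"
  shows transpose_U: "R u \<in> carr U" and transpose_norm: "ip_norm W (R u) \<le> sqrt c * ip_norm W u"
proof -
  have *: "(cmod (p (R u) g))\<^sup>2 \<le> (c * QK u) * Q g" if g: "g \<in> carr V" for g
  proof -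
    have "(cmod (p (R u) g))\<^sup>2 \<le> QK u * Q (S' g)" unfolding R(1)[OF g] by (rule QK_bound[OF u S(2)[OF g]])
    also have "\<dots> \<le> QK u * (c * Q g)" by (intro mult_left_mono c g U.Q_nonneg u)
    finally show ?thesis by (simp add: mult_ac)
  qed
  have nn: "0 \<le> c * QK u" using c(1) U.Q_nonneg[OF u] by simp
  show Ru: "R u \<in> carr U" by (rule UI[OF nn *])
  have "QK (R u) \<le> c * QK u" by (rule QK_le[OF nn *])
  then show "ip_norm W (R u) \<le> sqrt c * ip_norm W u"
    using real_sqrt_le_mono by (simp add: ip_norm_W[OF Ru] ip_norm_W[OF u] flip: real_sqrt_mult)
qed

lemma transpose_emb: "f \<in> carr V \<Longrightarrow> R (emb f) = emb (S f)"
  by (rule p_eqI) (simp add: R p_emb S adj)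

end

text \<open>Against v of the form \<open>emb f\<close> both sides are the value of u at
  \<open>S' f\<close>, by the reproducing property. Density of these vectors and boundedness of the
  transposes extend this to all v.\<close>

lemma form_K_transpose:
  fixes R R' :: "'u \<Rightarrow> 'u" and S S' :: "'v \<Rightarrow> 'v" and c :: real
  assumes S: "\<And>g. g \<in> carr V \<Longrightarrow> S g \<in> carr V" "\<And>g. g \<in> carr V \<Longrightarrow> S' g \<in> carr V"
    and adj: "\<And>f g. f \<in> carr V \<Longrightarrow> g \<in> carr V \<Longrightarrow> form V (S f) g = form V f (S' g)"
    and c: "c \<ge> 0" "\<And>g. g \<in> carr V \<Longrightarrow> Q (S g) \<le> c * Q g" "\<And>g. g \<in> carr V \<Longrightarrow> Q (S' g) \<le> c * Q g"
    and R: "\<And>u g. g \<in> carr V \<Longrightarrow> p (R u) g = p u (S' g)" "\<And>u g. g \<in> carr V \<Longrightarrow> p (R' u) g = p u (S g)"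
    and u: "u \<in> carr U" and v: "v \<in> carr U"
  shows "form K (R u) v = form K u (R' v)"
proof -
  interpret KW: krein_pair K W J by (rule krein_pair_K)
  have adj': "form V (S' f) g = form V f (S g)" if "f \<in> carr V" "g \<in> carr V" for f g
    using that S adj[of g f] form_swap by metis
  have RU: "R u \<in> carr U" and R'U: "R' w \<in> carr U" if "w \<in> carr U" for w
    using transpose_U[of S S' c R R', OF S adj c R] u
      transpose_U[of S' S c R' R, OF S(2,1) adj' c(1,3,2) R(2,1)] that by auto
  have R'norm: "ip_norm W (R' w) \<le> sqrt c * ip_norm W w" if "w \<in> carr U" for w
    using transpose_norm[of S' S c R' R, OF S(2,1) adj' c(1,3,2) R(2,1)] that by auto
  have R'diff: "R' (x - y) = R' x - R' y" for x y
    by (rule p_eqI) (simp add: R p_diff S)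
  have R'emb: "R' (emb f) = emb (S' f)" if "f \<in> carr V" for f
    using transpose_emb[of S' S c R' R, OF S(2,1) adj' c(1,3,2) R(2,1)] that by auto
  \<comment> \<open>Bounds the discrepancy per unit of approximation error in v; dividing by
    \<open>C + 1\<close> below is safe also when C = 0.\<close>
  define C where "C = ip_norm W (R u) + sqrt c * ip_norm W u"
  have "cmod (form K (R u) v - form K u (R' v)) \<le> e" if e: "e > 0" for e
  proof -
    have C: "C \<ge> 0"
      using W.ip_norm_nonneg[of u] W.ip_norm_nonneg[of "R u"] u RU[OF u] c(1) by (simp add: C_def del: U_simps(2))
    obtain f where f: "f \<in> carr V" "ip_norm W (v - emb f) < e / (C + 1)"
      using dense_emb[OF v, of "e / (C + 1)"] e C by auto
    define w where "w = v - emb f"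
    have w: "w \<in> carr U" unfolding w_def by (intro U.carr_diff v emb_U f)
    note RU = RU[OF u]
    have "form K (R u) (emb f) = form K u (R' (emb f))"
      using f(1) S R(1) by (simp only: form_K_emb u RU R'emb)
    moreover have "form K (R u) w = form K (R u) v - form K (R u) (emb f)"
      using KW.V.form_diff_right[of v "emb f" "R u"] v emb_U[OF f(1)] RU by (simp add: w_def del: U_simps(2))
    moreover have "form K u (R' w) = form K u (R' v) - form K u (R' (emb f))"
      using KW.V.form_diff_right[of "R' v" "R' (emb f)" u] R'U v u emb_U[OF f(1)]
      by (simp add: w_def R'diff del: U_simps(2))
    ultimately have "form K (R u) v - form K u (R' v) = form K (R u) w - form K u (R' w)" by simp
    then have "cmod (form K (R u) v - form K u (R' v)) \<le> cmod (form K (R u) w) + cmod (form K u (R' w))"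
      by (simp add: norm_triangle_ineq4)
    also have "\<dots> \<le> ip_norm W (R u) * ip_norm W w + ip_norm W u * ip_norm W (R' w)"
      using RU R'U w u by (intro add_mono KW.cmod_form_le) (simp_all del: U_simps(2))
    also have "\<dots> \<le> ip_norm W (R u) * ip_norm W w + ip_norm W u * (sqrt c * ip_norm W w)"
      using R'norm[OF w] W.ip_norm_nonneg[of u] u by (intro add_left_mono mult_left_mono) (simp_all del: U_simps(2))
    also have "\<dots> = C * ip_norm W w" by (simp add: C_def algebra_simps)
    also have "\<dots> \<le> C * (e / (C + 1))" using f(2) C by (intro mult_left_mono) (auto simp: w_def)
    also have "\<dots> \<le> e" using C e by (simp add: field_simps)
    finally show ?thesis .
  qed
  then have "cmod (form K (R u) v - form K u (R' v)) \<le> 0"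
    using field_le_epsilon[of "cmod (form K (R u) v - form K u (R' v))" 0] by simp
  then show ?thesis by simp
qed

end

section \<open>Finitely supported functions and kernels\<close>

text \<open>The order relation between kernels compares diagonal values only. Polarizing the form
  and applying the parallelogram law to Q yields 4 Re [x, y] \<le> 2 Q x + 2 Q y, and scaling then
  gives the Cauchy-Schwarz bound.\<close>

lemma majorizedI:
  assumes "indefinite_ip V" "quadratic_functional V Q"
    and le: "\<And>f. f \<in> carr V \<Longrightarrow> \<bar>Re (form V f f)\<bar> \<le> Q f"
  shows "majorized V Q"
proof -
  interpret indefinite_ip V by fact
  interpret quadratic V Q by unfold_locales fact
  show ?thesis
  proof unfold_locales
    fix f g assume f: "f \<in> carr V" and g: "g \<in> carr V"
    obtain c where c: "cmod c = 1" "c * form V f g = of_real (cmod (form V f g))"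
      using cmod_rotation .
    have "0 \<le> Q f - 2 * t * cmod (form V f g) + t\<^sup>2 * Q g" for t
    proof -
      let ?x = "scl V c f" and ?y = "scl V (of_real t) g"
      have x: "?x \<in> carr V" "?y \<in> carr V" using f g by simp_all
      have "Re (form V ?x ?y) = t * cmod (form V f g)"
        using f g c(2) by (simp add: form_scl_left form_scl_right)
      moreover have "4 * Re (form V ?x ?y) \<le> 2 * Q ?x + 2 * Q ?y"
        using Q_parallelogram[OF x] form_self_add[OF x] form_self_diff[OF x]
          le[OF carr_add[OF x]] le[OF carr_diff[OF x]] by linarith
      ultimately show ?thesis using f g c(1) by (simp add: Q_scl)
    qed
    from discriminant_bound[OF Q_nonneg[OF g] this]
    show "(cmod (form V f g))\<^sup>2 \<le> Q f * Q g" .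
  qed
qed

lemma fin_suppD: "f \<in> fin_supp \<Longrightarrow> finite {x. f x \<noteq> 0}"
  by (simp add: fin_supp_def)

lemma delta_fin_supp [simp]: "delta \<xi> x \<in> fin_supp"
proof -
  have "{z. delta \<xi> x z \<noteq> 0} \<subseteq> {x}" by (auto simp: delta_def)
  then show ?thesis unfolding fin_supp_def using finite_subset by blast
qed

lemma psi_fin_supp:
  assumes "f \<in> fin_supp" shows "psi \<phi> a f \<in> fin_supp"
proof -
  have "psi \<phi> a f z = 0" if "z \<notin> \<phi> a ` {x. f x \<noteq> 0}" for z
  proof -
    have "{x. f x \<noteq> 0 \<and> \<phi> a x = z} = {}" using that by auto
    then show ?thesis unfolding psi_def by (simp only: sum.empty)
  qed
  then have "{z. psi \<phi> a f z \<noteq> 0} \<subseteq> \<phi> a ` {x. f x \<noteq> 0}" by blast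
  then show ?thesis
    using assms finite_subset unfolding fin_supp_def by blast
qed

text \<open>Regroups the sum along the fibres of \<open>\<phi> a\<close>. Additivity gives
  \<open>G z 0 = 0\<close>, so points where the values on a fibre cancel do no harm.\<close>

lemma sum_psi:
  fixes G :: "'a \<Rightarrow> 'h::ab_group_add \<Rightarrow> 'b::ab_group_add"
  assumes f: "f \<in> fin_supp" and add: "\<And>z x y. G z (x + y) = G z x + G z y"
  shows "(\<Sum>z | psi \<phi> a f z \<noteq> 0. G z (psi \<phi> a f z)) = (\<Sum>x | f x \<noteq> 0. G (\<phi> a x) (f x))"
proof -
  let ?S = "{x. f x \<noteq> 0}"
  have S: "finite ?S" using f by (rule fin_suppD)
  have zero: "G z 0 = 0" for z using add[of z 0 0] by simp
  have sum: "G z (sum h I) = (\<Sum>i\<in>I. G z (h i))" for z I and h :: "'a \<Rightarrow> 'h"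
    by (induction I rule: infinite_finite_induct) (simp_all add: zero add)
  have "{z. psi \<phi> a f z \<noteq> 0} \<subseteq> \<phi> a ` ?S"
    using sum.empty by (force simp: psi_def elim: sum.not_neutral_contains_not_neutral)
  then have "(\<Sum>z | psi \<phi> a f z \<noteq> 0. G z (psi \<phi> a f z)) = (\<Sum>z\<in>\<phi> a ` ?S. G z (psi \<phi> a f z))"
    using S by (intro sum.mono_neutral_left) (auto simp: zero)
  also have "\<dots> = (\<Sum>z\<in>\<phi> a ` ?S. \<Sum>x | x \<in> ?S \<and> \<phi> a x = z. G (\<phi> a x) (f x))"
    by (intro sum.cong refl) (simp add: psi_def sum)
  also have "\<dots> = (\<Sum>x\<in>?S. G (\<phi> a x) (f x))"
    by (rule sum.image_gen[OF S, symmetric])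
  finally show ?thesis .
qed

text \<open>Only the second argument has to be finitely supported. Thus arbitrary functions
  represent functionals, and \<open>'a \<Rightarrow> 'h\<close> can serve as ambient space of the
  dilation.\<close>

definition pairing :: "'h::ab_group_add ip_space \<Rightarrow> ('a \<Rightarrow> 'h) \<Rightarrow> ('a \<Rightarrow> 'h) \<Rightarrow> complex" where
  "pairing H u g = (\<Sum>x | g x \<noteq> 0. form H (u x) (g x))"

definition kernel_apply :: "('a \<Rightarrow> 'a \<Rightarrow> 'h \<Rightarrow> 'h) \<Rightarrow> ('a \<Rightarrow> 'h) \<Rightarrow> 'a \<Rightarrow> 'h::ab_group_add" where
  "kernel_apply M f x = (\<Sum>y | f y \<noteq> 0. M x y (f y))"

definition fun_scl :: "'h ip_space \<Rightarrow> complex \<Rightarrow> ('a \<Rightarrow> 'h) \<Rightarrow> 'a \<Rightarrow> 'h" where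
  "fun_scl H c f = (\<lambda>x. scl H c (f x))"

definition fin_supp_space ::
    "'h::ab_group_add ip_space \<Rightarrow> ('a \<Rightarrow> 'a \<Rightarrow> 'h \<Rightarrow> 'h) \<Rightarrow> ('a \<Rightarrow> 'h) ip_space" where
  "fin_supp_space H M = \<lparr>scl = fun_scl H, carr = fin_supp, form = kernel_form H M\<rparr>"

lemma fin_supp_space_simps [simp]:
  "scl (fin_supp_space H M) = fun_scl H" "carr (fin_supp_space H M) = fin_supp"
  "form (fin_supp_space H M) = kernel_form H M"
  by (simp_all add: fin_supp_space_def)

section \<open>Pairings and kernels of Krein space operators\<close>

locale full_krein = krein_pair H "hilb H" J for H :: "'h::ab_group_add ip_space" and J +
  assumes carr_UNIV [simp]: "carr H = UNIV"
begin

lemma form_sum_left: "form H (sum f I) x = (\<Sum>i\<in>I. form H (f i) x)"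
  by (rule V.form_sum_left) simp_all

lemma pairing_eq_sum:
  assumes "finite S" "{x. g x \<noteq> 0} \<subseteq> S"
  shows "pairing H u g = (\<Sum>x\<in>S. form H (u x) (g x))"
  unfolding pairing_def using assms by (intro sum.mono_neutral_left) auto

lemma pairing_add_left: "pairing H (u + v) g = pairing H u g + pairing H v g"
  by (simp add: pairing_def V.form_add_left sum.distrib)

lemma pairing_scl_left: "pairing H (fun_scl H c u) g = c * pairing H u g"
  by (simp add: pairing_def fun_scl_def V.form_scl_left sum_distrib_left)

lemma pairing_add_right:
  assumes "f \<in> fin_supp" "g \<in> fin_supp"
  shows "pairing H u (f + g) = pairing H u f + pairing H u g"
proof -
  let ?S = "{x. f x \<noteq> 0} \<union> {x. g x \<noteq> 0}"
  have S: "finite ?S" using assms by (simp add: fin_suppD)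
  have "pairing H u (f + g) = (\<Sum>x\<in>?S. form H (u x) ((f + g) x))"
    by (rule pairing_eq_sum[OF S]) auto
  also have "\<dots> = (\<Sum>x\<in>?S. form H (u x) (f x)) + (\<Sum>x\<in>?S. form H (u x) (g x))"
    by (simp add: V.form_add_right sum.distrib)
  also have "\<dots> = pairing H u f + pairing H u g"
    using pairing_eq_sum[OF S, of f u] pairing_eq_sum[OF S, of g u] by simp
  finally show ?thesis .
qed

lemma pairing_scl_right:
  assumes "f \<in> fin_supp"
  shows "pairing H u (fun_scl H c f) = cnj c * pairing H u f"
proof -
  have "pairing H u (fun_scl H c f) = (\<Sum>x | f x \<noteq> 0. form H (u x) (fun_scl H c f x))"
    using assms by (intro pairing_eq_sum) (auto simp: fin_suppD fun_scl_def)
  then show ?thesis by (simp add: pairing_def fun_scl_def V.form_scl_right sum_distrib_left)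
qed

lemma pairing_delta: "pairing H u (delta \<xi> x) = form H (u x) \<xi>"
  by (subst pairing_eq_sum[of "{x}"]) (auto simp: delta_def)

lemma pairing_psi:
  assumes f: "f \<in> fin_supp"
  shows "pairing H u (psi \<phi> a f) = pairing H (\<lambda>x. u (\<phi> a x)) f"
  unfolding pairing_def by (rule sum_psi[OF f]) (simp add: V.form_add_right)

lemma vector_space_fun_scl: "vector_space (fun_scl H :: complex \<Rightarrow> ('a \<Rightarrow> 'h) \<Rightarrow> _)"
  by unfold_locales
    (auto simp: fun_scl_def fun_eq_iff V.scale_right_distrib V.scale_left_distrib)

lemma fin_supp_add: "f \<in> fin_supp \<Longrightarrow> g \<in> fin_supp \<Longrightarrow> (f + g :: 'a \<Rightarrow> 'h) \<in> fin_supp"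
  unfolding fin_supp_def mem_Collect_eq
  by (rule finite_subset[of _ "{x. f x \<noteq> 0} \<union> {x. g x \<noteq> 0}"]) auto

lemma fin_supp_scl: "f \<in> fin_supp \<Longrightarrow> fun_scl H c f \<in> fin_supp"
  unfolding fin_supp_def mem_Collect_eq
  by (rule finite_subset[of _ "{x. f x \<noteq> 0}"]) (auto simp: fun_scl_def)

lemma kernel_form_eq: "kernel_form H M f g = pairing H (kernel_apply M f) g"
  by (simp add: kernel_form_def pairing_def kernel_apply_def form_sum_left)

lemma krein_ops_iff:
  "A \<in> krein_ops H H \<longleftrightarrow> (\<forall>x y. A (x + y) = A x + A y) \<and> (\<forall>c x. A (scl H c x) = scl H c (A x)) \<and>
    (\<exists>b. \<forall>x. ip_norm (hilb H) (A x) \<le> b * ip_norm (hilb H) x)"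
  by (simp add: krein_ops_def hilbert_ops_def)

lemma krein_ops_zero: "A \<in> krein_ops H H \<Longrightarrow> A 0 = 0"
  unfolding krein_ops_iff by (metis add_cancel_right_right)

lemma form_adjoint_krein_op:
  assumes "A \<in> krein_ops H H"
  shows "form H z (adjoint_op H H A y) = form H (A z) y"
  by (rule form_adjoint_op[OF krein_pair_axioms krein_pair_axioms]) (use assms in \<open>simp_all add: krein_ops_def\<close>)

context
  fixes M :: "'a \<Rightarrow> 'a \<Rightarrow> 'h \<Rightarrow> 'h"
  assumes M_ops: "\<And>x y. M x y \<in> krein_ops H H"
begin

lemma kernel_apply_eq_sum:
  assumes "finite S" "{x. f x \<noteq> 0} \<subseteq> S"
  shows "kernel_apply M f x = (\<Sum>y\<in>S. M x y (f y))"
  unfolding kernel_apply_def using assms krein_ops_zero[OF M_ops] by (intro sum.mono_neutral_left) auto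

lemma kernel_apply_add:
  assumes "f \<in> fin_supp" "g \<in> fin_supp"
  shows "kernel_apply M (f + g) = kernel_apply M f + kernel_apply M g"
proof
  fix x
  let ?S = "{x. f x \<noteq> 0} \<union> {x. g x \<noteq> 0}"
  have S: "finite ?S" using assms by (simp add: fin_suppD)
  have add: "M x y (\<xi> + \<eta>) = M x y \<xi> + M x y \<eta>" for y \<xi> \<eta> using M_ops krein_ops_iff by blast
  have "kernel_apply M (f + g) x = (\<Sum>y\<in>?S. M x y ((f + g) y))"
    by (rule kernel_apply_eq_sum[OF S]) auto
  also have "\<dots> = (\<Sum>y\<in>?S. M x y (f y)) + (\<Sum>y\<in>?S. M x y (g y))"
    by (simp add: add sum.distrib)
  finally show "kernel_apply M (f + g) x = (kernel_apply M f + kernel_apply M g) x"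
    using kernel_apply_eq_sum[OF S, of f x] kernel_apply_eq_sum[OF S, of g x] by simp
qed

lemma kernel_apply_scl:
  assumes "f \<in> fin_supp"
  shows "kernel_apply M (fun_scl H c f) = fun_scl H c (kernel_apply M f)"
proof
  fix x
  have scl: "M x y (scl H c \<xi>) = scl H c (M x y \<xi>)" for y \<xi> using M_ops krein_ops_iff by blast
  have "kernel_apply M (fun_scl H c f) x = (\<Sum>y | f y \<noteq> 0. M x y (fun_scl H c f y))"
    using assms by (intro kernel_apply_eq_sum) (auto simp: fin_suppD fun_scl_def)
  then show "kernel_apply M (fun_scl H c f) x = fun_scl H c (kernel_apply M f) x"
    by (simp add: kernel_apply_def fun_scl_def scl V.scale_sum_right)
qed

lemma kernel_apply_delta: "kernel_apply M (delta \<xi> y) x = M x y \<xi>"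
  by (subst kernel_apply_eq_sum[of "{y}"]) (auto simp: delta_def)

lemma kernel_apply_psi:
  assumes f: "f \<in> fin_supp"
  shows "kernel_apply M (psi \<phi> a f) x = kernel_apply (\<lambda>x y. M x (\<phi> a y)) f x"
  unfolding kernel_apply_def
proof (rule sum_psi[OF f])
  show "M x z (\<xi> + \<eta>) = M x z \<xi> + M x z \<eta>" for z \<xi> \<eta> using M_ops krein_ops_iff by blast
qed

lemma indefinite_ip_fin_supp_space:
  assumes sym: "\<And>x y \<xi> \<eta>. form H (M x y \<xi>) \<eta> = form H \<xi> (M y x \<eta>)"
  shows "indefinite_ip (fin_supp_space H M)"
proof (intro indefinite_ip.intro lin_carrier.intro)
  interpret F: vector_space "fun_scl H :: complex \<Rightarrow> ('a \<Rightarrow> 'h) \<Rightarrow> _" by (rule vector_space_fun_scl)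
  show "vector_space (scl (fin_supp_space H M))" by (simp add: vector_space_fun_scl)
  show "module.subspace (scl (fin_supp_space H M)) (carr (fin_supp_space H M))"
    unfolding fin_supp_space_simps
    by (rule F.subspaceI) (simp_all add: fin_supp_add fin_supp_scl, simp add: fin_supp_def)
  show "indefinite_ip_axioms (fin_supp_space H M)"
  proof (unfold_locales, unfold fin_supp_space_simps)
    fix f g h :: "'a \<Rightarrow> 'h" and c
    assume f: "f \<in> fin_supp" and g: "g \<in> fin_supp"
    show "kernel_form H M (fun_scl H c f) g = c * kernel_form H M f g"
      by (simp add: kernel_form_eq kernel_apply_scl[OF f] pairing_scl_left)
    have "form H (M x y (f y)) (g x) = cnj (form H (M y x (g x)) (f y))" for x y
      using sym[of x y "f y" "g x"] V.form_swap[of "M y x (g x)" "f y"] by simp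
    then have "cnj (kernel_form H M f g) = (\<Sum>x | g x \<noteq> 0. \<Sum>y | f y \<noteq> 0. form H (M y x (g x)) (f y))"
      by (simp add: kernel_form_def)
    also have "\<dots> = kernel_form H M g f"
      unfolding kernel_form_def by (rule sum.swap)
    finally show "kernel_form H M g f = cnj (kernel_form H M f g)" by simp
    show "kernel_form H M (f + g) h = kernel_form H M f h + kernel_form H M g h"
      by (simp add: kernel_form_eq kernel_apply_add[OF f g] pairing_add_left)
  qed
qed

end

lemma fin_supp_induct [consumes 1, case_names zero add]:
  assumes f: "f \<in> fin_supp" and "P 0"
    and add: "\<And>f x \<xi>. f \<in> fin_supp \<Longrightarrow> P f \<Longrightarrow> P (delta \<xi> x + f)"
  shows "P (f :: 'a \<Rightarrow> 'h)"
proof -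
  have "\<forall>f :: 'a \<Rightarrow> 'h. {x. f x \<noteq> 0} \<subseteq> S \<longrightarrow> P f" if "finite S" for S
    using that
  proof induction
    case empty
    have "f = 0" if "{x. f x \<noteq> 0} \<subseteq> {}" for f :: "'a \<Rightarrow> 'h" using that by (auto simp: fun_eq_iff)
    then show ?case using \<open>P 0\<close> by metis
  next
    case (insert x S)
    show ?case
    proof (intro allI impI)
      fix f :: "'a \<Rightarrow> 'h" assume f: "{x. f x \<noteq> 0} \<subseteq> insert x S"
      define g where "g = f(x := 0)"
      have g: "{x. g x \<noteq> 0} \<subseteq> S" using f by (auto simp: g_def)
      then have "g \<in> fin_supp" using insert.hyps(1) finite_subset unfolding fin_supp_def by blast
      moreover have "P g" using insert.IH g by blast
      ultimately have "P (delta (f x) x + g)" by (rule add)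
      moreover have "delta (f x) x + g = f" by (auto simp: fun_eq_iff delta_def g_def)
      ultimately show "P f" by simp
    qed
  qed
  then show ?thesis using f fin_suppD by blast
qed

text \<open>Riesz in H, one coordinate at a time. The constant \<open>b x\<close> may vary with x,
  because u is subject to no growth condition.\<close>

lemma pairing_surj:
  assumes M: "bounded_functional (fin_supp_space H N) Q l"
    and Q: "\<And>x \<xi>. Q (delta \<xi> x) \<le> b x * (ip_norm (hilb H) \<xi>)\<^sup>2"
  obtains u where "\<And>g. g \<in> fin_supp \<Longrightarrow> pairing H u g = l (g :: 'a \<Rightarrow> 'h)"
proof -
  obtain C where C: "C \<ge> 0" "\<And>g. g \<in> fin_supp \<Longrightarrow> (cmod (l g))\<^sup>2 \<le> C * Q g"
    using M by (auto simp: bounded_functional_def)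
  have l_add: "l (f + g) = l f + l g" if "f \<in> fin_supp" "g \<in> fin_supp" for f g
    using M that by (auto simp: bounded_functional_def conj_linear_on_def)
  have l_scl: "l (fun_scl H c f) = cnj c * l f" if "f \<in> fin_supp" for f c
    using M that by (auto simp: bounded_functional_def conj_linear_on_def)
  have "\<exists>w. \<forall>\<xi>. l (delta \<xi> x) = form H w \<xi>" for x
  proof -
    \<comment> \<open>Conjugation is needed because l is conjugate-linear, while Riesz is stated for
      linear functionals.\<close>
    obtain w where w: "\<And>\<xi>. \<xi> \<in> carr (hilb H) \<Longrightarrow> cnj (l (delta \<xi> x)) = form (hilb H) \<xi> w"
    proof (rule W.Riesz)
      fix \<xi> \<eta> :: 'h and c
      have "delta (\<xi> + \<eta>) x = delta \<xi> x + delta \<eta> x" by (auto simp: delta_def)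
      then show "cnj (l (delta (\<xi> + \<eta>) x)) = cnj (l (delta \<xi> x)) + cnj (l (delta \<eta> x))"
        by (simp add: l_add)
      have "delta (scl H c \<xi>) x = fun_scl H c (delta \<xi> x)" by (auto simp: delta_def fun_scl_def)
      then show "cnj (l (delta (scl (hilb H) c \<xi>) x)) = c * cnj (l (delta \<xi> x))"
        by (simp add: l_scl)
      have n: "0 \<le> ip_norm (hilb H) \<xi>" using W.ip_norm_nonneg[of \<xi>] by simp
      have "(cmod (l (delta \<xi> x)))\<^sup>2 \<le> C * (b x * (ip_norm (hilb H) \<xi>)\<^sup>2)"
        using C(2)[of "delta \<xi> x"] mult_left_mono[OF Q C(1)] by (meson delta_fin_supp order_trans)
      \<comment> \<open>The modulus makes the constant admissible under a square root, as
        \<open>b x\<close> has no assumed sign.\<close>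
      also have "\<dots> \<le> (C * \<bar>b x\<bar>) * (ip_norm (hilb H) \<xi>)\<^sup>2"
        using C(1) by (simp add: mult_left_mono mult_right_mono mult.assoc)
      finally show "cmod (cnj (l (delta \<xi> x))) \<le> sqrt (C * \<bar>b x\<bar>) * ip_norm (hilb H) \<xi>"
        using real_le_rsqrt n by (fastforce simp: real_sqrt_mult)
    qed blast
    have "l (delta \<xi> x) = form H (J w) \<xi>" for \<xi>
      using w[of \<xi>] W.form_swap[of \<xi> w] form_J_left[of w \<xi>] by (simp add: complex_cnj_cancel_iff flip: w)
    then show ?thesis by blast
  qed
  then obtain u where u: "\<And>x \<xi>. l (delta \<xi> x) = form H (u x) \<xi>" by metis
  have "pairing H u g = l g" if "g \<in> fin_supp" for g
    using that
  proof (induction rule: fin_supp_induct)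
    case zero
    show ?case using l_scl[of 0 0] by (simp add: pairing_def fin_supp_def fun_scl_def zero_fun_def)
  next
    case (add f x \<xi>)
    then show ?case
      by (simp only: pairing_add_right[OF delta_fin_supp] l_add[OF delta_fin_supp] pairing_delta u)
  qed
  then show thesis by (rule that)
qed

lemma pairing_inj:
  assumes "\<And>g. g \<in> fin_supp \<Longrightarrow> pairing H u g = 0"
  shows "u = 0"
proof
  fix x
  have "form H (u x) \<xi> = 0" for \<xi> using assms[of "delta \<xi> x"] by (simp add: pairing_delta)
  then show "u x = 0 x"
    using nondegenerate[of "u x"] V.form_swap[of "u x"] by simp
qed

end

section \<open>Kernels and dilations\<close>

locale hermitian_map = full_krein H J + A: unital_star_algebra sA star
  for H :: "'h::ab_group_add ip_space" and J
    and sA :: "complex \<Rightarrow> 'a::{ring,monoid_mult} \<Rightarrow> 'a" and star +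
  fixes T :: "'a \<Rightarrow> 'h \<Rightarrow> 'h"
  assumes T_ops: "T a \<in> krein_ops H H"
    and T_linear: "Vector_Spaces.linear sA (scl H) (\<lambda>a. T a \<xi>)"
    and T_hermitian: "T (star a) = adjoint_op H H (T a)"
begin

lemma star_one: "star 1 = 1"
  by (metis A.star_mult A.star_star mult_1_left)

lemma form_T_star: "form H (T a \<xi>) \<eta> = form H \<xi> (T (star a) \<eta>)"
  unfolding T_hermitian by (rule form_adjoint_krein_op[OF T_ops, symmetric])

lemma T_add: "T (a + b) \<xi> = T a \<xi> + T b \<xi>" and T_scl: "T (sA c a) \<xi> = scl H c (T a \<xi>)"
  using T_linear[of \<xi>] by (auto simp: Vector_Spaces.linear_iff)

abbreviation kernel_T where "kernel_T \<equiv> \<lambda>x y. T (x * star y)"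

lemma form_kernel_T: "form H (kernel_T x y \<xi>) \<eta> = form H \<xi> (kernel_T y x \<eta>)"
  unfolding form_T_star by (simp add: A.star_mult A.star_star)

text \<open>The ambient type of the dilation space is left free, so that a dilation on any type can
  be converted into a kernel.\<close>

lemma kernel_if_dilation:
  assumes "has_minimal_stinespring_dilation TYPE('k::ab_group_add) sA star H T"
  obtains L where "L \<in> phi_bounded_pd_kernels H (\<lambda>a x. x * star a)"
    "kernel_le H (- L) kernel_T" "kernel_le H kernel_T L"
proof -
  from assms obtain \<pi> and K :: "'k ip_space" and B where dil: "stinespring_dilation sA star H T \<pi> K B"
    unfolding has_minimal_stinespring_dilation_def minimal_stinespring_dilation_def by blast
  then have K: "krein_space K" and sr: "selfadjoint_representation sA star K \<pi>"
    and B: "B \<in> krein_ops H K" and T: "\<And>a \<xi>. T a \<xi> = adjoint_op H K B (\<pi> a (B \<xi>))"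
    by (auto simp: stinespring_dilation_def)
  obtain JK where "krein_pair K (hilb K) JK" using krein_space_hilb[OF K] .
  then interpret K: krein_pair K "hilb K" JK .
  note HK = krein_pair_axioms K.krein_pair_axioms
  have B': "B \<in> hilbert_ops (hilb H) (hilb K)" using B by (simp add: krein_ops_def)
  have \<pi>: "\<pi> a \<in> hilbert_ops (hilb K) (hilb K)" for a
    using sr by (simp add: selfadjoint_representation_def krein_ops_def)
  have Bc: "B \<xi> \<in> carr K" for \<xi> using B' by (auto simp: hilbert_ops_def)
  have \<pi>c: "\<pi> a v \<in> carr K" if "v \<in> carr K" for a v using \<pi>[of a] that by (auto simp: hilbert_ops_def)
  have \<pi>_mult: "\<pi> (a * b) v = \<pi> a (\<pi> b v)" if "v \<in> carr K" for a b v
    using sr that by (simp add: selfadjoint_representation_def)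
  have \<pi>_star: "form K u (\<pi> a v) = form K (\<pi> (star a) u) v" if "u \<in> carr K" "v \<in> carr K" for a u v
  proof -
    have "\<pi> (star (star a)) v = adjoint_op K K (\<pi> (star a)) v"
      using sr that by (simp only: selfadjoint_representation_def)
    then show ?thesis
      using form_adjoint_op[OF HK(2) HK(2) \<pi>[of "star a"], of v u] that by (simp add: A.star_star)
  qed
  define Bs where "Bs = adjoint_op H K B"
  have Bs: "Bs \<in> hilbert_ops (hilb K) (hilb H)"
    unfolding Bs_def by (rule adjoint_op_hilbert_ops[OF HK B'])
  have form_Bs: "form H \<xi> (Bs v) = form K (B \<xi>) v" if "v \<in> carr K" for \<xi> v
    unfolding Bs_def using form_adjoint_op[OF HK B' that] by simp
  \<comment> \<open>\<open>K\<^sub>T\<close> and L become Gram kernels of the same vectors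
    \<open>G x \<xi>\<close>, in the indefinite and in the Hilbert form respectively. All claims
    about L then become claims about the sums \<open>F f\<close>.\<close>
  define G where "G x \<xi> = \<pi> (star x) (B \<xi>)" for x \<xi>
  have Gc: "G x \<xi> \<in> carr K" for x \<xi> unfolding G_def by (intro \<pi>c Bc)
  have G_add: "G x (\<xi> + \<eta>) = G x \<xi> + G x \<eta>" for x \<xi> \<eta>
    using B' \<pi>[of "star x"] Bc by (simp add: G_def hilbert_ops_def)
  define L where "L x y \<xi> = Bs (\<pi> x (JK (G y \<xi>)))" for x y \<xi>
  have form_L: "form H \<xi> (L x y \<eta>) = form (hilb K) (G x \<xi>) (G y \<eta>)" for x y \<xi> \<eta>
    unfolding L_def
    by (simp add: form_Bs \<pi>c K.J_carr Gc \<pi>_star Bc K.form_J_right flip: G_def)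
  have form_L': "form H (L x y \<xi>) \<eta> = form (hilb K) (G y \<xi>) (G x \<eta>)" for x y \<xi> \<eta>
    using V.form_swap[of \<eta> "L x y \<xi>"] K.W.form_swap[of "G x \<eta>" "G y \<xi>"] Gc by (simp add: form_L)
  have form_T: "form H (kernel_T x y \<xi>) \<eta> = form K (G y \<xi>) (G x \<eta>)" for x y \<xi> \<eta>
  proof -
    have "form H \<eta> (kernel_T x y \<xi>) = form K (G x \<eta>) (G y \<xi>)"
      by (simp add: T form_Bs \<pi>c Bc Gc \<pi>_star \<pi>_mult flip: Bs_def G_def)
    then show ?thesis
      using V.form_swap[of \<eta> "kernel_T x y \<xi>"] K.V.form_swap[of "G x \<eta>" "G y \<xi>"] Gc by simp
  qed
  define F where "F f = (\<Sum>x | f x \<noteq> 0. G x (f x))" for f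
  have Fc: "F f \<in> carr K" for f unfolding F_def by (intro K.V.carr_sum Gc)
  \<comment> \<open>Stated for any form on the carrier of K, as it serves both the Hilbert and the
    indefinite form.\<close>
  have sum2: "(\<Sum>x\<in>X. \<Sum>y\<in>Y. form S (G y (f y)) (G x (g x))) =
      form S (\<Sum>y\<in>Y. G y (f y)) (\<Sum>x\<in>X. G x (g x))"
    if S: "indefinite_ip S" "carr S = carr K" for S X Y f g
  proof -
    interpret S: indefinite_ip S by fact
    have c: "G x \<xi> \<in> carr S" for x \<xi> using Gc S by simp
    have right: "form S u (\<Sum>x\<in>X. G x (g x)) = (\<Sum>x\<in>X. form S u (G x (g x)))" if "u \<in> carr S" for u
      using S.form_swap[OF S.carr_sum[of X "\<lambda>x. G x (g x)"] that] S.form_swap[OF c that] c that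
      by (simp add: S.form_sum_left)
    show ?thesis by (simp add: right S.carr_sum c S.form_sum_left)
  qed
  have kf_L: "kernel_form H L f g = form (hilb K) (F f) (F g)" for f g
    unfolding kernel_form_def F_def form_L'
    by (rule sum2) (simp_all add: K.W.indefinite_ip_axioms)
  have kf_T: "kernel_form H kernel_T f g = form K (F f) (F g)" for f g
    unfolding kernel_form_def F_def form_T
    by (rule sum2) (simp_all add: K.V.indefinite_ip_axioms)
  have kf_minus: "kernel_form H (- L) f g = - kernel_form H L f g" for f g
    by (simp add: kernel_form_def V.form_neg_left sum_negf)
  \<comment> \<open>F intertwines \<psi> with \<pi>, so \<phi>-boundedness of L is boundedness of
    the operators \<open>\<pi> a\<close>.\<close>
  have F_psi: "F (psi (\<lambda>a x. x * star a) a f) = \<pi> a (F f)" if f: "f \<in> fin_supp" for a f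
  proof -
    have zero: "\<pi> a 0 = 0" using \<pi>[of a] unfolding hilbert_ops_def
      by simp (metis K.V.carr_zero add_cancel_right_right)
    have sum: "\<pi> a (\<Sum>x\<in>X. G x (f x)) = (\<Sum>x\<in>X. \<pi> a (G x (f x)))" for X
    proof (induction X rule: infinite_finite_induct)
      case (insert x X)
      then show ?case using \<pi>[of a] Gc by (simp add: hilbert_ops_def K.V.carr_sum)
    qed (simp_all add: zero)
    have "F (psi (\<lambda>a x. x * star a) a f) = (\<Sum>x | f x \<noteq> 0. G (x * star a) (f x))"
      unfolding F_def by (rule sum_psi[OF f G_add])
    also have "\<dots> = (\<Sum>x | f x \<noteq> 0. \<pi> a (G x (f x)))"
      by (simp add: G_def A.star_mult A.star_star \<pi>_mult Bc)
    also have "\<dots> = \<pi> a (F f)" unfolding F_def by (rule sum[symmetric])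
    finally show ?thesis .
  qed
  have L_ops: "L x y \<in> krein_ops H H" for x y
  proof -
    have JK: "JK \<in> hilbert_ops (hilb K) (hilb K)"
      by (auto simp: hilbert_ops_def K.J_carr K.J_add K.J_scl K.ip_norm_J intro!: exI[of _ 1])
    note s = K.W.semi_ip_axioms W.semi_ip_axioms
    have "(\<lambda>\<xi>. \<pi> (star y) (B \<xi>)) \<in> hilbert_ops (hilb H) (hilb K)"
      using \<pi> B' s(1) s(1) s(2) by (rule hilbert_ops_compose)
    from hilbert_ops_compose[OF JK this s(1) s(1) s(2)]
    have "(\<lambda>\<xi>. JK (\<pi> (star y) (B \<xi>))) \<in> hilbert_ops (hilb H) (hilb K)" .
    from hilbert_ops_compose[OF \<pi> this s(1) s(1) s(2)]
    have "(\<lambda>\<xi>. \<pi> x (JK (\<pi> (star y) (B \<xi>)))) \<in> hilbert_ops (hilb H) (hilb K)" .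
    from hilbert_ops_compose[OF Bs this s(1) s(2) s(2)]
    show ?thesis unfolding krein_ops_def L_def G_def .
  qed
  have L_herm: "L x y = adjoint_op H H (L y x)" for x y
  proof
    fix \<eta>
    have "adjoint_op H H (L y x) \<eta> = L x y \<eta>"
    proof (rule adjoint_op_eqI[OF krein_pair_axioms krein_pair_axioms])
      show "L y x \<in> hilbert_ops (hilb H) (hilb H)" using L_ops by (simp add: krein_ops_def)
    qed (simp_all add: form_L form_L')
    then show "L x y \<eta> = adjoint_op H H (L y x) \<eta>" ..
  qed
  have "positive_definite_kernel H L"
    unfolding positive_definite_kernel_def hermitian_kernel_def kf_L
    by (intro conjI allI ballI L_ops L_herm K.W.form_nonneg) (simp add: Fc)
  moreover have "\<exists>c. \<forall>f\<in>fin_supp. sqrt (Re (kernel_form H L (psi (\<lambda>a x. x * star a) a f) (psi (\<lambda>a x. x * star a) a f)))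
      \<le> c * sqrt (Re (kernel_form H L f f))" for a
  proof -
    obtain b where "\<And>v. v \<in> carr (hilb K) \<Longrightarrow> ip_norm (hilb K) (\<pi> a v) \<le> b * ip_norm (hilb K) v"
      using hilbert_opsE[OF \<pi> K.W.semi_ip_axioms] by metis
    then show ?thesis
      by (intro exI[of _ b]) (simp add: kf_L F_psi Fc flip: ip_norm_def)
  qed
  ultimately have "L \<in> phi_bounded_pd_kernels H (\<lambda>a x. x * star a)"
    by (simp add: phi_bounded_pd_kernels_def)
  \<comment> \<open>The fundamental symmetry is isometric, so the modulus of [v, v] is at most the
    squared Hilbert norm of v; here v = \<open>F f\<close>.\<close>
  moreover have "\<bar>Re (kernel_form H kernel_T f f)\<bar> \<le> Re (kernel_form H L f f)" for f
    using abs_Re_le_cmod[of "form K (F f) (F f)"] K.cmod_form_le[OF Fc[of f] Fc[of f]]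
      K.W.ip_norm_power2[of "F f"] Fc[of f]
    by (simp add: kf_L kf_T power2_eq_square)
  then have "kernel_le H (- L) kernel_T" "kernel_le H kernel_T L"
    by (simp_all add: kernel_le_def kf_minus abs_le_iff minus_le_iff)
  ultimately show thesis by (rule that)
qed

lemma dilation_if_kernel:
  assumes L: "L \<in> phi_bounded_pd_kernels H (\<lambda>a x. x * star a)"
    and le: "kernel_le H (- L) kernel_T" "kernel_le H kernel_T L"
  shows "has_minimal_stinespring_dilation TYPE('a \<Rightarrow> 'h) sA star H T"
proof -
  let ?\<phi> = "\<lambda>a x. x * star a"
  from L have L_ops: "\<And>x y. L x y \<in> krein_ops H H" and L_adj: "\<And>x y. L x y = adjoint_op H H (L y x)"
    and L_pos: "\<And>f. f \<in> fin_supp \<Longrightarrow> 0 \<le> Re (kernel_form H L f f)"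
    and L_bdd: "\<And>a. \<exists>c. \<forall>f\<in>fin_supp. sqrt (Re (kernel_form H L (psi ?\<phi> a f) (psi ?\<phi> a f)))
      \<le> c * sqrt (Re (kernel_form H L f f))"
    unfolding phi_bounded_pd_kernels_def positive_definite_kernel_def hermitian_kernel_def by blast+
  define q where "q f = Re (kernel_form H L f f)" for f
  have q_nonneg: "0 \<le> q f" if "f \<in> fin_supp" for f using L_pos[OF that] by (simp add: q_def)
  have form_L: "form H (L x y \<xi>) \<eta> = form H \<xi> (L y x \<eta>)" for x y \<xi> \<eta>
    using form_adjoint_krein_op[OF L_ops, of \<xi> x y \<eta>] L_adj[of y x] by simp
  have kf_minus: "kernel_form H (- L) f g = - kernel_form H L f g" for f g
    by (simp add: kernel_form_def V.form_neg_left sum_negf)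
  have le_q: "\<bar>Re (kernel_form H kernel_T f f)\<bar> \<le> q f" if "f \<in> fin_supp" for f
    using le that unfolding kernel_le_def q_def kf_minus by (force simp: abs_le_iff)
  interpret IT: indefinite_ip "fin_supp_space H kernel_T"
    by (rule indefinite_ip_fin_supp_space[OF T_ops form_kernel_T])
  have semi: "semi_ip (fin_supp_space H L)"
    by (intro semi_ip.intro indefinite_ip_fin_supp_space[OF L_ops form_L] semi_ip_axioms.intro)
      (simp add: L_pos)
  \<comment> \<open>The notion depends on the linear structure alone, which the spaces for L and for
    \<open>kernel_T\<close> share.\<close>
  have q: "quadratic_functional (fin_supp_space H kernel_T) q"
    using semi_ip.quadratic_functional_form[OF semi] by (simp add: quadratic_functional_def q_def)
  interpret M: majorized "fin_supp_space H kernel_T" q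
    by (rule majorizedI[OF IT.indefinite_ip_axioms q]) (simp add: le_q)
  define Q where "Q = M.newton_lim"
  \<comment> \<open>Continuity on single coordinates, required for \<open>pairing_surj\<close>. It
    comes from the boundedness of \<open>L x x\<close> and passes to the limit Q because the
    iterates decrease.\<close>
  have "\<exists>b. \<forall>\<xi>. q (delta \<xi> x) \<le> b * (ip_norm (hilb H) \<xi>)\<^sup>2" for x :: 'a
  proof -
    obtain b where b: "b \<ge> 0" "\<And>\<xi>. \<xi> \<in> carr (hilb H) \<Longrightarrow> ip_norm (hilb H) (L x x \<xi>) \<le> b * ip_norm (hilb H) \<xi>"
      using hilbert_opsE[of "L x x", OF _ W.semi_ip_axioms] L_ops unfolding krein_ops_def by metis
    have "q (delta \<xi> x) \<le> b * (ip_norm (hilb H) \<xi>)\<^sup>2" for \<xi>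
    proof -
      have n: "0 \<le> ip_norm (hilb H) \<xi>" using W.ip_norm_nonneg[of \<xi>] by simp
      have "q (delta \<xi> x) = Re (form H (L x x \<xi>) \<xi>)"
        by (simp add: q_def kernel_form_eq pairing_delta kernel_apply_delta[OF L_ops])
      also have "\<dots> \<le> ip_norm (hilb H) (L x x \<xi>) * ip_norm (hilb H) \<xi>"
        using complex_Re_le_cmod cmod_form_le[of "L x x \<xi>" \<xi>] order_trans by fastforce
      also have "\<dots> \<le> (b * ip_norm (hilb H) \<xi>) * ip_norm (hilb H) \<xi>"
        using b n by (intro mult_right_mono) auto
      finally show ?thesis by (simp add: power2_eq_square mult.assoc)
    qed
    then show ?thesis by blast
  qed
  then obtain b where b: "\<And>x \<xi>. q (delta \<xi> x) \<le> b x * (ip_norm (hilb H) \<xi>)\<^sup>2" by metis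
  have Q_b: "Q (delta \<xi> x) \<le> b x * (ip_norm (hilb H) \<xi>)\<^sup>2" for x \<xi>
    using M.newton_lim_le[of "delta \<xi> x" 0] b[of \<xi> x] by (simp add: Q_def)
  interpret MQ: majorized "fin_supp_space H kernel_T" Q
    unfolding Q_def by (rule M.majorized_newton_lim)
  interpret D: antidual "fin_supp_space H kernel_T" Q "fun_scl H" "pairing H"
  proof unfold_locales
    show "MQ.dual f = Q f" if "f \<in> carr (fin_supp_space H kernel_T)" for f
      unfolding Q_def by (rule M.newton_lim_selfdual[OF that])
    interpret FS: vector_space "fun_scl H :: complex \<Rightarrow> ('a \<Rightarrow> 'h) \<Rightarrow> _" by (rule vector_space_fun_scl)
    show "conj_linear_on (fin_supp_space H kernel_T) (pairing H u)" for u
      by (simp add: conj_linear_on_def pairing_add_right pairing_scl_right)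
    show "\<exists>u. \<forall>g\<in>carr (fin_supp_space H kernel_T). pairing H u g = l g"
      if "bounded_functional (fin_supp_space H kernel_T) Q l" for l
      using pairing_surj[OF that Q_b] by (metis fin_supp_space_simps(2))
    show "u = 0" if "\<And>g. g \<in> carr (fin_supp_space H kernel_T) \<Longrightarrow> pairing H u g = 0" for u
      using pairing_inj[of u] that by simp
    fix u v :: "'a \<Rightarrow> 'h" and g c
    show "pairing H (u + v) g = pairing H u g + pairing H v g" by (rule pairing_add_left)
    show "pairing H (fun_scl H c u) g = c * pairing H u g" by (rule pairing_scl_left)
    show "fun_scl H c (u + v) = fun_scl H c u + fun_scl H c v" by (rule FS.scale_right_distrib)
    show "fun_scl H 1 u = u" by simp
    fix d
    show "fun_scl H (c + d) u = fun_scl H c u + fun_scl H d u" by (rule FS.scale_left_distrib)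
    show "fun_scl H c (fun_scl H d u) = fun_scl H (c * d) u" by simp
  qed
  define \<pi> where "\<pi> a u = (\<lambda>x. u (x * a))" for a :: 'a and u :: "'a \<Rightarrow> 'h"
  \<comment> \<open>This is the functional of \<open>delta \<xi> 1\<close>, as
    \<open>star 1 = 1\<close>; by the reproducing property its adjoint is evaluation at 1.\<close>
  define B where "B \<xi> = (\<lambda>x. T x \<xi>)" for \<xi>
  let ?S = "psi ?\<phi>"
  have pair_\<pi>: "pairing H (\<pi> a u) g = pairing H u (?S (star a) g)" if "g \<in> fin_supp" for a u g
    using pairing_psi[OF that, of u ?\<phi> "star a"] by (simp add: \<pi>_def A.star_star)
  \<comment> \<open>The invariance of the kernel: replacing y by \<open>y * star a\<close> has the
    same effect as replacing x by \<open>x * a\<close>, since both insert a between x and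
    \<open>star y\<close>.\<close>
  have adj: "kernel_form H kernel_T (?S a f) g = kernel_form H kernel_T f (?S (star a) g)"
    if f: "f \<in> fin_supp" and g: "g \<in> fin_supp" for a f g
  proof -
    have "kernel_apply kernel_T (?S a f) = \<pi> a (kernel_apply kernel_T f)"
      using kernel_apply_psi[OF T_ops f, of "\<lambda>x y. x * star y" ?\<phi> a]
      by (auto simp: \<pi>_def kernel_apply_def A.star_mult A.star_star mult.assoc)
    then show ?thesis by (simp add: kernel_form_eq pair_\<pi>[OF g])
  qed
  have "\<exists>c. c \<ge> 0 \<and> (\<forall>f\<in>fin_supp. q (?S a f) \<le> c * q f)" for a
  proof -
    obtain c where c: "\<And>f. f \<in> fin_supp \<Longrightarrow> sqrt (q (?S a f)) \<le> c * sqrt (q f)"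
      using L_bdd[of a] unfolding q_def by blast
    have "q (?S a f) \<le> c\<^sup>2 * q f" if f: "f \<in> fin_supp" for f
    proof -
      have "(sqrt (q (?S a f)))\<^sup>2 \<le> (c * sqrt (q f))\<^sup>2"
        using c[OF f] q_nonneg[OF psi_fin_supp[OF f, of ?\<phi> a]] by (intro power_mono) auto
      then show ?thesis
        using q_nonneg[OF f] q_nonneg[OF psi_fin_supp[OF f, of ?\<phi> a]] by (simp add: power_mult_distrib)
    qed
    then show ?thesis by (intro exI[of _ "c\<^sup>2"]) simp
  qed
  then obtain c0 where c0: "\<And>a. c0 a \<ge> 0" "\<And>a f. f \<in> fin_supp \<Longrightarrow> q (?S a f) \<le> c0 a * q f" by metis
  \<comment> \<open>The contraction argument needs one constant common to a map and its
    adjoint.\<close>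
  define c where "c a = max (c0 a) (c0 (star a))" for a
  have c: "c a \<ge> 0" "c (star a) = c a" for a
    using c0(1)[of a] by (auto simp: c_def A.star_star max.commute)
  have q_c: "q (?S a f) \<le> c a * q f" "q (?S (star a) f) \<le> c a * q f" if f: "f \<in> fin_supp" for a f
    using c0(2)[OF f, of a] c0(2)[OF f, of "star a"] q_nonneg[OF f]
    by (auto simp: c_def intro: order_trans[OF _ mult_right_mono])
  have Q_c: "Q (?S a f) \<le> c a * Q f" if "f \<in> fin_supp" for a f
    unfolding Q_def
    by (rule M.newton_lim_contract[of "?S a" "?S (star a)"])
      (use that psi_fin_supp adj c q_c in \<open>simp_all\<close>)
  have Q_c': "Q (?S (star a) f) \<le> c a * Q f" if "f \<in> fin_supp" for a f
    using Q_c[OF that, of "star a"] by (simp add: c)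
  have pair_\<pi>': "pairing H (\<pi> (star a) u) g = pairing H u (?S a g)" if "g \<in> fin_supp" for a u g
    using pair_\<pi>[OF that, of "star a" u] by (simp add: A.star_star)
  \<comment> \<open>The premises of the transpose lemmas: \<open>\<pi> a\<close> is the transpose of
    \<open>?S (star a)\<close>, and \<open>\<pi> (star a)\<close> that of
    \<open>?S a\<close>.\<close>
  have tr: "g \<in> carr (fin_supp_space H kernel_T) \<Longrightarrow> ?S a g \<in> carr (fin_supp_space H kernel_T)"
    "f \<in> carr (fin_supp_space H kernel_T) \<Longrightarrow> g \<in> carr (fin_supp_space H kernel_T) \<Longrightarrow>
      form (fin_supp_space H kernel_T) (?S a f) g = form (fin_supp_space H kernel_T) f (?S (star a) g)"
    "g \<in> carr (fin_supp_space H kernel_T) \<Longrightarrow> Q (?S a g) \<le> c a * Q g"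
    "g \<in> carr (fin_supp_space H kernel_T) \<Longrightarrow> Q (?S (star a) g) \<le> c a * Q g"
    "g \<in> carr (fin_supp_space H kernel_T) \<Longrightarrow> pairing H (\<pi> a u) g = pairing H u (?S (star a) g)"
    "g \<in> carr (fin_supp_space H kernel_T) \<Longrightarrow> pairing H (\<pi> (star a) u) g = pairing H u (?S a g)"
    for a f g u
    unfolding fin_supp_space_simps by (fact psi_fin_supp adj Q_c Q_c' pair_\<pi> pair_\<pi>')+
  have \<pi>_U: "\<pi> a u \<in> carr D.U" if "u \<in> carr D.U" for a u
    by (rule D.transpose_U[where S = "?S a" and S' = "?S (star a)" and c = "c a" and R = "\<pi> a" and R' = "\<pi> (star a)"])
      (erule (1) tr | erule tr | rule c(1) that)+
  have \<pi>_norm: "ip_norm D.W (\<pi> a u) \<le> sqrt (c a) * ip_norm D.W u" if "u \<in> carr D.U" for a u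
    by (rule D.transpose_norm[where S = "?S a" and S' = "?S (star a)" and c = "c a" and R = "\<pi> a" and R' = "\<pi> (star a)"])
      (erule (1) tr | erule tr | rule c(1) that)+
  have \<pi>_emb: "\<pi> a (D.emb f) = D.emb (?S a f)" if "f \<in> fin_supp" for a f
    by (rule D.transpose_emb[where S = "?S a" and S' = "?S (star a)" and c = "c a" and R = "\<pi> a" and R' = "\<pi> (star a)"])
      (erule (1) tr | erule tr | rule c(1) | simp add: that)+
  have \<pi>_form: "form D.K (\<pi> a u) v = form D.K u (\<pi> (star a) v)"
    if "u \<in> carr D.U" "v \<in> carr D.U" for a u v
    by (rule D.form_K_transpose[where S = "?S a" and S' = "?S (star a)" and c = "c a" and R = "\<pi> a" and R' = "\<pi> (star a)"])
      (erule (1) tr | erule tr | rule c(1) that)+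
  have B_emb: "B \<xi> = D.emb (delta \<xi> 1)" for \<xi>
  proof (rule D.p_eqI)
    fix g assume g: "g \<in> carr (fin_supp_space H kernel_T)"
    have "B \<xi> = kernel_apply kernel_T (delta \<xi> 1)"
      by (auto simp: B_def star_one kernel_apply_delta[OF T_ops])
    then show "pairing H (B \<xi>) g = pairing H (D.emb (delta \<xi> 1)) g"
      using D.p_emb[of "delta \<xi> 1" g] g by (simp add: kernel_form_eq)
  qed
  obtain JK where KK: "krein_pair D.K (hilb D.K) JK" using krein_space_hilb[OF D.krein_space_K] .
  note KW = D.krein_pair_K
  have B_ops: "B \<in> hilbert_ops (hilb H) (hilb D.K)"
  proof (rule hilbert_ops_equiv[OF krein_pair_axioms krein_pair_axioms KW KK])
    have Tx: "T x (\<xi> + \<eta>) = T x \<xi> + T x \<eta>" "T x (scl H d \<xi>) = scl H d (T x \<xi>)" for x \<xi> \<eta> d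
      using T_ops krein_ops_iff by blast+
    have "ip_norm D.W (B \<xi>) \<le> sqrt (b 1) * ip_norm (hilb H) \<xi>" for \<xi>
    proof -
      have "ip_norm D.W (B \<xi>) = sqrt (Q (delta \<xi> 1))"
        by (simp add: B_emb D.ip_norm_W D.emb_U D.QK_emb del: D.U_simps(2))
      also have "\<dots> \<le> sqrt (b 1 * (ip_norm (hilb H) \<xi>)\<^sup>2)" using Q_b by simp
      finally show ?thesis using W.ip_norm_nonneg[of \<xi>] by (simp add: real_sqrt_mult)
    qed
    moreover have "B \<xi> \<in> carr D.U" for \<xi> unfolding B_emb by (rule D.emb_U) simp
    ultimately show "B \<in> hilbert_ops (hilb H) D.W"
      unfolding hilbert_ops_def
      by (auto simp: B_def Tx fun_scl_def fun_eq_iff simp del: D.U_simps(2))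
  qed
  have \<pi>_ops: "\<pi> a \<in> hilbert_ops (hilb D.K) (hilb D.K)" for a
  proof (rule hilbert_ops_equiv[OF KW KK KW KK])
    show "\<pi> a \<in> hilbert_ops D.W D.W"
      unfolding hilbert_ops_def mem_Collect_eq D.W_simps
    proof (intro conjI ballI allI exI[of _ "sqrt (c a)"])
      show "\<pi> a u \<in> carr D.U" "ip_norm D.W (\<pi> a u) \<le> sqrt (c a) * ip_norm D.W u"
        if "u \<in> carr D.U" for u using that by (rule \<pi>_U \<pi>_norm)+
    qed (simp_all add: \<pi>_def fun_scl_def fun_eq_iff)
  qed
  \<comment> \<open>If \<open>kernel_apply\<close> annihilates f, the dual functional is 0 at f,
    hence by self-duality so is Q, and no functional bounded by Q can see f. This is the implicit
    quotient by the null space.\<close>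
  have pairing_null: "pairing H u f = 0"
    if u: "u \<in> carr D.U" and f: "f \<in> fin_supp" and null: "kernel_apply kernel_T f = 0" for u f
  proof -
    have "MQ.dual f \<le> 0"
      by (rule MQ.dual_le) (simp_all add: kernel_form_eq null pairing_def)
    then have "Q f \<le> 0" using D.selfdual f by simp
    moreover have "0 \<le> Q f" using MQ.Q_nonneg f by simp
    ultimately show ?thesis using D.QK_bound[OF u, of f] f by simp
  qed
  \<comment> \<open>The combinations of deltas below are null vectors because T is linear, so every
    u in the space inherits linearity. It is what makes \<pi> linear in the algebra
    variable.\<close>
  have u_add: "u (x + y) = u x + u y" and u_scl: "u (sA d x) = scl H d (u x)"
    if u: "u \<in> carr D.U" for u x y d
  proof -
    have "form H (u (x + y) - (u x + u y)) \<xi> = 0" for \<xi>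
    proof -
      let ?f = "delta \<xi> (x + y) + fun_scl H (-1) (delta \<xi> x + delta \<xi> y)"
      have "kernel_apply kernel_T ?f = 0"
        by (simp only: kernel_apply_add[OF T_ops] kernel_apply_scl[OF T_ops] fin_supp_add fin_supp_scl
            delta_fin_supp)
          (auto simp: fun_eq_iff kernel_apply_delta[OF T_ops] A.star_add distrib_left T_add fun_scl_def)
      then have "pairing H u ?f = 0" by (intro pairing_null u fin_supp_add fin_supp_scl delta_fin_supp)
      then show ?thesis
        by (simp only: pairing_add_right pairing_scl_right pairing_delta fin_supp_add fin_supp_scl
            delta_fin_supp) (simp add: V.form_diff_left V.form_add_left algebra_simps)
    qed
    then have "u (x + y) - (u x + u y) = 0"
      using nondegenerate[of "u (x + y) - (u x + u y)"] V.form_swap[of "u (x + y) - (u x + u y)"] by simp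
    then show "u (x + y) = u x + u y" by simp
    have "form H (u (sA d x) - scl H d (u x)) \<xi> = 0" for \<xi>
    proof -
      \<comment> \<open>The conjugate of d matches \<open>star\<close>, which is conjugate-linear;
        the pairing conjugates once more in its second argument, so u itself comes out
        linear.\<close>
      let ?f = "delta \<xi> (sA d x) + fun_scl H (- cnj d) (delta \<xi> x)"
      have "kernel_apply kernel_T ?f = 0"
        by (simp only: kernel_apply_add[OF T_ops] kernel_apply_scl[OF T_ops] fin_supp_scl delta_fin_supp)
          (auto simp: fun_eq_iff kernel_apply_delta[OF T_ops] A.star_scale A.scale_mult_right T_scl fun_scl_def)
      then have "pairing H u ?f = 0" by (intro pairing_null u fin_supp_add fin_supp_scl delta_fin_supp)
      then show ?thesis
        by (simp only: pairing_add_right pairing_scl_right pairing_delta fin_supp_add fin_supp_scl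
            delta_fin_supp) (simp add: V.form_diff_left V.form_scl_left)
    qed
    then have "u (sA d x) - scl H d (u x) = 0"
      using nondegenerate[of "u (sA d x) - scl H d (u x)"] V.form_swap[of "u (sA d x) - scl H d (u x)"] by simp
    then show "u (sA d x) = scl H d (u x)" by simp
  qed
  have rep: "selfadjoint_representation sA star D.K \<pi>"
    unfolding selfadjoint_representation_def
  proof (intro conjI allI ballI)
    fix a a' :: 'a and u assume "u \<in> carr D.K"
    then have u: "u \<in> carr D.U" unfolding D.K_simps .
    show "Vector_Spaces.linear sA (scl D.K) (\<lambda>a. \<pi> a u)"
      unfolding Vector_Spaces.linear_iff using A.vector_space_axioms vector_space_fun_scl
      by (auto simp: \<pi>_def fun_eq_iff distrib_left u_add[OF u] u_scl[OF u] A.scale_mult_right fun_scl_def)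
    show "\<pi> (a * a') u = \<pi> a (\<pi> a' u)" by (simp add: \<pi>_def mult.assoc)
    show "\<pi> (star a) u = adjoint_op D.K D.K (\<pi> a) u"
      by (rule adjoint_op_eqI[OF KK KK \<pi>_ops, symmetric])
        (use u \<pi>_U \<pi>_form in \<open>simp_all del: D.U_simps(2)\<close>)
  qed (simp add: krein_ops_def \<pi>_ops)
  have B_adj: "adjoint_op H D.K B u = u 1" if u: "u \<in> carr D.U" for u
  proof (rule adjoint_op_eqI[OF krein_pair_axioms KK B_ops])
    fix \<xi>
    have "form D.K u (B \<xi>) = form H (u 1) \<xi>"
      unfolding B_emb using D.form_K_emb[OF u, of "delta \<xi> 1"] by (simp add: pairing_delta)
    moreover have "B \<xi> \<in> carr D.U" unfolding B_emb by (rule D.emb_U) simp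
    ultimately show "form H \<xi> (u 1) = form D.K (B \<xi>) u"
      using indefinite_ip.form_swap[OF krein_pair.axioms(1)[OF KK], of u "B \<xi>"] u
        V.form_swap[of "u 1" \<xi>] by (simp del: D.U_simps(2))
  qed simp
  have B_U: "B \<xi> \<in> carr D.U" for \<xi> unfolding B_emb by (rule D.emb_U) simp
  have dil: "stinespring_dilation sA star H T \<pi> D.K B"
    unfolding stinespring_dilation_def
  proof (intro conjI allI D.krein_space_K rep)
    show "B \<in> krein_ops H D.K" unfolding krein_ops_def by (rule B_ops)
    show "T a \<xi> = adjoint_op H D.K B (\<pi> a (B \<xi>))" for a \<xi>
      unfolding B_adj[OF \<pi>_U[OF B_U]] by (simp add: \<pi>_def B_def)
  qed
  let ?D = "module.span (scl D.K) (\<Union>a. range (\<lambda>\<xi>. \<pi> a (B \<xi>)))"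
  interpret K: indefinite_ip D.K by (rule krein_pair.axioms(1)[OF KK])
  have "krein_dense D.K ?D"
  proof (rule krein_denseI[OF KW KK])
    show "?D \<subseteq> carr D.K"
      using \<pi>_U B_U by (intro K.span_minimal K.subspace_carr) auto
    have emb_D: "D.emb f \<in> ?D" if "f \<in> fin_supp" for f
      using that
    proof (induction rule: fin_supp_induct)
      case zero
      have "D.emb 0 = 0"
        by (rule D.p_eqI) (simp only: D.p_emb D.p_zero IT.carr_zero IT.form_zero_left)
      then show ?case using K.span_zero by (simp only:)
    next
      case (add f x \<xi>)
      \<comment> \<open>\<psi> moves the delta at 1 to any point of the algebra, so the vectors
        \<open>\<pi> a (B \<xi>)\<close> span the range of \<open>emb\<close>, which is
        dense.\<close>
      have "D.emb (delta \<xi> x) = \<pi> (star x) (B \<xi>)"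
        by (simp add: B_emb \<pi>_emb psi_delta A.star_star)
      then have "D.emb (delta \<xi> x) \<in> ?D" by (intro K.span_base) blast
      then have "D.emb (delta \<xi> x) + D.emb f \<in> ?D" using add(2) by (rule K.span_add)
      moreover have "D.emb (delta \<xi> x + f) = D.emb (delta \<xi> x) + D.emb f"
        by (rule D.emb_add) (simp_all add: add(1))
      ultimately show ?case by (simp only:)
    qed
    show "\<exists>d\<in>?D. ip_norm D.W (u - d) < e" if "u \<in> carr D.K" "e > 0" for u e
      using D.dense_emb[of u e] that emb_D unfolding D.K_simps by (metis fin_supp_space_simps(2))
  qed
  with dil show ?thesis
    unfolding has_minimal_stinespring_dilation_def minimal_stinespring_dilation_def by blast
qed

end

theorem theorem7p2:
  fixes sA :: "complex \<Rightarrow> 'a::{ring,monoid_mult} \<Rightarrow> 'a" and star :: "'a \<Rightarrow> 'a"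
    and H :: "'h::ab_group_add ip_space" and T :: "'a \<Rightarrow> 'h \<Rightarrow> 'h"
  assumes A: "unital_star_algebra sA star"
    and H: "krein_space H" "carr H = UNIV"
    and T_ops: "\<And>a. T a \<in> krein_ops H H"
    and T_linear: "\<And>\<xi>. Vector_Spaces.linear sA (scl H) (\<lambda>a. T a \<xi>)"
    and T_hermitian: "\<And>a. T (star a) = adjoint_op H H (T a)"
  defines "K\<^sub>T \<equiv> \<lambda>x y. T (x * star y)"
    and "\<phi> \<equiv> \<lambda>a x. x * star a"
  shows "((\<exists>L\<in>phi_bounded_pd_kernels H \<phi>. kernel_le H (- L) K\<^sub>T \<and> kernel_le H K\<^sub>T L)
           \<longleftrightarrow> has_minimal_stinespring_dilation TYPE('a \<Rightarrow> 'h) sA star H T) \<and>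
         (has_minimal_stinespring_dilation TYPE('k::ab_group_add) sA star H T
           \<longrightarrow> has_minimal_stinespring_dilation TYPE('a \<Rightarrow> 'h) sA star H T)"
proof -
  obtain J where J: "krein_pair H (hilb H) J" using krein_space_hilb[OF H(1)] .
  interpret hermitian_map H J sA star T
    using A J H(2) T_ops T_linear T_hermitian
    by (intro hermitian_map.intro full_krein.intro full_krein_axioms.intro hermitian_map_axioms.intro)
  let ?kernel = "\<exists>L\<in>phi_bounded_pd_kernels H \<phi>. kernel_le H (- L) K\<^sub>T \<and> kernel_le H K\<^sub>T L"
  have "has_minimal_stinespring_dilation TYPE('a \<Rightarrow> 'h) sA star H T" if ?kernel
    using that dilation_if_kernel unfolding K\<^sub>T_def \<phi>_def by blast
  moreover have ?kernel if "has_minimal_stinespring_dilation TYPE('a \<Rightarrow> 'h) sA star H T"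
    using kernel_if_dilation[OF that] unfolding K\<^sub>T_def \<phi>_def by blast
  \<comment> \<open>The kernel does not mention the dilation space, so passing through it moves a
    dilation from any type to \<open>'a \<Rightarrow> 'h\<close>.\<close>
  moreover have ?kernel if "has_minimal_stinespring_dilation TYPE('k) sA star H T"
    using kernel_if_dilation[OF that] unfolding K\<^sub>T_def \<phi>_def by blast
  ultimately show ?thesis by blast
qed

end
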